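(* Let $A,B\in\mathbb{B}(\mathscr{H})_+$ and $X\in\mathcal{I}$. Then $$\int_{1/4}^{3/4}K(\nu)\,d\nu\leq\frac18K(1/4)+\frac14K(3/8).$$
   Context: $\mathscr{H}$ is a separable complex Hilbert space, $\mathbb{B}(\mathscr{H})_+$ is the cone of positive (semidefinite) bounded operators on $\mathscr{H}$, and $\mathbb{K}(\mathscr{H})$ is the ideal of compact operators. A unitarily invariant norm $|||\cdot|||:\mathbb{K}(\mathscr{H})\to[0,\infty]$ is a map $|||A|||=g(s(A))$, where $g$ is a symmetric gauge function and $s(A)=(s_1(A),s_2(A),\dots)$ is the sequence of singular values of $A$ (eigenvalues of $|A|=(A^*A)^{1/2}$ in decreasing order with multiplicity). Fix such a norm and put $\mathcal{I}=\{A\in\mathbb{K}(\mathscr{H}):|||A|||<\infty\}$, a two-sided ideal of $\mathbb{B}(\mathscr{H})$. For given $A,B,X$ define, for $\nu\in[0,1]$, $$K(\nu)=|||A^{\nu}XB^{1-\nu}-A^{1-\nu}XB^{\nu}|||.$$ *)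

theory Defs
  imports "HOL-Analysis.Analysis" "HOL-Computational_Algebra.Polynomial"
begin

text \<open>
  Complex Hilbert spaces are built on top of the real inner product class, so that the norm and
  the type of bounded (real-)linear maps are those of the library; the real inner product is the
  real part of the complex one. The complex inner product is linear in the first argument.
\<close>

class complex_hilbert_space = real_inner + complete_space +
  fixes scaleC :: "complex \<Rightarrow> 'a \<Rightarrow> 'a" (infixr \<open>*\<^sub>C\<close> 75)
    and cinner :: "'a \<Rightarrow> 'a \<Rightarrow> complex"
  assumes scaleC_add_right: "c *\<^sub>C (x + y) = c *\<^sub>C x + c *\<^sub>C y"
    and scaleC_add_left: "(c + d) *\<^sub>C x = c *\<^sub>C x + d *\<^sub>C x"
    and scaleC_scaleC: "c *\<^sub>C d *\<^sub>C x = (c * d) *\<^sub>C x"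
    and scaleC_one: "1 *\<^sub>C x = x"
    and scaleR_scaleC: "scaleR r x = complex_of_real r *\<^sub>C x"
    and cinner_commute: "cinner x y = cnj (cinner y x)"
    and cinner_add_left: "cinner (x + y) z = cinner x z + cinner y z"
    and cinner_scaleC_left: "cinner (c *\<^sub>C x) y = c * cinner x y"
    and inner_eq_Re_cinner: "inner x y = Re (cinner x y)"

instance complex_hilbert_space \<subseteq> banach ..

instantiation complex :: complex_hilbert_space
begin

definition "scaleC_complex = ((*) :: complex \<Rightarrow> complex \<Rightarrow> complex)"

definition "cinner_complex = (\<lambda>x y :: complex. x * cnj y)"

instance
  by standard
    (auto simp: scaleC_complex_def cinner_complex_def inner_complex_def algebra_simps
      scaleR_conv_of_real)

end

interpretation complex_vector:
  vector_space "scaleC :: complex \<Rightarrow> 'a \<Rightarrow> 'a :: complex_hilbert_space"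
  by standard (simp_all add: scaleC_add_right scaleC_add_left scaleC_scaleC scaleC_one)


text \<open>
  The type of bounded operators in the library only records real linearity;
  \<open>bounded_ops\<close> is the algebra of complex-linear bounded operators.
\<close>

definition bounded_ops :: "('a::complex_hilbert_space \<Rightarrow>\<^sub>L 'a) set" where
  "bounded_ops = {T. \<forall>c x. blinfun_apply T (c *\<^sub>C x) = c *\<^sub>C blinfun_apply T x}"

definition positive_ops :: "('a::complex_hilbert_space \<Rightarrow>\<^sub>L 'a) set" where
  "positive_ops = {T \<in> bounded_ops. \<forall>x. cinner (T x) x \<in> \<real>\<^sub>\<ge>\<^sub>0}"

definition compact_ops :: "('a::complex_hilbert_space \<Rightarrow>\<^sub>L 'a) set" where
  "compact_ops = {T \<in> bounded_ops. compact (closure (blinfun_apply T ` cball 0 1))}"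

definition op_adjoint :: "('a::complex_hilbert_space \<Rightarrow>\<^sub>L 'a) \<Rightarrow> 'a \<Rightarrow>\<^sub>L 'a" where
  "op_adjoint T = (THE S. \<forall>x y. cinner (T x) y = cinner x (blinfun_apply S y))"

definition op_spectrum :: "('a::complex_hilbert_space \<Rightarrow>\<^sub>L 'a) \<Rightarrow> complex set" where
  "op_spectrum T = {z. \<not> (\<exists>S\<in>bounded_ops.
     (\<forall>x. S (T x - z *\<^sub>C x) = x) \<and> (\<forall>x. T (S x) - z *\<^sub>C S x = x))}"

definition op_poly :: "real poly \<Rightarrow> ('a::complex_hilbert_space \<Rightarrow>\<^sub>L 'a) \<Rightarrow> 'a \<Rightarrow>\<^sub>L 'a" where
  "op_poly p T = (\<Sum>k\<le>degree p. coeff p k *\<^sub>R (((o\<^sub>L) T ^^ k) id_blinfun))"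

text \<open>
  Continuous functional calculus for a self-adjoint operator \<open>T\<close> and a real-valued function
  \<open>f\<close> continuous on its (real) spectrum: \<open>f(T)\<close> is the common norm limit of all
  \<open>p\<^sub>n(T)\<close>, for polynomials \<open>p\<^sub>n\<close> converging to \<open>f\<close> uniformly on the spectrum.
\<close>

definition cont_calculus ::
    "(real \<Rightarrow> real) \<Rightarrow> ('a::complex_hilbert_space \<Rightarrow>\<^sub>L 'a) \<Rightarrow> 'a \<Rightarrow>\<^sub>L 'a" where
  "cont_calculus f T = (THE F. \<forall>p.
     uniform_limit {t. complex_of_real t \<in> op_spectrum T} (\<lambda>n. poly (p n)) f sequentially
     \<longrightarrow> (\<lambda>n. op_poly (p n) T) \<longlonglongrightarrow> F)"

text \<open>
  Powers of positive operators. The library has \<open>0 powr 0 = 0\<close>; the convention here is that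
  the zeroth power is the identity.
\<close>

definition op_powr :: "('a::complex_hilbert_space \<Rightarrow>\<^sub>L 'a) \<Rightarrow> real \<Rightarrow> 'a \<Rightarrow>\<^sub>L 'a" where
  "op_powr T \<nu> = cont_calculus (\<lambda>t. if \<nu> = 0 then 1 else t powr \<nu>) T"

definition op_abs :: "('a::complex_hilbert_space \<Rightarrow>\<^sub>L 'a) \<Rightarrow> 'a \<Rightarrow>\<^sub>L 'a" where
  "op_abs T = op_powr (op_adjoint T o\<^sub>L T) (1/2)"

text \<open>
  The singular values of a compact operator (indexed from 0): the positive eigenvalues of its
  absolute value in decreasing order, repeated according to their multiplicity, padded with zeros
  if there are only finitely many. Convergence to 0 ensures that the cardinality below is that of
  a finite set. For noncompact operators the value is not meaningful.
\<close>

definition singular_values :: "('a::complex_hilbert_space \<Rightarrow>\<^sub>L 'a) \<Rightarrow> nat \<Rightarrow> real" where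
  "singular_values T = (THE s. antimono s \<and> (\<forall>n. 0 \<le> s n) \<and> s \<longlonglongrightarrow> 0 \<and>
     (\<forall>\<mu>>0. card {n. s n = \<mu>} = complex_vector.dim {x. op_abs T x = \<mu> *\<^sub>R x}))"


text \<open>
  A symmetric gauge function is a norm on the finitely supported real sequences that is invariant
  under permutations and sign changes of the entries. No normalization is imposed.
\<close>

definition fin_seqs :: "(nat \<Rightarrow> real) set" where
  "fin_seqs = {x. finite {n. x n \<noteq> 0}}"

definition symmetric_gauge :: "((nat \<Rightarrow> real) \<Rightarrow> real) \<Rightarrow> bool" where
  "symmetric_gauge g \<longleftrightarrow>
     (\<forall>x\<in>fin_seqs. 0 \<le> g x \<and> (g x = 0 \<longleftrightarrow> (\<forall>n. x n = 0))) \<and>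
     (\<forall>x\<in>fin_seqs. \<forall>a. g (\<lambda>n. a * x n) = \<bar>a\<bar> * g x) \<and>
     (\<forall>x\<in>fin_seqs. \<forall>y\<in>fin_seqs. g (\<lambda>n. x n + y n) \<le> g x + g y) \<and>
     (\<forall>x\<in>fin_seqs. \<forall>\<pi>. bij \<pi> \<longrightarrow> g (\<lambda>n. x (\<pi> n)) = g x) \<and>
     (\<forall>x\<in>fin_seqs. \<forall>\<epsilon>. (\<forall>n. \<epsilon> n \<in> {-1, 1}) \<longrightarrow> g (\<lambda>n. \<epsilon> n * x n) = g x)"

text \<open>
  The usual extension to arbitrary sequences with values in \<open>[0,\<infinity>]\<close>: the supremum (equivalently,
  limit) of the values at the truncations.
\<close>

definition gauge_ext :: "((nat \<Rightarrow> real) \<Rightarrow> real) \<Rightarrow> (nat \<Rightarrow> real) \<Rightarrow> ennreal" where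
  "gauge_ext g s = (SUP n. ennreal (g (\<lambda>k. if k < n then s k else 0)))"

definition ui_norm ::
    "((nat \<Rightarrow> real) \<Rightarrow> real) \<Rightarrow> ('a::complex_hilbert_space \<Rightarrow>\<^sub>L 'a) \<Rightarrow> ennreal" where
  "ui_norm g T = gauge_ext g (singular_values T)"

definition norm_ideal ::
    "((nat \<Rightarrow> real) \<Rightarrow> real) \<Rightarrow> ('a::complex_hilbert_space \<Rightarrow>\<^sub>L 'a) set" where
  "norm_ideal g = {T \<in> compact_ops. ui_norm g T < \<infinity>}"

definition heinz_diff_norm ::
    "((nat \<Rightarrow> real) \<Rightarrow> real) \<Rightarrow> ('a::complex_hilbert_space \<Rightarrow>\<^sub>L 'a) \<Rightarrow> ('a \<Rightarrow>\<^sub>L 'a) \<Rightarrow>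
      ('a \<Rightarrow>\<^sub>L 'a) \<Rightarrow> real \<Rightarrow> ennreal" where
  "heinz_diff_norm g A B X \<nu> =
     ui_norm g ((op_powr A \<nu> o\<^sub>L X o\<^sub>L op_powr B (1 - \<nu>)) -
                (op_powr A (1 - \<nu>) o\<^sub>L X o\<^sub>L op_powr B \<nu>))"

end

theory Submission
  imports Defs "HOL-Computational_Algebra.Fundamental_Theorem_Algebra"
begin

text \<open>
  Put \<open>T(\<nu>) = A\<^sup>\<nu> X B\<^bsup>1-\<nu>\<^esup> - A\<^bsup>1-\<nu>\<^esup> X B\<^sup>\<nu>\<close>, so that \<open>K(\<nu>)\<close> is the norm of \<open>T(\<nu>)\<close>. Since
  \<open>T(1 - \<nu>) = - T(\<nu>)\<close>, the function \<open>K\<close> is symmetric about \<open>1/2\<close> and vanishes there. Once \<open>K\<close> is known to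
  be convex, the claim is the trapezoidal rule on \<open>[1/4, 3/8]\<close> and \<open>[3/8, 1/2]\<close> and on their mirror images.

  Midpoint convexity is the arithmetic-geometric mean inequality
  \<open>2 |||C Y D||| \<le> |||C\<^sup>2 Y + Y D\<^sup>2|||\<close> in disguise: for \<open>C = A\<^sup>d\<close>, \<open>D = B\<^sup>d\<close> and a suitable \<open>Y\<close> one has
  \<open>C Y D = T(m)\<close> and \<open>C\<^sup>2 Y + Y D\<^sup>2 = T(m - d) + T(m + d)\<close> (\<open>heinz_diff_midpoint\<close>). The inequality is proved
  for sums of the \<open>n\<close> largest singular values (\<open>Ky_Fan_arithmetic_geometric_mean\<close>). If \<open>e\<^sub>j, f\<^sub>j\<close> are the
  singular vectors of \<open>C Y D\<close>, then \<open>(C f\<^sub>j, D e\<^sub>j)\<close> is an eigenvector of the block operator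
  \<open>(u, v) \<mapsto> (C\<^sup>2 Y v, D\<^sup>2 Y\<^sup>* u)\<close> for the \<open>j\<close>-th singular value. In an orthonormal basis obtained by
  Gram-Schmidt these eigenvalues are the diagonal entries of a triangular matrix; being real, they are also
  the diagonal entries of its self-adjoint part, which is built from \<open>C\<^sup>2 Y + Y D\<^sup>2\<close>. Ky Fan's maximum
  principle (\<open>Ky_Fan_bound\<close>) bounds their sum. Symmetric gauge functions are monotone under weak
  majorisation (\<open>gauge_weak_majorization\<close>), which carries the inequality over to the norm.

  To work with finite and continuous functions, all this is done for the gauge of the first \<open>n\<close>
  singular values. It is continuous in \<open>\<nu>\<close> because singular values are Lipschitz in the operator norm and
  \<open>A\<^sup>\<nu>\<close> is norm continuous for \<open>\<nu> > 0\<close>, and a continuous midpoint convex function lies below its chords. The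
  supremum over \<open>n\<close> is taken with monotone convergence.

  Two pieces of operator theory are developed on the way. The continuous functional calculus rests on the
  fact that a nonzero \<open>\<parallel>p(T)\<parallel>\<close> is attained by \<open>\<bar>p\<bar>\<close> on the spectrum of a self-adjoint \<open>T\<close>
  (\<open>norm_op_poly_attained_nonconst\<close>, \<open>op_poly_norm_le\<close>). The singular values of a compact operator and its
  singular vectors come from diagonalising \<open>\<bar>T\<bar>\<close> by repeatedly splitting off an eigenvector for the largest
  eigenvalue (\<open>dim_eigenspace\<close>, \<open>singular_value_decomposition\<close>).
\<close>

section \<open>Complex inner products and adjoints\<close>

lemma cinner_scaleC_right: "cinner x (c *\<^sub>C y) = cnj c * cinner x y"
  by (metis cinner_commute cinner_scaleC_left complex_cnj_mult)

lemma cinner_add_right: "cinner x (y + z) = cinner x y + cinner x z"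
  by (metis cinner_commute cinner_add_left complex_cnj_add)

lemma cinner_self: "cinner x x = complex_of_real ((norm x)\<^sup>2)"
proof (rule complex_eqI)
  show "Re (cinner x x) = Re (complex_of_real ((norm x)\<^sup>2))"
    using inner_eq_Re_cinner[of x x] by (simp add: power2_norm_eq_inner)
  have "Im (cinner x x) = - Im (cinner x x)"
    by (subst cinner_commute) simp
  then show "Im (cinner x x) = Im (complex_of_real ((norm x)\<^sup>2))"
    by simp
qed

lemma norm_scaleC: "norm (c *\<^sub>C x) = cmod c * norm x"
proof -
  have "complex_of_real ((norm (c *\<^sub>C x))\<^sup>2) = complex_of_real ((cmod c * norm x)\<^sup>2)"
    by (simp only: cinner_self[symmetric] cinner_scaleC_left cinner_scaleC_right)
      (simp add: cinner_self power_mult_distrib complex_norm_square mult.assoc[symmetric]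
        mult.commute[of "cnj c"] del: of_real_power)
  then have "(norm (c *\<^sub>C x))\<^sup>2 = (cmod c * norm x)\<^sup>2"
    using of_real_eq_iff by blast
  then show ?thesis
    by (simp add: power2_eq_iff_nonneg)
qed

lemma cinner_Cauchy_Schwarz: "cmod (cinner x y) \<le> norm x * norm y"
proof (cases "cinner x y = 0")
  case False
  define c where "c = cnj (cinner x y) / of_real (cmod (cinner x y))"
  have c: "cmod c = 1"
    using False by (simp add: c_def norm_divide)
  have "Re (cinner (c *\<^sub>C x) y) = cmod (cinner x y)"
  proof -
    have "cnj (cinner x y) * cinner x y = of_real ((cmod (cinner x y))\<^sup>2)"
      by (metis complex_norm_square mult.commute of_real_power)
    then have "c * cinner x y = of_real (cmod (cinner x y))"
      using False by (simp add: c_def power2_eq_square)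
    then show ?thesis
      by (simp add: cinner_scaleC_left)
  qed
  then show ?thesis
    using norm_cauchy_schwarz[of "c *\<^sub>C x" y] c by (simp add: inner_eq_Re_cinner norm_scaleC)
qed simp

interpretation cinner: bounded_bilinear "cinner :: 'a::complex_hilbert_space \<Rightarrow> 'a \<Rightarrow> complex"
proof
  show "\<exists>K. \<forall>x y :: 'a. cmod (cinner x y) \<le> norm x * norm y * K"
    using cinner_Cauchy_Schwarz by (intro exI[of _ 1]) auto
  fix r and x y :: 'a
  show "cinner (r *\<^sub>R x) y = r *\<^sub>R cinner x y"
    by (simp only: scaleR_scaleC[of r x] cinner_scaleC_left scaleR_conv_of_real)
  show "cinner x (r *\<^sub>R y) = r *\<^sub>R cinner x y"
    by (simp only: scaleR_scaleC[of r y] cinner_scaleC_right scaleR_conv_of_real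
        complex_cnj_complex_of_real)
qed (auto simp: cinner_add_left cinner_add_right)

interpretation scaleC: bounded_bilinear "scaleC :: complex \<Rightarrow> 'a \<Rightarrow> 'a::complex_hilbert_space"
proof
  show "\<exists>K. \<forall>c (x :: 'a). norm (c *\<^sub>C x) \<le> norm c * norm x * K"
    by (intro exI[of _ 1]) (auto simp: norm_scaleC)
  fix r c and x :: 'a
  show "(r *\<^sub>R c) *\<^sub>C x = r *\<^sub>R c *\<^sub>C x"
    by (simp only: scaleR_scaleC[of r "c *\<^sub>C x"] scaleC_scaleC scaleR_conv_of_real)
  show "c *\<^sub>C r *\<^sub>R x = r *\<^sub>R c *\<^sub>C x"
    by (simp only: scaleR_scaleC[of r] scaleC_scaleC mult.commute)
qed (auto simp: scaleC_add_left scaleC_add_right)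

text \<open>
  Real and imaginary part of the complex inner product are both values of the real one. This is
  how statements about the real inner product, such as the Riesz representation, are transferred.
\<close>

lemma Im_cinner: "Im (cinner x y) = - inner (\<i> *\<^sub>C x) y"
  by (simp add: inner_eq_Re_cinner cinner_scaleC_left)

lemma cinner_eqI_left: "(\<And>y. cinner x y = cinner z y) \<Longrightarrow> x = z"
  by (metis cinner.diff_left cinner_self eq_iff_diff_eq_0 of_real_eq_0_iff power_eq_0_iff norm_eq_zero)

lemma cinner_eqI_right: "(\<And>y. cinner y x = cinner y z) \<Longrightarrow> x = z"
  by (metis cinner_eqI_left cinner_commute)

text \<open>
  A functional attains its norm on the unit sphere: by the parallelogram law a maximising sequence
  is Cauchy. At a maximiser \<open>u\<close> the first variation vanishes, which makes the functional a multiple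
  of the inner product with \<open>u\<close>.
\<close>

lemma Riesz_representation:
  fixes \<phi> :: "'a::{real_inner, complete_space} \<Rightarrow> real"
  assumes "bounded_linear \<phi>"
  shows "\<exists>u. \<forall>y. \<phi> y = inner u y"
proof -
  interpret \<phi>: bounded_linear \<phi> by fact
  define N where "N = onorm \<phi>"
  have le: "\<bar>\<phi> x\<bar> \<le> N * norm x" for x
    using onorm[OF assms, of x] by (simp add: N_def)
  have "N \<ge> 0"
    using onorm_pos_le[OF assms] by (simp add: N_def)
  show ?thesis
  proof (cases "N = 0")
    case True
    then show ?thesis
      using le by (intro exI[of _ 0]) simp
  next
    case False
    with \<open>N \<ge> 0\<close> have N: "N > 0" by simp
    have ex: "\<exists>x. norm x = 1 \<and> \<phi> x > b" if "b < N" "b \<ge> 0" for b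
    proof (rule ccontr)
      assume contr: "\<nexists>x. norm x = 1 \<and> \<phi> x > b"
      have "norm (\<phi> x) \<le> b * norm x" for x
      proof (cases "x = 0")
        case False
        have b: "\<phi> (sgn y) \<le> b" if "y \<noteq> 0" for y
          using contr that norm_sgn[of y] by force
        have "\<phi> (sgn y) = \<phi> y / norm y" for y
          by (simp add: sgn_div_norm \<phi>.scaleR divide_inverse mult.commute)
        with b[of x] b[of "-x"] False show ?thesis
          by (auto simp: \<phi>.neg divide_simps abs_if split: if_splits)
      qed (simp add: \<phi>.zero)
      then have "onorm \<phi> \<le> b"
        by (rule onorm_bound[OF \<open>b \<ge> 0\<close>])
      with \<open>b < N\<close> show False
        by (simp add: N_def)
    qed
    have "\<exists>x. norm x = 1 \<and> \<phi> x > N * (1 - 1 / Suc n)" for n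
      using N by (intro ex) (auto simp: field_simps)
    then obtain x where nx: "\<And>n. norm (x n) = 1" and fx: "\<And>n. \<phi> (x n) > N * (1 - 1 / Suc n)"
      by metis
    have close: "(norm (x n - x m))\<^sup>2 \<le> 8 / Suc M" if "n \<ge> M" "m \<ge> M" for n m M
    proof -
      have "N * (1 - 1 / Suc M) \<le> N * (1 - 1 / Suc k)" if "k \<ge> M" for k
        using N that by (intro mult_left_mono) (auto simp: frac_le)
      then have "N * (2 * (1 - 1 / Suc M)) \<le> \<phi> (x n + x m)"
        using fx[of n] fx[of m] that unfolding \<phi>.add by (smt (verit) distrib_left)
      also have "\<dots> \<le> N * norm (x n + x m)"
        using le by (smt (verit))
      finally have "2 * (1 - 1 / Suc M) \<le> norm (x n + x m)"
        using N by simp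
      then have "(2 * (1 - 1 / Suc M))\<^sup>2 \<le> (norm (x n + x m))\<^sup>2"
        by (intro power_mono) (auto simp: field_simps)
      moreover have "(norm (x n - x m))\<^sup>2 + (norm (x n + x m))\<^sup>2 = 2 * (norm (x n))\<^sup>2 + 2 * (norm (x m))\<^sup>2"
        by (simp add: power2_norm_eq_inner inner_diff inner_add inner_commute)
      moreover have "4 - 8 / Suc M \<le> (2 * (1 - 1 / Suc M))\<^sup>2"
        by (simp add: power2_eq_square algebra_simps)
      ultimately show ?thesis
        by (simp add: nx)
    qed
    have "Cauchy x"
    proof (rule metric_CauchyI)
      fix e :: real assume "e > 0"
      then obtain M where M: "8 / e\<^sup>2 < real M"
        using reals_Archimedean2 by blast
      have "dist (x m) (x n) < e" if "m \<ge> M" "n \<ge> M" for m n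
      proof -
        have "8 < e\<^sup>2 * Suc M"
          using M \<open>e > 0\<close> by (simp add: field_simps) (smt (verit) zero_less_power)
        then have "8 / Suc M < e\<^sup>2"
          by (simp add: field_simps)
        with close[OF that] have "(norm (x m - x n))\<^sup>2 < e\<^sup>2"
          by simp
        then show ?thesis
          using \<open>e > 0\<close> by (simp add: dist_norm power2_less_imp_less)
      qed
      then show "\<exists>M. \<forall>m\<ge>M. \<forall>n\<ge>M. dist (x m) (x n) < e" by blast
    qed
    then obtain u where u: "x \<longlonglongrightarrow> u"
      by (meson Cauchy_convergent_iff convergent_def)
    have nu: "norm u = 1"
      using tendsto_norm[OF u] nx by (simp add: LIMSEQ_const_iff)
    have "(\<lambda>n. N * (1 - 1 / Suc n)) \<longlonglongrightarrow> N * (1 - 0)"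
      by (intro tendsto_intros LIMSEQ_Suc[OF lim_1_over_n])
    then have "N \<le> \<phi> u"
      using LIMSEQ_le[OF _ \<phi>.tendsto[OF u]] fx by (fastforce intro: less_imp_le)
    with le[of u] nu have fu: "\<phi> u = N"
      by simp
    have "\<phi> y = inner (N *\<^sub>R u) y" for y
    proof -
      \<comment> \<open>\<open>a\<close> is the first variation: \<open>\<phi>(u + t y)\<^sup>2 \<le> N\<^sup>2 \<parallel>u + t y\<parallel>\<^sup>2\<close> reads \<open>t a \<le> t\<^sup>2 C\<close>\<close>
      define a where "a = 2 * N * (\<phi> y - N * inner u y)"
      define C where "C = N\<^sup>2 * (norm y)\<^sup>2 - (\<phi> y)\<^sup>2"
      have tC: "t * a \<le> t\<^sup>2 * C" for t
      proof -
        have "(\<phi> (u + t *\<^sub>R y))\<^sup>2 \<le> (N * norm (u + t *\<^sub>R y))\<^sup>2"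
          using le N by (intro abs_le_square_iff[THEN iffD1]) (simp add: abs_mult)
        moreover have "(norm (u + t *\<^sub>R y))\<^sup>2 = 1 + 2 * t * inner u y + t\<^sup>2 * (norm y)\<^sup>2"
        proof -
          have "inner u u = 1" using nu by (simp flip: power2_norm_eq_inner)
          then show ?thesis
            unfolding power2_norm_eq_inner by (simp add: inner_add inner_commute power2_eq_square algebra_simps)
        qed
        ultimately show ?thesis
          by (simp add: \<phi>.add \<phi>.scaleR fu a_def C_def power_mult_distrib algebra_simps power2_eq_square)
      qed
      have "a = 0"
      proof (rule ccontr)
        assume "a \<noteq> 0"
        define D where "D = \<bar>C\<bar> + 1"
        have "D > 0" "C < D" by (auto simp: D_def)
        have "a\<^sup>2 / D \<le> a\<^sup>2 / D * (C / D)"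
          using tC[of "a / D"] by (simp add: power2_eq_square)
        then have "1 \<le> C / D"
          using \<open>a \<noteq> 0\<close> \<open>D > 0\<close> mult_le_cancel_left_pos[of "a\<^sup>2 / D" 1 "C / D"] by simp
        with \<open>D > 0\<close> \<open>C < D\<close> show False
          by simp
      qed
      then show ?thesis
        using N by (simp add: a_def)
    qed
    then show ?thesis by blast
  qed
qed

lemma bounded_opsD: "T \<in> bounded_ops \<Longrightarrow> T (c *\<^sub>C x) = c *\<^sub>C T x"
  by (simp add: bounded_ops_def)

text \<open>
  The adjoint is first found for the real inner product; it is an adjoint for the complex one
  because \<open>T\<close> commutes with multiplication by \<open>\<i>\<close>.
\<close>

lemma op_adjoint_exists:
  fixes T :: "'a::complex_hilbert_space \<Rightarrow>\<^sub>L 'a"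
  assumes T: "T \<in> bounded_ops"
  shows "\<exists>S\<in>bounded_ops. \<forall>x y. cinner (T x) y = cinner x (blinfun_apply S y)"
proof -
  have "\<exists>u. \<forall>x. inner (T x) y = inner u x" for y
    by (intro Riesz_representation bounded_linear_compose[OF bounded_linear_inner_left]
        blinfun.bounded_linear_right)
  then obtain S where "\<And>x y. inner (T x) y = inner (S y) x"
    by metis
  then have S: "inner (T x) y = inner x (S y)" for x y
    by (simp add: inner_commute)
  have cS: "cinner (T x) y = cinner x (S y)" for x y
  proof (rule complex_eqI)
    show "Re (cinner (T x) y) = Re (cinner x (S y))"
      using S[of x y] by (simp add: inner_eq_Re_cinner)
    show "Im (cinner (T x) y) = Im (cinner x (S y))"
      using S[of "\<i> *\<^sub>C x" y] by (simp add: Im_cinner bounded_opsD[OF T])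
  qed
  have "bounded_linear S"
  proof (rule bounded_linear_intro[where K = "norm T"])
    show "S (x + y) = S x + S y" for x y
      by (rule cinner_eqI_right) (simp add: cinner_add_right flip: cS)
    show "S (r *\<^sub>R x) = r *\<^sub>R S x" for r x
      by (rule cinner_eqI_right) (simp add: cinner.scaleR_right flip: cS)
    show "norm (S y) \<le> norm y * norm T" for y
    proof -
      have "(norm (S y))\<^sup>2 = inner (T (S y)) y"
        by (simp add: S power2_norm_eq_inner)
      also have "\<dots> \<le> norm T * norm (S y) * norm y"
        by (meson norm_cauchy_schwarz norm_blinfun order_trans mult_right_mono norm_ge_zero)
      finally show ?thesis
        by (cases "norm (S y) = 0") (auto simp: power2_eq_square algebra_simps mult_le_cancel_left)
    qed
  qed
  then have *: "blinfun_apply (Blinfun S) = S"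
    by (rule bounded_linear_Blinfun_apply)
  have "Blinfun S \<in> bounded_ops"
    unfolding bounded_ops_def mem_Collect_eq *
    by (intro allI, rule cinner_eqI_right) (simp add: cinner_scaleC_right flip: cS)
  then show ?thesis
    using cS * by (intro bexI[of _ "Blinfun S"]) auto
qed

lemma
  fixes T :: "'a::complex_hilbert_space \<Rightarrow>\<^sub>L 'a"
  assumes T: "T \<in> bounded_ops"
  shows cinner_op_adjoint: "cinner (T x) y = cinner x (op_adjoint T y)"
    and op_adjoint_bounded_ops: "op_adjoint T \<in> bounded_ops"
proof -
  obtain S where S: "S \<in> bounded_ops" "\<And>x y. cinner (T x) y = cinner x (blinfun_apply S y)"
    using op_adjoint_exists[OF T] by blast
  have "op_adjoint T = S"
    unfolding op_adjoint_def
  proof (rule the_equality)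
    fix R :: "'a \<Rightarrow>\<^sub>L 'a" assume "\<forall>x y. cinner (T x) y = cinner x (blinfun_apply R y)"
    then show "R = S"
      using S(2) by (metis blinfun_eqI cinner_eqI_right)
  qed (use S in auto)
  with S show "cinner (T x) y = cinner x (op_adjoint T y)" "op_adjoint T \<in> bounded_ops"
    by auto
qed

lemma cinner_op_adjoint': "T \<in> bounded_ops \<Longrightarrow> cinner x (T y) = cinner (op_adjoint T x) y"
  by (metis cinner_op_adjoint cinner_commute)

lemma bounded_ops_compose: "S \<in> bounded_ops \<Longrightarrow> T \<in> bounded_ops \<Longrightarrow> S o\<^sub>L T \<in> bounded_ops"
  by (simp add: bounded_ops_def)

lemma bounded_ops_add: "S \<in> bounded_ops \<Longrightarrow> T \<in> bounded_ops \<Longrightarrow> S + T \<in> bounded_ops"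
  by (simp add: bounded_ops_def blinfun.add_left scaleC_add_right)

lemma bounded_ops_diff: "S \<in> bounded_ops \<Longrightarrow> T \<in> bounded_ops \<Longrightarrow> S - T \<in> bounded_ops"
  by (simp add: bounded_ops_def blinfun.diff_left scaleC.diff_right)

lemma bounded_ops_id: "id_blinfun \<in> bounded_ops"
  by (simp add: bounded_ops_def)

lemma bounded_ops_scaleR: "T \<in> bounded_ops \<Longrightarrow> r *\<^sub>R T \<in> bounded_ops"
  by (simp add: bounded_ops_def blinfun.scaleR_left scaleC.scaleR_right)

lemma bounded_ops_limit:
  assumes "\<And>n. S n \<in> bounded_ops" and "S \<longlonglongrightarrow> T"
  shows "T \<in> bounded_ops"
proof -
  have lim: "(\<lambda>n. S n x) \<longlonglongrightarrow> T x" for x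
    using assms(2) by (intro blinfun.tendsto tendsto_const)
  show ?thesis
    unfolding bounded_ops_def mem_Collect_eq
  proof (intro allI)
    fix c x
    have "(\<lambda>n. c *\<^sub>C S n x) \<longlonglongrightarrow> c *\<^sub>C T x"
      by (intro scaleC.tendsto lim tendsto_const)
    moreover have "(\<lambda>n. c *\<^sub>C S n x) = (\<lambda>n. S n (c *\<^sub>C x))"
      by (simp add: bounded_opsD[OF assms(1)])
    ultimately show "T (c *\<^sub>C x) = c *\<^sub>C T x"
      using LIMSEQ_unique[OF lim] by metis
  qed
qed

section \<open>Polynomials of an operator\<close>

definition self_adjoint :: "('a::complex_hilbert_space \<Rightarrow>\<^sub>L 'a) \<Rightarrow> bool" where
  "self_adjoint T \<longleftrightarrow> T \<in> bounded_ops \<and> (\<forall>x y. cinner (T x) y = cinner x (T y))"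

text \<open>
  A complex polynomial in \<open>T\<close> is a plain function, because the scalars of the operator type are real.
\<close>

definition complex_op_poly ::
    "complex poly \<Rightarrow> ('a::complex_hilbert_space \<Rightarrow>\<^sub>L 'a) \<Rightarrow> 'a \<Rightarrow> 'a" where
  "complex_op_poly p T x = (\<Sum>k\<le>degree p. coeff p k *\<^sub>C (blinfun_apply T ^^ k) x)"

lemma complex_op_poly_altdef:
  assumes "degree p \<le> n"
  shows "complex_op_poly p T x = (\<Sum>k\<le>n. coeff p k *\<^sub>C (blinfun_apply T ^^ k) x)"
  unfolding complex_op_poly_def using assms
  by (intro sum.mono_neutral_left) (auto simp: coeff_eq_0 scaleC.zero_left)

lemma complex_op_poly_0 [simp]: "complex_op_poly 0 T x = 0"
  by (simp add: complex_op_poly_def scaleC.zero_left)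

lemma complex_op_poly_pCons:
  assumes T: "T \<in> bounded_ops"
  shows "complex_op_poly (pCons a p) T x = a *\<^sub>C x + T (complex_op_poly p T x)"
proof -
  have "complex_op_poly (pCons a p) T x
      = (\<Sum>k\<le>Suc (degree p). coeff (pCons a p) k *\<^sub>C (blinfun_apply T ^^ k) x)"
    by (intro complex_op_poly_altdef degree_pCons_le)
  also have "\<dots> = a *\<^sub>C x + (\<Sum>k\<le>degree p. coeff p k *\<^sub>C T ((blinfun_apply T ^^ k) x))"
    by (subst sum.atMost_Suc_shift) simp
  finally show ?thesis
    by (simp add: complex_op_poly_def blinfun.sum_right bounded_opsD[OF T])
qed

lemma complex_op_poly_add:
  "complex_op_poly (p + q) T x = complex_op_poly p T x + complex_op_poly q T x"
proof -
  define n where "n = max (degree p) (degree q)"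
  have "degree (p + q) \<le> n" "degree p \<le> n" "degree q \<le> n"
    using degree_add_le_max[of p q] by (auto simp: n_def)
  then show ?thesis
    by (simp add: complex_op_poly_altdef[where n = n] scaleC_add_left sum.distrib)
qed

lemma complex_op_poly_smult:
  "complex_op_poly (smult c p) T x = c *\<^sub>C complex_op_poly p T x"
  by (simp add: complex_op_poly_altdef[OF degree_smult_le] complex_op_poly_def
      scaleC.sum_right scaleC_scaleC)

lemma complex_op_poly_linear_mult:
  assumes T: "T \<in> bounded_ops"
  shows "complex_op_poly ([:- r, 1:] * q) T x = T (complex_op_poly q T x) - r *\<^sub>C complex_op_poly q T x"
proof -
  have "[:- r, 1:] * q = smult (- r) q + pCons 0 q"
    by simp
  then show ?thesis
    by (simp only: complex_op_poly_add complex_op_poly_smult complex_op_poly_pCons[OF T])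
      (simp add: scaleC.minus_left scaleC.zero_left)
qed

definition bounded_below :: "('a::real_normed_vector \<Rightarrow> 'b::real_normed_vector) \<Rightarrow> bool" where
  "bounded_below f \<longleftrightarrow> (\<exists>c>0. \<forall>x. c * norm x \<le> norm (f x))"

text \<open>
  Over the complex numbers a polynomial in \<open>T\<close> is a product of factors \<open>T - r\<close>, and a product of
  operators that are bounded below is bounded below.
\<close>

lemma bounded_below_complex_op_poly:
  fixes T :: "'a::complex_hilbert_space \<Rightarrow>\<^sub>L 'a"
  assumes T: "T \<in> bounded_ops"
    and "p \<noteq> 0" "\<And>r. poly p r = 0 \<Longrightarrow> bounded_below (\<lambda>x. T x - r *\<^sub>C x)"
  shows "bounded_below (complex_op_poly p T)"
  using assms(2,3)
proof (induction "degree p" arbitrary: p)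
  case 0
  then obtain a where a: "p = [:a:]"
    by (metis degree_eq_zeroE)
  with 0 have "a \<noteq> 0" by simp
  then show ?case
    unfolding bounded_below_def a
    by (intro exI[of _ "cmod a"])
      (simp add: complex_op_poly_pCons[OF T] norm_scaleC blinfun.zero_right)
next
  case (Suc n)
  then obtain r where r: "poly p r = 0"
    using alg_closed_imp_poly_has_root[of p] by auto
  then obtain q where q: "p = [:- r, 1:] * q"
    by (meson dvdE poly_eq_0_iff_dvd)
  with Suc.prems have "q \<noteq> 0" by auto
  then have deg: "n = degree q"
    using Suc.hyps(2) unfolding q by (subst (asm) degree_mult_eq) auto
  have "bounded_below (complex_op_poly q T)"
    using Suc.hyps(1)[OF deg \<open>q \<noteq> 0\<close>] Suc.prems(2) by (simp add: q)
  then obtain c where c: "c > 0" "\<And>x. c * norm x \<le> norm (complex_op_poly q T x)"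
    by (auto simp: bounded_below_def)
  obtain d where d: "d > 0" "\<And>x. d * norm x \<le> norm (T x - r *\<^sub>C x)"
    using Suc.prems(2)[OF r] by (auto simp: bounded_below_def)
  show ?case
    unfolding bounded_below_def
  proof (intro exI[of _ "d * c"] conjI allI)
    fix x
    have "d * (c * norm x) \<le> d * norm (complex_op_poly q T x)"
      using c(2) d(1) by (intro mult_left_mono) auto
    also have "\<dots> \<le> norm (complex_op_poly p T x)"
      unfolding q complex_op_poly_linear_mult[OF T] by (rule d(2))
    finally show "d * c * norm x \<le> norm (complex_op_poly p T x)"
      by (simp add: mult.assoc)
  qed (use c d in simp)
qed

lemma op_poly_altdef:
  assumes "degree p \<le> n"
  shows "op_poly p T = (\<Sum>k\<le>n. coeff p k *\<^sub>R (((o\<^sub>L) T ^^ k) id_blinfun))"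
  unfolding op_poly_def using assms
  by (intro sum.mono_neutral_left) (auto simp: coeff_eq_0)

lemma op_poly_0 [simp]: "op_poly 0 T = 0"
  by (simp add: op_poly_def)

lemma op_poly_pCons: "op_poly (pCons a p) T = a *\<^sub>R id_blinfun + (T o\<^sub>L op_poly p T)"
proof -
  have "op_poly (pCons a p) T
      = (\<Sum>k\<le>Suc (degree p). coeff (pCons a p) k *\<^sub>R (((o\<^sub>L) T ^^ k) id_blinfun))"
    by (intro op_poly_altdef degree_pCons_le)
  also have "\<dots> = a *\<^sub>R id_blinfun + (\<Sum>k\<le>degree p. coeff p k *\<^sub>R (T o\<^sub>L ((o\<^sub>L) T ^^ k) id_blinfun))"
    by (subst sum.atMost_Suc_shift) simp
  finally show ?thesis
    by (simp add: op_poly_def bounded_bilinear.sum_right[OF bounded_bilinear_blinfun_compose]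
        bounded_bilinear.scaleR_right[OF bounded_bilinear_blinfun_compose])
qed

lemma op_poly_add: "op_poly (p + q) T = op_poly p T + op_poly q T"
proof -
  define n where "n = max (degree p) (degree q)"
  have "degree (p + q) \<le> n" "degree p \<le> n" "degree q \<le> n"
    using degree_add_le_max[of p q] by (auto simp: n_def)
  then show ?thesis
    by (simp add: op_poly_altdef[where n = n] scaleR_add_left sum.distrib)
qed

lemma op_poly_smult: "op_poly (smult c p) T = c *\<^sub>R op_poly p T"
  by (simp add: op_poly_altdef[OF degree_smult_le] op_poly_def scaleR_sum_right)

lemma op_poly_diff: "op_poly (p - q) T = op_poly p T - op_poly q T"
  using op_poly_add[of p "smult (-1) q" T] op_poly_smult[of "-1" q T] by simp

lemma op_poly_mult: "op_poly (p * q) T = op_poly p T o\<^sub>L op_poly q T"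
proof (induction p)
  case (pCons a p)
  have "op_poly (pCons a p * q) T = a *\<^sub>R op_poly q T + (T o\<^sub>L (op_poly p T o\<^sub>L op_poly q T))"
    by (simp add: op_poly_add op_poly_smult op_poly_pCons pCons.IH)
  then show ?case
    by (intro blinfun_eqI) (simp add: op_poly_pCons blinfun.bilinear_simps)
qed simp

lemma op_poly_eq_complex_op_poly:
  assumes "T \<in> bounded_ops"
  shows "op_poly p T x = complex_op_poly (map_poly complex_of_real p) T x"
proof (induction p)
  case (pCons a p)
  then show ?case
    by (simp add: op_poly_pCons complex_op_poly_pCons[OF assms] map_poly_pCons
        blinfun.bilinear_simps scaleR_scaleC)
qed simp

lemma poly_map_poly_complex_of_real:
  "poly (map_poly complex_of_real p) (complex_of_real r) = complex_of_real (poly p r)"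
  by (induction p) (auto simp: map_poly_pCons)

lemma self_adjoint_bounded_ops: "self_adjoint T \<Longrightarrow> T \<in> bounded_ops"
  by (simp add: self_adjoint_def)

lemma self_adjointD: "self_adjoint T \<Longrightarrow> cinner (T x) y = cinner x (T y)"
  by (simp add: self_adjoint_def)

lemma self_adjoint_op_poly:
  assumes "self_adjoint T"
  shows "self_adjoint (op_poly p T)" and "op_poly p T (T x) = T (op_poly p T x)"
proof -
  have "self_adjoint (op_poly p T) \<and> (\<forall>x. op_poly p T (T x) = T (op_poly p T x))"
  proof (induction p)
    case 0
    then show ?case
      by (auto simp: self_adjoint_def bounded_ops_def cinner.zero_left cinner.zero_right
          scaleC.zero_right blinfun.zero_right)
  next
    case (pCons a p)
    then have IH: "self_adjoint (op_poly p T)" "\<And>x. op_poly p T (T x) = T (op_poly p T x)"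
      by auto
    have "op_poly (pCons a p) T \<in> bounded_ops"
      using IH(1) assms unfolding op_poly_pCons
      by (intro bounded_ops_add bounded_ops_scaleR bounded_ops_id bounded_ops_compose)
        (auto simp: self_adjoint_def)
    moreover have "cinner (op_poly (pCons a p) T x) y = cinner x (op_poly (pCons a p) T y)" for x y
      by (simp add: op_poly_pCons blinfun.bilinear_simps cinner.add_left cinner.add_right
          cinner.scaleR_left cinner.scaleR_right self_adjointD[OF assms] self_adjointD[OF IH(1)]
          IH(2))
    moreover have "op_poly (pCons a p) T (T x) = T (op_poly (pCons a p) T x)" for x
      by (simp add: op_poly_pCons blinfun.bilinear_simps IH(2))
    ultimately show ?case
      by (simp add: self_adjoint_def)
  qed
  then show "self_adjoint (op_poly p T)" "op_poly p T (T x) = T (op_poly p T x)"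
    by auto
qed

lemma self_adjoint_cinner_self:
  assumes "self_adjoint T"
  shows "cinner (T x) x = complex_of_real (inner (T x) x)"
proof (rule complex_eqI)
  have "cinner (T x) x = cnj (cinner (T x) x)"
    using assms cinner_commute by (metis self_adjointD)
  then show "Im (cinner (T x) x) = Im (complex_of_real (inner (T x) x))"
    by (metis Im_complex_of_real complex_In_mult_cnj_zero Reals_cnj_iff complex_is_Real_iff)
qed (simp add: inner_eq_Re_cinner)

text \<open>
  The form \<open>\<langle>T x, x\<rangle>\<close> is real, so \<open>\<langle>T x - r x, x\<rangle>\<close> has the imaginary part \<open>- Im r \<parallel>x\<parallel>\<^sup>2\<close>.
\<close>

lemma self_adjoint_bounded_below:
  fixes T :: "'a::complex_hilbert_space \<Rightarrow>\<^sub>L 'a"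
  assumes "self_adjoint T" "Im r \<noteq> 0"
  shows "bounded_below (\<lambda>x. T x - r *\<^sub>C x)"
  unfolding bounded_below_def
proof (intro exI[of _ "\<bar>Im r\<bar>"] conjI allI)
  fix x
  have "cinner (T x - r *\<^sub>C x) x = of_real (inner (T x) x) - r * of_real ((norm x)\<^sup>2)"
    by (simp add: cinner.diff_left cinner_scaleC_left self_adjoint_cinner_self[OF assms(1)] cinner_self)
  then have "Im (cinner (T x - r *\<^sub>C x) x) = - Im r * (norm x)\<^sup>2"
    by simp
  then have "\<bar>Im r\<bar> * norm x * norm x \<le> norm (T x - r *\<^sub>C x) * norm x"
    using order_trans[OF abs_Im_le_cmod cinner_Cauchy_Schwarz[of "T x - r *\<^sub>C x" x]]
    by (simp add: abs_mult power2_eq_square mult.assoc)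
  then show "\<bar>Im r\<bar> * norm x \<le> norm (T x - r *\<^sub>C x)"
    by (cases "x = 0") auto
qed (use assms in auto)

lemma not_bounded_below_op_spectrum:
  fixes T :: "'a::complex_hilbert_space \<Rightarrow>\<^sub>L 'a"
  assumes "\<not> bounded_below (\<lambda>x. T x - r *\<^sub>C x)"
  shows "r \<in> op_spectrum T"
  unfolding op_spectrum_def mem_Collect_eq
proof
  assume "\<exists>S\<in>bounded_ops. (\<forall>x. S (T x - r *\<^sub>C x) = x) \<and> (\<forall>x. T (S x) - r *\<^sub>C S x = x)"
  then obtain S where S: "\<And>x. blinfun_apply S (T x - r *\<^sub>C x) = x"
    by blast
  have "bounded_below (\<lambda>x. T x - r *\<^sub>C x)"
    unfolding bounded_below_def
  proof (intro exI[of _ "1 / (norm S + 1)"] conjI allI)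
    show "0 < 1 / (norm S + 1)"
      by (simp add: add_nonneg_pos)
    fix x
    have "norm x \<le> norm S * norm (T x - r *\<^sub>C x)"
      using norm_blinfun[of S "T x - r *\<^sub>C x"] by (simp add: S)
    also have "\<dots> \<le> (norm S + 1) * norm (T x - r *\<^sub>C x)"
      by (simp add: mult_right_mono)
    finally show "1 / (norm S + 1) * norm x \<le> norm (T x - r *\<^sub>C x)"
      by (simp add: pos_divide_le_eq add_nonneg_pos mult.commute)
  qed
  with assms show False by contradiction
qed

text \<open>
  With \<open>S = p(T)\<close> and \<open>N\<close> its norm, a vector that almost attains the norm is almost annihilated by
  \<open>S\<^sup>2 - N\<^sup>2\<close>, because the squared norm of \<open>S\<^sup>2 x - N\<^sup>2 x\<close> is at most
  \<open>2 N\<^sup>4 - 2 N\<^sup>2 \<parallel>S x\<parallel>\<^sup>2\<close> for unit \<open>x\<close>. So \<open>p\<^sup>2 - N\<^sup>2\<close> has a root in the spectrum,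
  and this root is real.
\<close>

lemma norm_op_poly_attained_nonconst:
  fixes T :: "'a::complex_hilbert_space \<Rightarrow>\<^sub>L 'a"
  assumes T: "self_adjoint T" and N: "norm (op_poly p T) = N" "N > 0"
    and ne: "p * p \<noteq> [:N\<^sup>2:]"
  shows "\<exists>r. complex_of_real r \<in> op_spectrum T \<and> \<bar>poly p r\<bar> = N"
proof -
  define S where "S = op_poly p T"
  define q where "q = p * p - [:N\<^sup>2:]"
  have S: "self_adjoint S" "norm S = N"
    using self_adjoint_op_poly(1)[OF T] N by (auto simp: S_def)
  have q_eq: "complex_op_poly (map_poly complex_of_real q) T x = S (S x) - N\<^sup>2 *\<^sub>R x" for x
    using op_poly_eq_complex_op_poly[OF self_adjoint_bounded_ops[OF T], of q x]
    by (simp add: q_def op_poly_diff op_poly_mult op_poly_pCons S_def blinfun.bilinear_simps)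
  have "\<not> bounded_below (\<lambda>x. S (S x) - N\<^sup>2 *\<^sub>R x)"
  proof
    assume "bounded_below (\<lambda>x. S (S x) - N\<^sup>2 *\<^sub>R x)"
    then obtain c where c: "c > 0" "\<And>x. c * norm x \<le> norm (S (S x) - N\<^sup>2 *\<^sub>R x)"
      by (auto simp: bounded_below_def)
    \<comment> \<open>a lower bound \<open>c\<close> would improve the norm: \<open>\<parallel>S x\<parallel>\<^sup>2 \<le> b \<parallel>x\<parallel>\<^sup>2\<close> with \<open>b < N\<^sup>2\<close>\<close>
    define b where "b = N\<^sup>2 - c\<^sup>2 / (2 * N\<^sup>2)"
    have "b < N\<^sup>2"
      using c N by (simp add: b_def)
    have b: "(norm (S x))\<^sup>2 \<le> b * (norm x)\<^sup>2" for x
    proof -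
      have "inner (S (S x)) x = (norm (S x))\<^sup>2"
        using S(1) by (simp add: inner_eq_Re_cinner self_adjointD power2_norm_eq_inner)
      then have eq: "(norm (S (S x) - N\<^sup>2 *\<^sub>R x))\<^sup>2
          = (norm (S (S x)))\<^sup>2 - 2 * N\<^sup>2 * (norm (S x))\<^sup>2 + N\<^sup>2 * N\<^sup>2 * (norm x)\<^sup>2"
        by (simp add: power2_norm_eq_inner inner_diff inner_commute algebra_simps)
      have "(norm (S (S x)))\<^sup>2 \<le> (N * (N * norm x))\<^sup>2"
      proof (rule power_mono)
        have "norm (S (S x)) \<le> N * norm (S x)" "norm (S x) \<le> N * norm x"
          using norm_blinfun[of S] S(2) by auto
        then show "norm (S (S x)) \<le> N * (N * norm x)"
          using N by (smt (verit) mult_left_mono)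
      qed simp
      moreover have "(c * norm x)\<^sup>2 \<le> (norm (S (S x) - N\<^sup>2 *\<^sub>R x))\<^sup>2"
        using c by (intro power_mono) auto
      ultimately have "c\<^sup>2 * (norm x)\<^sup>2 \<le> 2 * N\<^sup>2 * (N\<^sup>2 * (norm x)\<^sup>2) - 2 * N\<^sup>2 * (norm (S x))\<^sup>2"
        unfolding eq by (simp add: power_mult_distrib power2_eq_square algebra_simps)
      then have "2 * N\<^sup>2 * (norm (S x))\<^sup>2 \<le> 2 * N\<^sup>2 * (b * (norm x)\<^sup>2)"
        using N by (simp add: b_def algebra_simps)
      then show ?thesis
        using N by simp
    qed
    have "norm S \<le> sqrt (max b 0)"
    proof (rule norm_blinfun_bound)
      fix x
      have "(norm (S x))\<^sup>2 \<le> max b 0 * (norm x)\<^sup>2"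
        using b[of x] mult_right_mono[of b "max b 0" "(norm x)\<^sup>2"] by simp
      then have "norm (S x) \<le> sqrt (max b 0 * (norm x)\<^sup>2)"
        by (rule real_le_rsqrt)
      then show "norm (S x) \<le> sqrt (max b 0) * norm x"
        by (simp add: real_sqrt_mult)
    qed simp
    then have "N\<^sup>2 \<le> max b 0"
      using N S(2) by (metis max.cobounded2 order_less_imp_le power_mono real_sqrt_pow2)
    with \<open>b < N\<^sup>2\<close> N show False
      by (simp add: max_def split: if_splits)
  qed
  then have "\<not> bounded_below (complex_op_poly (map_poly complex_of_real q) T)"
    by (simp add: q_eq[abs_def] fun_eq_iff)
  moreover have "map_poly complex_of_real q \<noteq> 0"
    using ne by (simp add: q_def map_poly_eq_0_iff)
  ultimately obtain r where r: "poly (map_poly complex_of_real q) r = 0"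
      and nb: "\<not> bounded_below (\<lambda>x. T x - r *\<^sub>C x)"
    using bounded_below_complex_op_poly self_adjoint_bounded_ops[OF T] by blast
  have "Im r = 0"
    using self_adjoint_bounded_below[OF T] nb by blast
  then have r_eq: "r = complex_of_real (Re r)"
    by (simp add: complex_eq_iff)
  have "poly q (Re r) = 0"
    using r by (subst (asm) r_eq) (simp only: poly_map_poly_complex_of_real of_real_eq_0_iff)
  then have "(poly p (Re r))\<^sup>2 = N\<^sup>2"
    by (simp add: q_def power2_eq_square)
  then have "\<bar>poly p (Re r)\<bar> = N"
    using N(2) by (auto simp: power2_eq_iff)
  with not_bounded_below_op_spectrum[OF nb] r_eq show ?thesis
    by metis
qed

text \<open>
  When \<open>p\<^sup>2\<close> is the constant \<open>N\<^sup>2\<close>, the polynomial \<open>p\<^sup>2 - N\<^sup>2\<close> has no roots to offer. Then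
  \<open>\<bar>p\<bar> = N\<close> everywhere and it suffices that the spectrum contains some real number, which follows from
  the polynomial \<open>t\<close> in place of \<open>p\<close> (or is trivial for \<open>T = 0\<close>).
\<close>

lemma op_poly_norm_le:
  fixes T :: "'a::complex_hilbert_space \<Rightarrow>\<^sub>L 'a"
  assumes T: "self_adjoint T" and "c \<ge> 0"
    and le: "\<And>r. complex_of_real r \<in> op_spectrum T \<Longrightarrow> \<bar>poly p r\<bar> \<le> c"
  shows "norm (op_poly p T) \<le> c"
proof (cases "op_poly p T = 0")
  case False
  define N where "N = norm (op_poly p T)"
  have N: "N > 0"
    using False by (simp add: N_def)
  have "\<exists>r. complex_of_real r \<in> op_spectrum T \<and> \<bar>poly p r\<bar> = N"
  proof (cases "p * p = [:N\<^sup>2:]")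
    case True
    have "(poly p r)\<^sup>2 = N\<^sup>2" for r
      using arg_cong[OF True, of "\<lambda>q. poly q r"] by (simp add: power2_eq_square)
    then have p: "\<bar>poly p r\<bar> = N" for r
      using N by (metis abs_of_pos power2_eq_iff_nonneg abs_ge_zero power2_abs less_imp_le)
    have "\<exists>r. complex_of_real r \<in> op_spectrum T"
    proof (cases "T = 0")
      case True
      obtain x where x: "op_poly p T x \<noteq> 0"
        using False by (metis blinfun_eqI blinfun.zero_left)
      then have "x \<noteq> 0"
        by (auto simp: blinfun.zero_right)
      then have "\<not> bounded_below (\<lambda>x. T x - 0 *\<^sub>C x)"
        unfolding bounded_below_def True
        by (auto simp: blinfun.zero_left scaleC.zero_left not_le intro!: exI[of _ x])
      from not_bounded_below_op_spectrum[OF this] show ?thesis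
        by (intro exI[of _ 0]) simp
    next
      case False
      have "op_poly [:0, 1:] T = T"
        by (rule blinfun_eqI) (simp add: op_poly_pCons blinfun.bilinear_simps)
      moreover have "[:0, 1:] * [:0, 1:] \<noteq> [:c:]" for c :: real
        by simp
      ultimately show ?thesis
        using norm_op_poly_attained_nonconst[OF T, of "[:0, 1:]" "norm T"] False by auto
    qed
    with p show ?thesis by blast
  next
    case False
    then show ?thesis
      using norm_op_poly_attained_nonconst[OF T N_def[symmetric] N] by blast
  qed
  then show ?thesis
    using le unfolding N_def by metis
qed (use \<open>c \<ge> 0\<close> in simp)

section \<open>Positive operators and the continuous functional calculus\<close>

text \<open>Positivity of all \<open>\<langle>T x, x\<rangle>\<close> forces self-adjointness by polarisation.\<close>

lemma positive_ops_self_adjoint: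
  fixes T :: "'a::complex_hilbert_space \<Rightarrow>\<^sub>L 'a"
  assumes "T \<in> positive_ops"
  shows "self_adjoint T"
proof -
  have T: "T \<in> bounded_ops" and Im: "Im (cinner (T x) x) = 0" for x
    using assms by (auto simp: positive_ops_def complex_nonneg_Reals_iff)
  have sum: "Im (cinner (T x) y) = - Im (cinner (T y) x)" for x y
    using Im[of "x + y"] Im[of x] Im[of y]
    by (simp add: blinfun.add_right cinner_add_left cinner_add_right)
  have "cinner (T x) y = cinner x (T y)" for x y
  proof -
    have "Re (cinner (T x) y) = Re (cinner (T y) x)"
      using sum[of "\<i> *\<^sub>C x" y] by (simp add: bounded_opsD[OF T] cinner_scaleC_left cinner_scaleC_right)
    with sum[of x y] have "cinner (T x) y = cnj (cinner (T y) x)"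
      by (simp add: complex_eq_iff)
    then show ?thesis
      by (metis cinner_commute)
  qed
  with T show ?thesis
    by (simp add: self_adjoint_def)
qed

lemma positive_ops_iff: "T \<in> positive_ops \<longleftrightarrow> self_adjoint T \<and> (\<forall>x. 0 \<le> inner (T x) x)"
proof
  assume "T \<in> positive_ops"
  then show "self_adjoint T \<and> (\<forall>x. 0 \<le> inner (T x) x)"
    using positive_ops_self_adjoint
    by (auto simp: positive_ops_def complex_nonneg_Reals_iff inner_eq_Re_cinner)
next
  assume T: "self_adjoint T \<and> (\<forall>x. 0 \<le> inner (T x) x)"
  then show "T \<in> positive_ops"
    by (simp add: positive_ops_def self_adjoint_bounded_ops self_adjoint_cinner_self)
qed

lemma self_adjoint_inner: "self_adjoint T \<Longrightarrow> inner (T x) y = inner x (T y)"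
  by (simp add: inner_eq_Re_cinner self_adjointD)

lemma positive_ops_inner: "T \<in> positive_ops \<Longrightarrow> inner (T x) y = inner x (T y)"
  using positive_ops_self_adjoint self_adjoint_inner by blast

text \<open>
  The Cauchy-Schwarz inequality for the form \<open>\<langle>T x, y\<rangle>\<close> with \<open>y = T x\<close>; it follows from
  nonnegativity of the form at \<open>\<parallel>T\<parallel> x - T x\<close>.
\<close>

lemma positive_ops_norm_square_le:
  fixes T :: "'a::complex_hilbert_space \<Rightarrow>\<^sub>L 'a"
  assumes T: "T \<in> positive_ops"
  shows "(norm (T x))\<^sup>2 \<le> norm T * inner (T x) x"
proof (cases "norm T = 0")
  case False
  then have N: "norm T > 0" by simp
  define y where "y = T x"
  have "0 \<le> inner (T (norm T *\<^sub>R x - y)) (norm T *\<^sub>R x - y)"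
    using T positive_ops_iff by blast
  also have "\<dots> = norm T * (norm T * inner (T x) x) - 2 * norm T * (norm y)\<^sup>2 + inner (T y) y"
    by (simp add: blinfun.bilinear_simps inner_diff positive_ops_inner[OF T] y_def
        power2_norm_eq_inner inner_commute algebra_simps)
  also have "inner (T y) y \<le> norm T * (norm y)\<^sup>2"
    using norm_cauchy_schwarz[of "T y" y] norm_blinfun[of T y]
    by (smt (verit) mult_right_mono norm_ge_zero power2_eq_square mult.assoc)
  finally have "norm T * (norm y)\<^sup>2 \<le> norm T * (norm T * inner (T x) x)"
    by simp
  then show ?thesis
    using N by (simp add: y_def)
qed (simp add: blinfun.zero_left)

text \<open>
  If \<open>r\<close> lies outside \<open>[0, \<parallel>T\<parallel>]\<close> then \<open>\<bar>r - \<parallel>T\<parallel>/2\<bar> > \<parallel>T\<parallel>/2 \<ge> \<parallel>T - \<parallel>T\<parallel>/2\<parallel>\<close>, so \<open>T - r\<close> is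
  invertible; the inverse is found with the contraction principle.
\<close>

lemma positive_ops_spectrum:
  fixes T :: "'a::complex_hilbert_space \<Rightarrow>\<^sub>L 'a"
  assumes T: "T \<in> positive_ops" and r: "complex_of_real r \<in> op_spectrum T"
  shows "r \<in> {0..norm T}"
proof (rule ccontr)
  assume out: "r \<notin> {0..norm T}"
  have bT: "T \<in> bounded_ops"
    using T by (simp add: positive_ops_def)
  define c where "c = norm T / 2"
  define s where "s = r - c"
  have s: "\<bar>s\<bar> > c" "s \<noteq> 0" and "c \<ge> 0"
  proof -
    have "r < 0 \<or> r > norm T"
      using out by auto
    then show "\<bar>s\<bar> > c" "s \<noteq> 0" "c \<ge> 0"
      unfolding c_def s_def using norm_ge_zero[of T] by arith+
  qed
  have shift: "norm (T x - c *\<^sub>R x) \<le> c * norm x" for x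
  proof (rule power2_le_imp_le)
    have "(norm (T x - c *\<^sub>R x))\<^sup>2 = (norm (T x))\<^sup>2 - norm T * inner (T x) x + c\<^sup>2 * (norm x)\<^sup>2"
      unfolding power2_norm_eq_inner
      by (simp add: c_def inner_diff inner_commute power2_eq_square algebra_simps)
    also have "\<dots> \<le> (c * norm x)\<^sup>2"
      using positive_ops_norm_square_le[OF T, of x] by (simp add: power_mult_distrib)
    finally show "(norm (T x - c *\<^sub>R x))\<^sup>2 \<le> (c * norm x)\<^sup>2" .
  qed (use \<open>c \<ge> 0\<close> in simp)
  have below: "(\<bar>s\<bar> - c) * norm x \<le> norm (T x - r *\<^sub>R x)" for x
  proof -
    have "\<bar>s\<bar> * norm x = norm ((T x - c *\<^sub>R x) - (T x - r *\<^sub>R x))"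
      by (simp add: s_def flip: scaleR_diff_left)
    also have "\<dots> \<le> norm (T x - c *\<^sub>R x) + norm (T x - r *\<^sub>R x)"
      by (rule norm_triangle_ineq4)
    finally show ?thesis
      using shift[of x] by (simp add: algebra_simps)
  qed
  have inj: "x = y" if "T x - r *\<^sub>R x = T y - r *\<^sub>R y" for x y
  proof -
    have "T (x - y) - r *\<^sub>R (x - y) = 0"
      using that by (simp add: blinfun.diff_right algebra_simps)
    with below[of "x - y"] s(1) show ?thesis
      by (simp add: mult_le_0_iff)
  qed
  have "\<exists>x. T x - r *\<^sub>R x = y" for y
  proof -
    define f where "f = (\<lambda>x. (1 / s) *\<^sub>R (T x - c *\<^sub>R x - y))"
    have "dist (f x) (f z) \<le> c / \<bar>s\<bar> * dist x z" for x z
    proof -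
      have "f x - f z = (1 / s) *\<^sub>R (T (x - z) - c *\<^sub>R (x - z))"
        by (simp add: f_def blinfun.diff_right algebra_simps)
      then show ?thesis
        using shift[of "x - z"] by (simp add: dist_norm divide_right_mono)
    qed
    then have "\<exists>!x. f x = x"
      using s \<open>c \<ge> 0\<close> by (intro banach_fix_type[of "c / \<bar>s\<bar>"]) auto
    then obtain x where "f x = x" by blast
    then have "T x - c *\<^sub>R x - y = s *\<^sub>R x"
      using s(2) unfolding f_def by (metis divide_self_if scaleR_one scaleR_scaleR times_divide_eq_right mult.right_neutral)
    then show ?thesis
      by (intro exI[of _ x]) (simp add: s_def algebra_simps)
  qed
  then obtain R where R: "\<And>y. T (R y) - r *\<^sub>R R y = y"
    by metis
  have lin: "bounded_linear R"
  proof (rule bounded_linear_intro[where K = "1 / (\<bar>s\<bar> - c)"])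
    show "R (x + y) = R x + R y" for x y
      by (rule inj) (simp add: R blinfun.add_right scaleR_add_right add_diff_add)
    have sc: "T (a *\<^sub>R x) - r *\<^sub>R a *\<^sub>R x = a *\<^sub>R (T x - r *\<^sub>R x)" for a x
      by (simp add: blinfun.scaleR_right scaleR_diff_right mult.commute)
    show "R (a *\<^sub>R x) = a *\<^sub>R R x" for a x
      by (rule inj) (simp only: R sc)
    show "norm (R x) \<le> norm x * (1 / (\<bar>s\<bar> - c))" for x
      using below[of "R x"] s(1) by (simp add: R field_simps)
  qed
  then have R': "blinfun_apply (Blinfun R) = R"
    by (rule bounded_linear_Blinfun_apply)
  have sc: "T (a *\<^sub>C x) - r *\<^sub>R a *\<^sub>C x = a *\<^sub>C (T x - r *\<^sub>R x)" for a x
    by (simp add: bounded_opsD[OF bT] scaleC.diff_right scaleC.scaleR_right)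
  have "Blinfun R \<in> bounded_ops"
    unfolding bounded_ops_def mem_Collect_eq R' by (intro allI, rule inj) (simp only: R sc)
  moreover have "R (T x - complex_of_real r *\<^sub>C x) = x" for x
    by (rule inj) (simp only: R flip: scaleR_scaleC)
  moreover have "T (R x) - complex_of_real r *\<^sub>C R x = x" for x
    by (simp only: R flip: scaleR_scaleC)
  ultimately have "complex_of_real r \<notin> op_spectrum T"
    unfolding op_spectrum_def using R' by (auto intro!: bexI[of _ "Blinfun R"])
  with r show False by contradiction
qed

definition real_spectrum :: "('a::complex_hilbert_space \<Rightarrow>\<^sub>L 'a) \<Rightarrow> real set" where
  "real_spectrum T = {t. complex_of_real t \<in> op_spectrum T}"

lemma real_spectrum_subset: "T \<in> positive_ops \<Longrightarrow> real_spectrum T \<subseteq> {0..norm T}"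
  unfolding real_spectrum_def using positive_ops_spectrum by blast

lemma op_poly_diff_tendsto_0:
  assumes T: "self_adjoint T"
    and p: "uniform_limit (real_spectrum T) (\<lambda>n. poly (p n)) f sequentially"
    and q: "uniform_limit (real_spectrum T) (\<lambda>n. poly (q n)) f sequentially"
    and "e > 0"
  shows "\<exists>M. \<forall>m\<ge>M. \<forall>n\<ge>M. norm (op_poly (p m) T - op_poly (q n) T) < e"
proof -
  have "\<forall>\<^sub>F n in sequentially. (\<forall>x\<in>real_spectrum T. dist (poly (p n) x) (f x) < e / 4) \<and>
      (\<forall>x\<in>real_spectrum T. dist (poly (q n) x) (f x) < e / 4)"
    using \<open>e > 0\<close> by (intro eventually_conj uniform_limitD[OF p] uniform_limitD[OF q]) auto
  then obtain M where M:
    "\<And>n x. n \<ge> M \<Longrightarrow> x \<in> real_spectrum T \<Longrightarrow> \<bar>poly (p n) x - f x\<bar> < e / 4"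
    "\<And>n x. n \<ge> M \<Longrightarrow> x \<in> real_spectrum T \<Longrightarrow> \<bar>poly (q n) x - f x\<bar> < e / 4"
    by (auto simp: eventually_sequentially dist_real_def)
  have "norm (op_poly (p m - q n) T) \<le> e / 2" if "m \<ge> M" "n \<ge> M" for m n
  proof (rule op_poly_norm_le[OF T])
    fix r assume "complex_of_real r \<in> op_spectrum T"
    then have "r \<in> real_spectrum T" by (simp add: real_spectrum_def)
    from M(1)[OF that(1) this] M(2)[OF that(2) this]
    show "\<bar>poly (p m - q n) r\<bar> \<le> e / 2"
      unfolding poly_diff by arith
  qed (use \<open>e > 0\<close> in simp)
  moreover have "e / 2 < e"
    using \<open>e > 0\<close> by simp
  ultimately show ?thesis
    unfolding op_poly_diff using le_less_trans by blast
qed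

text \<open>
  The calculus is defined through all approximating sequences of polynomials; the Weierstrass theorem
  provides at least one, so that the common limit is unique.
\<close>

lemma uniform_limit_poly_exists:
  assumes "continuous_on {0..M} (f :: real \<Rightarrow> real)"
  shows "\<exists>p. uniform_limit {0..M} (\<lambda>n. poly (p n)) f sequentially"
proof -
  have "\<exists>p. \<forall>x\<in>{0..M}. \<bar>f x - poly p x\<bar> < 1 / Suc n" for n
  proof -
    obtain h where "real_polynomial_function h" and h: "\<And>x. x \<in> {0..M} \<Longrightarrow> \<bar>f x - h x\<bar> < 1 / Suc n"
      using Stone_Weierstrass_real_polynomial_function[OF compact_Icc assms, of "1 / Suc n"] by auto
    then obtain a k where "h = (\<lambda>x. \<Sum>i\<le>(k::nat). a i * x ^ i)"
      by (auto simp: real_polynomial_function_iff_sum)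
    then have "h x = poly (\<Sum>i\<le>k. monom (a i) i) x" for x
      by (simp add: poly_sum poly_monom)
    with h show ?thesis by metis
  qed
  then obtain p where p: "\<And>n x. x \<in> {0..M} \<Longrightarrow> \<bar>f x - poly (p n) x\<bar> < 1 / Suc n"
    by metis
  have "uniform_limit {0..M} (\<lambda>n. poly (p n)) f sequentially"
  proof (rule uniform_limitI)
    fix e :: real assume "e > 0"
    then have "\<forall>\<^sub>F n in sequentially. 1 / Suc n < e"
      using order_tendstoD(2)[OF LIMSEQ_Suc[OF lim_1_over_n]] by simp
    then show "\<forall>\<^sub>F n in sequentially. \<forall>x\<in>{0..M}. dist (poly (p n) x) (f x) < e"
    proof (rule eventually_mono)
      fix n assume "1 / Suc n < e"
      then show "\<forall>x\<in>{0..M}. dist (poly (p n) x) (f x) < e"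
        using p[of _ n] by (metis abs_minus_commute dist_real_def less_trans)
    qed
  qed
  then show ?thesis by blast
qed

text \<open>
  Since \<open>\<parallel>p(T)\<parallel>\<close> is at most the maximum of \<open>\<bar>p\<bar>\<close> on the spectrum, uniform convergence there makes
  \<open>p\<^sub>n(T)\<close> a Cauchy sequence, and two approximating sequences have the same limit.
\<close>

lemma cont_calculus_tendsto:
  fixes T :: "'a::complex_hilbert_space \<Rightarrow>\<^sub>L 'a"
  assumes T: "T \<in> positive_ops" and f: "continuous_on {0..norm T} f"
    and p: "uniform_limit (real_spectrum T) (\<lambda>n. poly (p n)) f sequentially"
  shows "(\<lambda>n. op_poly (p n) T) \<longlonglongrightarrow> cont_calculus f T"
proof -
  note sT = positive_ops_self_adjoint[OF T]
  have "Cauchy (\<lambda>n. op_poly (p n) T)"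
    by (rule CauchyI) (use op_poly_diff_tendsto_0[OF sT p p] in blast)
  then obtain F where F: "(\<lambda>n. op_poly (p n) T) \<longlonglongrightarrow> F"
    using Cauchy_convergent_iff convergent_def by blast
  have all: "(\<lambda>n. op_poly (q n) T) \<longlonglongrightarrow> F"
    if q: "uniform_limit (real_spectrum T) (\<lambda>n. poly (q n)) f sequentially" for q
  proof -
    have "(\<lambda>n. op_poly (p n) T - op_poly (q n) T) \<longlonglongrightarrow> 0"
      by (rule LIMSEQ_I) (use op_poly_diff_tendsto_0[OF sT p q] in \<open>simp; blast\<close>)
    from tendsto_diff[OF F this] show ?thesis by simp
  qed
  have "cont_calculus f T = F"
    unfolding cont_calculus_def real_spectrum_def[symmetric]
  proof (rule the_equality)
    fix G assume "\<forall>p. uniform_limit (real_spectrum T) (\<lambda>n. poly (p n)) f sequentially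
        \<longrightarrow> (\<lambda>n. op_poly (p n) T) \<longlonglongrightarrow> G"
    with p F show "G = F"
      using LIMSEQ_unique by blast
  qed (use all in blast)
  with F show ?thesis by simp
qed

lemma cont_calculus_approx:
  fixes T :: "'a::complex_hilbert_space \<Rightarrow>\<^sub>L 'a"
  assumes T: "T \<in> positive_ops" and f: "continuous_on {0..norm T} f"
  obtains p where "uniform_limit {0..norm T} (\<lambda>n. poly (p n)) f sequentially"
    and "(\<lambda>n. op_poly (p n) T) \<longlonglongrightarrow> cont_calculus f T"
proof -
  obtain p where p: "uniform_limit {0..norm T} (\<lambda>n. poly (p n)) f sequentially"
    using uniform_limit_poly_exists[OF f] by blast
  with cont_calculus_tendsto[OF T f uniform_limit_on_subset[OF p real_spectrum_subset[OF T]]] that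
  show thesis by blast
qed

lemma self_adjoint_limit:
  assumes "\<And>n. self_adjoint (S n)" and "S \<longlonglongrightarrow> T"
  shows "self_adjoint T"
proof -
  have lim: "(\<lambda>n. S n x) \<longlonglongrightarrow> T x" for x
    using assms(2) by (intro blinfun.tendsto tendsto_const)
  have "cinner (T x) y = cinner x (T y)" for x y
  proof (rule LIMSEQ_unique)
    show "(\<lambda>n. cinner (S n x) y) \<longlonglongrightarrow> cinner (T x) y"
      by (intro cinner.tendsto lim tendsto_const)
    have "(\<lambda>n. cinner x (S n y)) \<longlonglongrightarrow> cinner x (T y)"
      by (intro cinner.tendsto lim tendsto_const)
    then show "(\<lambda>n. cinner (S n x) y) \<longlonglongrightarrow> cinner x (T y)"
      using assms(1) by (simp add: self_adjointD)
  qed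
  then show ?thesis
    using bounded_ops_limit[OF self_adjoint_bounded_ops[OF assms(1)] assms(2)]
    by (simp add: self_adjoint_def)
qed

lemma cont_calculus_self_adjoint:
  assumes "T \<in> positive_ops" and "continuous_on {0..norm T} f"
  shows "self_adjoint (cont_calculus f T)"
  by (metis assms cont_calculus_approx self_adjoint_limit self_adjoint_op_poly(1)
      positive_ops_self_adjoint)

lemma cont_calculus_mult:
  assumes T: "T \<in> positive_ops"
    and f: "continuous_on {0..norm T} f" and h: "continuous_on {0..norm T} h"
  shows "cont_calculus (\<lambda>t. f t * h t) T = cont_calculus f T o\<^sub>L cont_calculus h T"
proof -
  obtain p where p: "uniform_limit {0..norm T} (\<lambda>n. poly (p n)) f sequentially"
      "(\<lambda>n. op_poly (p n) T) \<longlonglongrightarrow> cont_calculus f T"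
    using cont_calculus_approx[OF T f] .
  obtain q where q: "uniform_limit {0..norm T} (\<lambda>n. poly (q n)) h sequentially"
      "(\<lambda>n. op_poly (q n) T) \<longlonglongrightarrow> cont_calculus h T"
    using cont_calculus_approx[OF T h] .
  have "uniform_limit {0..norm T} (\<lambda>n. poly (p n * q n)) (\<lambda>t. f t * h t) sequentially"
    unfolding poly_mult
    by (intro uniform_lim_mult p q compact_imp_bounded compact_continuous_image f h compact_Icc)
  then have "(\<lambda>n. op_poly (p n * q n) T) \<longlonglongrightarrow> cont_calculus (\<lambda>t. f t * h t) T"
    by (intro cont_calculus_tendsto[OF T] continuous_on_mult f h)
      (rule uniform_limit_on_subset[OF _ real_spectrum_subset[OF T]])
  moreover have "(\<lambda>n. op_poly (p n * q n) T) \<longlonglongrightarrow> (cont_calculus f T o\<^sub>L cont_calculus h T)"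
    unfolding op_poly_mult
    by (intro bounded_bilinear.tendsto[OF bounded_bilinear_blinfun_compose] p q)
  ultimately show ?thesis
    by (rule LIMSEQ_unique)
qed

lemma cont_calculus_norm_diff_le:
  assumes T: "T \<in> positive_ops"
    and f: "continuous_on {0..norm T} f" and h: "continuous_on {0..norm T} h"
    and "c \<ge> 0" and le: "\<And>t. t \<in> {0..norm T} \<Longrightarrow> \<bar>f t - h t\<bar> \<le> c"
  shows "norm (cont_calculus f T - cont_calculus h T) \<le> c"
proof (rule field_le_epsilon)
  fix e :: real assume "e > 0"
  obtain p where p: "uniform_limit {0..norm T} (\<lambda>n. poly (p n)) f sequentially"
      "(\<lambda>n. op_poly (p n) T) \<longlonglongrightarrow> cont_calculus f T"
    using cont_calculus_approx[OF T f] .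
  obtain q where q: "uniform_limit {0..norm T} (\<lambda>n. poly (q n)) h sequentially"
      "(\<lambda>n. op_poly (q n) T) \<longlonglongrightarrow> cont_calculus h T"
    using cont_calculus_approx[OF T h] .
  have "\<forall>\<^sub>F n in sequentially. (\<forall>x\<in>{0..norm T}. dist (poly (p n) x) (f x) < e / 2) \<and>
      (\<forall>x\<in>{0..norm T}. dist (poly (q n) x) (h x) < e / 2)"
    using \<open>e > 0\<close> by (intro eventually_conj uniform_limitD[OF p(1)] uniform_limitD[OF q(1)]) auto
  then have ev: "\<forall>\<^sub>F n in sequentially. norm (op_poly (p n) T - op_poly (q n) T) \<le> c + e"
  proof (rule eventually_mono)
    fix n
    assume n: "(\<forall>x\<in>{0..norm T}. dist (poly (p n) x) (f x) < e / 2) \<and>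
      (\<forall>x\<in>{0..norm T}. dist (poly (q n) x) (h x) < e / 2)"
    show "norm (op_poly (p n) T - op_poly (q n) T) \<le> c + e"
      unfolding op_poly_diff[symmetric]
    proof (rule op_poly_norm_le[OF positive_ops_self_adjoint[OF T]])
      fix r assume "complex_of_real r \<in> op_spectrum T"
      then have r: "r \<in> {0..norm T}"
        by (rule positive_ops_spectrum[OF T])
      then have "\<bar>poly (p n) r - f r\<bar> < e / 2" "\<bar>poly (q n) r - h r\<bar> < e / 2"
        using n by (auto simp: dist_real_def)
      with le[OF r] show "\<bar>poly (p n - q n) r\<bar> \<le> c + e"
        unfolding poly_diff by linarith
    qed (use \<open>c \<ge> 0\<close> \<open>e > 0\<close> in simp)
  qed
  show "norm (cont_calculus f T - cont_calculus h T) \<le> c + e"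
    by (rule tendsto_upperbound[OF tendsto_norm[OF tendsto_diff[OF p(2) q(2)]] ev]) simp
qed

lemma cont_calculus_cong:
  assumes T: "T \<in> positive_ops"
    and f: "continuous_on {0..norm T} f" and eq: "\<And>t. t \<in> {0..norm T} \<Longrightarrow> f t = h t"
  shows "cont_calculus f T = cont_calculus h T"
proof -
  have "continuous_on {0..norm T} h"
    using f continuous_on_cong eq by metis
  from cont_calculus_norm_diff_le[OF T f this, of 0] eq show ?thesis
    by simp
qed

lemma cont_calculus_ident:
  fixes T :: "'a::complex_hilbert_space \<Rightarrow>\<^sub>L 'a"
  assumes T: "T \<in> positive_ops"
  shows "cont_calculus (\<lambda>t. t) T = T"
proof -
  have "op_poly [:0, 1:] T = T"
    by (rule blinfun_eqI) (simp add: op_poly_pCons blinfun.bilinear_simps)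
  moreover have "uniform_limit (real_spectrum T) (\<lambda>n. poly [:0, 1:]) (\<lambda>t. t) sequentially"
    by (rule uniform_limitI) simp
  then have "(\<lambda>n::nat. op_poly [:0, 1:] T) \<longlonglongrightarrow> cont_calculus (\<lambda>t. t) T"
    by (intro cont_calculus_tendsto[OF T] continuous_on_id)
  ultimately show ?thesis
    by (simp add: LIMSEQ_const_iff)
qed

section \<open>Powers of positive operators\<close>

lemma op_powr_pos: "\<nu> > 0 \<Longrightarrow> op_powr T \<nu> = cont_calculus (\<lambda>t. t powr \<nu>) T"
  by (simp add: op_powr_def)

lemma continuous_on_powr_const: "\<nu> > 0 \<Longrightarrow> continuous_on {0..M} (\<lambda>t::real. t powr \<nu>)"
  by (intro continuous_on_powr') (auto intro!: continuous_intros)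

lemma op_powr_add:
  assumes T: "T \<in> positive_ops" and "\<mu> > 0" "\<nu> > 0"
  shows "op_powr T (\<mu> + \<nu>) = op_powr T \<mu> o\<^sub>L op_powr T \<nu>"
  using cont_calculus_mult[OF T continuous_on_powr_const[OF assms(2)] continuous_on_powr_const[OF assms(3)]] assms
  by (simp add: op_powr_pos powr_add)

lemma op_powr_self_adjoint:
  "T \<in> positive_ops \<Longrightarrow> \<nu> > 0 \<Longrightarrow> self_adjoint (op_powr T \<nu>)"
  by (simp add: op_powr_pos cont_calculus_self_adjoint continuous_on_powr_const)

text \<open>
  A power is the square of the self-adjoint operator with half the exponent.
\<close>

lemma op_powr_positive:
  assumes T: "T \<in> positive_ops" and "\<nu> > 0"
  shows "op_powr T \<nu> \<in> positive_ops"
proof -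
  have half: "self_adjoint (op_powr T (\<nu> / 2))"
    using assms by (intro op_powr_self_adjoint) auto
  have "op_powr T \<nu> = op_powr T (\<nu> / 2) o\<^sub>L op_powr T (\<nu> / 2)"
    using op_powr_add[OF T, of "\<nu> / 2" "\<nu> / 2"] assms by simp
  then have "inner (op_powr T \<nu> x) x \<ge> 0" for x
    using self_adjoint_inner[OF half, of "op_powr T (\<nu> / 2) x" x] by simp
  then show ?thesis
    using op_powr_self_adjoint[OF assms] by (simp add: positive_ops_iff)
qed

lemma op_powr_one:
  assumes T: "T \<in> positive_ops"
  shows "op_powr T 1 = T"
proof -
  have "op_powr T 1 = cont_calculus (\<lambda>t. t powr 1) T"
    by (rule op_powr_pos) simp
  also have "\<dots> = cont_calculus (\<lambda>t. t) T"
    by (rule cont_calculus_cong[OF T continuous_on_powr_const]) auto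
  finally show ?thesis
    by (simp add: cont_calculus_ident[OF T])
qed

text \<open>
  The function \<open>(\<nu>, t) \<mapsto> t\<^sup>\<nu>\<close> is uniformly continuous on compact rectangles with \<open>\<nu> > 0\<close>, and the
  calculus is contractive for the uniform norm.
\<close>

lemma continuous_on_op_powr:
  assumes T: "T \<in> positive_ops" and "a > 0"
  shows "continuous_on {a..b} (op_powr T)"
  unfolding continuous_on_iff
proof (intro ballI allI impI)
  fix \<mu> e :: real assume \<mu>: "\<mu> \<in> {a..b}" and "e > 0"
  have "continuous_on ({a..b} \<times> {0..norm T}) (\<lambda>z. snd z powr fst z)"
    using \<open>a > 0\<close> by (intro continuous_on_powr') (auto intro!: continuous_intros)
  then have "uniformly_continuous_on ({a..b} \<times> {0..norm T}) (\<lambda>z. snd z powr fst z)"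
    by (rule compact_uniformly_continuous) (intro compact_Times compact_Icc)
  then obtain d where "d > 0" and d: "\<And>z z'. z \<in> {a..b} \<times> {0..norm T} \<Longrightarrow>
      z' \<in> {a..b} \<times> {0..norm T} \<Longrightarrow> dist z' z < d \<Longrightarrow> dist (snd z' powr fst z') (snd z powr fst z) < e / 2"
    using \<open>e > 0\<close> unfolding uniformly_continuous_on_def by (metis half_gt_zero)
  have "dist (op_powr T \<nu>) (op_powr T \<mu>) < e" if \<nu>: "\<nu> \<in> {a..b}" "dist \<nu> \<mu> < d" for \<nu>
  proof -
    have pos: "\<nu> > 0" "\<mu> > 0"
      using \<mu> \<nu> \<open>a > 0\<close> by auto
    have "norm (cont_calculus (\<lambda>t. t powr \<nu>) T - cont_calculus (\<lambda>t. t powr \<mu>) T) \<le> e / 2"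
    proof (rule cont_calculus_norm_diff_le[OF T])
      fix t assume t: "t \<in> {0..norm T}"
      have "dist (\<nu>, t) (\<mu>, t) < d"
        using \<nu>(2) by (simp add: dist_Pair_Pair)
      with d[of "(\<mu>, t)" "(\<nu>, t)"] \<mu> \<nu> t show "\<bar>t powr \<nu> - t powr \<mu>\<bar> \<le> e / 2"
        by (simp add: dist_real_def)
    qed (use pos \<open>e > 0\<close> continuous_on_powr_const in auto)
    then show ?thesis
      using \<open>e > 0\<close> pos by (simp add: dist_norm op_powr_pos)
  qed
  then show "\<exists>d>0. \<forall>\<nu>\<in>{a..b}. dist \<nu> \<mu> < d \<longrightarrow> dist (op_powr T \<nu>) (op_powr T \<mu>) < e"
    using \<open>d > 0\<close> by blast
qed

section \<open>Compact operators and the absolute value\<close>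

text \<open>
  The image of the unit ball is relatively compact. The sequential form is chosen because eigenvectors
  are found as limits of subsequences.
\<close>

definition compact_map :: "('a::real_normed_vector \<Rightarrow>\<^sub>L 'b::real_normed_vector) \<Rightarrow> bool" where
  "compact_map T \<longleftrightarrow> (\<forall>x. (\<forall>n. norm (x n) \<le> 1) \<longrightarrow>
     (\<exists>r :: nat \<Rightarrow> nat. strict_mono r \<and> convergent (\<lambda>n. T (x (r n)))))"

lemma compact_ops_compact_map:
  assumes "T \<in> compact_ops"
  shows "compact_map T"
  unfolding compact_map_def
proof (intro allI impI)
  fix x :: "nat \<Rightarrow> 'a" assume x: "\<forall>n. norm (x n) \<le> 1"
  have "compact (closure (blinfun_apply T ` cball 0 1))"
    using assms by (simp add: compact_ops_def)
  moreover have "T (x n) \<in> closure (blinfun_apply T ` cball 0 1)" for n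
    using x by (intro closure_subset[THEN subsetD] imageI) simp
  ultimately obtain l r where "strict_mono (r :: nat \<Rightarrow> nat)" "((\<lambda>n. T (x n)) \<circ> r) \<longlonglongrightarrow> l"
    unfolding compact_def by meson
  then show "\<exists>r :: nat \<Rightarrow> nat. strict_mono r \<and> convergent (\<lambda>n. T (x (r n)))"
    by (auto simp: convergent_def o_def)
qed

lemma compact_map_bounded_seq:
  assumes T: "compact_map T" and x: "\<And>n. norm (x n) \<le> M"
  obtains r :: "nat \<Rightarrow> nat" where "strict_mono r" "convergent (\<lambda>n. T (x (r n)))"
proof -
  define K where "K = max M 1"
  have "K > 0"
    by (simp add: K_def)
  have "norm ((1 / K) *\<^sub>R x n) \<le> 1" for n
    using x[of n] by (simp add: K_def)
  then obtain r :: "nat \<Rightarrow> nat" where r: "strict_mono r" "convergent (\<lambda>n. T ((1 / K) *\<^sub>R x (r n)))"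
    using T[unfolded compact_map_def, rule_format, of "\<lambda>n. (1 / K) *\<^sub>R x n"] by auto
  from r(2) obtain l where "(\<lambda>n. T ((1 / K) *\<^sub>R x (r n))) \<longlonglongrightarrow> l"
    by (auto simp: convergent_def)
  then have "(\<lambda>n. K *\<^sub>R T ((1 / K) *\<^sub>R x (r n))) \<longlonglongrightarrow> K *\<^sub>R l"
    by (intro tendsto_scaleR tendsto_const)
  moreover have "K *\<^sub>R T ((1 / K) *\<^sub>R x (r n)) = T (x (r n))" for n
    using \<open>K > 0\<close> by (simp add: blinfun.scaleR_right)
  ultimately show thesis
    using that r(1) by (auto simp: convergent_def)
qed

lemma compact_map_compose_left:
  assumes "compact_map T"
  shows "compact_map (S o\<^sub>L T)"
proof -
  have "convergent (\<lambda>n. S (T (y n)))" if "convergent (\<lambda>n. T (y n))" for y :: "nat \<Rightarrow> _"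
    using that blinfun.tendsto[OF tendsto_const, of _ _ sequentially S] by (auto simp: convergent_def)
  then show ?thesis
    using assms unfolding compact_map_def blinfun_apply_blinfun_compose by meson
qed

lemma compact_map_compose_right:
  assumes "compact_map T"
  shows "compact_map (T o\<^sub>L S)"
  unfolding compact_map_def
proof (intro allI impI)
  fix x :: "nat \<Rightarrow> 'c" assume "\<forall>n. norm (x n) \<le> 1"
  then have "norm (S (x n)) \<le> norm S" for n
    using norm_blinfun[of S "x n"] by (smt (verit) mult_left_le norm_ge_zero)
  from compact_map_bounded_seq[OF assms this] obtain r :: "nat \<Rightarrow> nat"
    where "strict_mono r" "convergent (\<lambda>n. T (S (x (r n))))" .
  then show "\<exists>r :: nat \<Rightarrow> nat. strict_mono r \<and> convergent (\<lambda>n. (T o\<^sub>L S) (x (r n)))"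
    by auto
qed

lemma compact_map_diff:
  assumes "compact_map S" "compact_map T"
  shows "compact_map (S - T)"
  unfolding compact_map_def
proof (intro allI impI)
  fix x :: "nat \<Rightarrow> 'a" assume x: "\<forall>n. norm (x n) \<le> 1"
  then obtain r :: "nat \<Rightarrow> nat" where r: "strict_mono r" "convergent (\<lambda>n. S (x (r n)))"
    using assms(1) unfolding compact_map_def by blast
  have "\<forall>n. norm (x (r n)) \<le> 1"
    using x by simp
  then obtain q :: "nat \<Rightarrow> nat" where q: "strict_mono q" "convergent (\<lambda>n. T (x (r (q n))))"
    using assms(2)[unfolded compact_map_def, rule_format, of "\<lambda>n. x (r n)"] by auto
  have "convergent (\<lambda>n. S (x (r (q n))))"
    using convergent_subseq_convergent[OF r(2) q(1)] by (simp add: o_def)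
  with q(2) have "convergent (\<lambda>n. (S - T) (x (r (q n))))"
    by (simp add: blinfun.diff_left convergent_diff)
  then show "\<exists>r :: nat \<Rightarrow> nat. strict_mono r \<and> convergent (\<lambda>n. (S - T) (x (r n)))"
    using strict_mono_o[OF r(1) q(1)] by (intro exI[of _ "r \<circ> q"]) auto
qed

lemma op_adjoint_compose_positive:
  assumes T: "T \<in> bounded_ops"
  shows "op_adjoint T o\<^sub>L T \<in> positive_ops"
proof -
  have "cinner (op_adjoint T (T x)) x \<in> \<real>\<^sub>\<ge>\<^sub>0" for x
    by (simp add: cinner_self flip: cinner_op_adjoint'[OF T])
  then show ?thesis
    by (simp add: positive_ops_def bounded_ops_compose op_adjoint_bounded_ops T)
qed

lemma op_abs_positive: "T \<in> bounded_ops \<Longrightarrow> op_abs T \<in> positive_ops"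
  by (simp add: op_abs_def op_powr_positive op_adjoint_compose_positive)

lemma op_abs_squared:
  assumes T: "T \<in> bounded_ops"
  shows "op_abs T (op_abs T x) = op_adjoint T (T x)"
proof -
  have "op_abs T o\<^sub>L op_abs T = op_adjoint T o\<^sub>L T"
    using op_powr_add[OF op_adjoint_compose_positive[OF T], of "1/2" "1/2"]
    by (simp add: op_abs_def op_powr_one[OF op_adjoint_compose_positive[OF T]])
  then show ?thesis
    by (metis blinfun_apply_blinfun_compose)
qed

lemma norm_op_abs:
  assumes T: "T \<in> bounded_ops"
  shows "norm (op_abs T x) = norm (T x)"
proof -
  have "(norm (op_abs T x))\<^sup>2 = inner (op_abs T (op_abs T x)) x"
    by (simp add: power2_norm_eq_inner positive_ops_inner[OF op_abs_positive[OF T]])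
  also have "\<dots> = inner (T x) (T x)"
    by (simp add: op_abs_squared[OF T] inner_eq_Re_cinner flip: cinner_op_adjoint'[OF T])
  finally show ?thesis
    by (simp add: power2_norm_eq_inner norm_eq_sqrt_inner)
qed

lemma compact_map_op_abs:
  assumes T: "T \<in> bounded_ops" and c: "compact_map T"
  shows "compact_map (op_abs T)"
  unfolding compact_map_def
proof (intro allI impI)
  fix x :: "nat \<Rightarrow> 'a" assume "\<forall>n. norm (x n) \<le> 1"
  then obtain r :: "nat \<Rightarrow> nat" where r: "strict_mono r" "convergent (\<lambda>n. T (x (r n)))"
    using c unfolding compact_map_def by blast
  have "dist (op_abs T y) (op_abs T z) = dist (T y) (T z)" for y z
    using norm_op_abs[OF T, of "y - z"] by (simp add: dist_norm blinfun.diff_right)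
  then have "Cauchy (\<lambda>n. op_abs T (x (r n)))"
    using convergent_Cauchy[OF r(2)] by (simp add: Cauchy_def)
  with r(1) show "\<exists>r :: nat \<Rightarrow> nat. strict_mono r \<and> convergent (\<lambda>n. op_abs T (x (r n)))"
    using Cauchy_convergent by blast
qed

section \<open>Diagonalisation of compact positive operators\<close>

lift_definition rank_one_proj :: "'a \<Rightarrow> 'a::complex_hilbert_space \<Rightarrow>\<^sub>L 'a"
  is "\<lambda>e x. cinner x e *\<^sub>C e"
proof -
  fix e :: 'a
  show "bounded_linear (\<lambda>x. cinner x e *\<^sub>C e)"
    by (intro bounded_linear_compose[OF scaleC.bounded_linear_left cinner.bounded_linear_left])
qed

lemma rank_one_proj_bounded_ops: "rank_one_proj e \<in> bounded_ops"
  by (simp add: bounded_ops_def rank_one_proj.rep_eq cinner_scaleC_left scaleC_scaleC)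

lemma rank_one_proj_self_adjoint: "self_adjoint (rank_one_proj e)"
  unfolding self_adjoint_def
  by (simp add: rank_one_proj_bounded_ops rank_one_proj.rep_eq cinner_scaleC_left
      cinner_scaleC_right cinner_commute[of e, symmetric])

text \<open>
  For almost maximising unit vectors \<open>P\<^sup>2 x - \<parallel>P\<parallel>\<^sup>2 x\<close> tends to \<open>0\<close>. By compactness \<open>P x\<close>, and
  hence \<open>x\<close> itself, converges along a subsequence, and the limit \<open>e\<close> satisfies \<open>P\<^sup>2 e = \<parallel>P\<parallel>\<^sup>2 e\<close>.
  Since \<open>P + \<parallel>P\<parallel>\<close> is injective, \<open>e\<close> is an eigenvector of \<open>P\<close>.
\<close>

lemma top_eigenvector_exists:
  fixes P :: "'a::complex_hilbert_space \<Rightarrow>\<^sub>L 'a"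
  assumes P: "P \<in> positive_ops" and c: "compact_map P" and "P \<noteq> 0"
  shows "\<exists>e. norm e = 1 \<and> P e = norm P *\<^sub>R e"
proof -
  define N where "N = norm P"
  have N: "N > 0"
    using \<open>P \<noteq> 0\<close> by (simp add: N_def)
  have "\<exists>x. norm x = 1 \<and> norm (P x) > N * (1 - 1 / real (Suc n))" for n
  proof (rule ccontr)
    assume contr: "\<not> ?thesis"
    have "norm P \<le> N * (1 - 1 / real (Suc n))"
    proof (rule norm_blinfun_bound)
      show "0 \<le> N * (1 - 1 / real (Suc n))"
        using N by simp
      fix x
      show "norm (P x) \<le> N * (1 - 1 / real (Suc n)) * norm x"
      proof (cases "x = 0")
        case False
        then have "norm (P (sgn x)) \<le> N * (1 - 1 / real (Suc n))"
          using contr norm_sgn[of x] by force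
        then show ?thesis
          using False by (simp add: sgn_div_norm blinfun.scaleR_right field_simps)
      qed (simp add: blinfun.zero_right)
    qed
    moreover have "N * (1 - 1 / real (Suc n)) < N * 1"
      using N by (intro mult_strict_left_mono) auto
    ultimately show False
      by (simp add: N_def)
  qed
  then obtain x where nx: "\<And>n. norm (x n) = 1"
    and Px: "\<And>n. norm (blinfun_apply P (x n)) > N * (1 - 1 / real (Suc n))"
    by metis
  have lim_const: "(\<lambda>n. N * (1 - 1 / real (Suc n))) \<longlonglongrightarrow> N * (1 - 0)"
    by (intro tendsto_intros LIMSEQ_Suc[OF lim_1_over_n])
  have lim_norm: "(\<lambda>n. norm (P (x n))) \<longlonglongrightarrow> N"
  proof (rule tendsto_sandwich[OF _ _ _ tendsto_const])
    show "(\<lambda>n. N * (1 - 1 / real (Suc n))) \<longlonglongrightarrow> N"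
      using lim_const by simp
    show "\<forall>\<^sub>F n in sequentially. norm (P (x n)) \<le> N"
      using norm_blinfun[of P] nx by (auto simp: N_def intro!: always_eventually) (metis mult.right_neutral)
  qed (intro always_eventually allI less_imp_le Px)
  have sq_le: "(norm (P (P (x n)) - N\<^sup>2 *\<^sub>R x n))\<^sup>2 \<le> 2 * N\<^sup>2 * (N\<^sup>2 - (norm (P (x n)))\<^sup>2)" for n
  proof -
    have "inner (P (P (x n))) (x n) = (norm (P (x n)))\<^sup>2"
      by (simp add: positive_ops_inner[OF P] power2_norm_eq_inner)
    moreover have "inner (x n) (x n) = 1"
      using nx[of n] by (simp flip: power2_norm_eq_inner)
    ultimately have "(norm (P (P (x n)) - N\<^sup>2 *\<^sub>R x n))\<^sup>2
        = (norm (P (P (x n))))\<^sup>2 - 2 * N\<^sup>2 * (norm (P (x n)))\<^sup>2 + N\<^sup>2 * N\<^sup>2"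
      unfolding power2_norm_eq_inner[of "P (P (x n)) - N\<^sup>2 *\<^sub>R x n"] power2_norm_eq_inner[of "P (P (x n))"]
      by (simp add: inner_diff inner_commute algebra_simps)
    moreover have "(norm (P (P (x n))))\<^sup>2 \<le> (N * N)\<^sup>2"
    proof (rule power_mono)
      have "norm (P (P (x n))) \<le> N * norm (P (x n))" "norm (P (x n)) \<le> N"
        using norm_blinfun[of P "P (x n)"] norm_blinfun[of P "x n"] nx[of n] by (auto simp: N_def)
      then show "norm (P (P (x n))) \<le> N * N"
        using N by (smt (verit) mult_left_mono)
    qed simp
    ultimately show ?thesis
      by (simp add: power2_eq_square algebra_simps)
  qed
  have "(\<lambda>n. 2 * N\<^sup>2 * (N\<^sup>2 - (norm (P (x n)))\<^sup>2)) \<longlonglongrightarrow> 2 * N\<^sup>2 * (N\<^sup>2 - N\<^sup>2)"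
    by (intro tendsto_intros lim_norm)
  then have upper: "(\<lambda>n. 2 * N\<^sup>2 * (N\<^sup>2 - (norm (P (x n)))\<^sup>2)) \<longlonglongrightarrow> 0"
    by simp
  have "(\<lambda>n. (norm (P (P (x n)) - N\<^sup>2 *\<^sub>R x n))\<^sup>2) \<longlonglongrightarrow> 0"
  proof (rule tendsto_sandwich[OF _ _ tendsto_const upper])
    show "\<forall>\<^sub>F n in sequentially. 0 \<le> (norm (P (P (x n)) - N\<^sup>2 *\<^sub>R x n))\<^sup>2"
      by simp
    show "\<forall>\<^sub>F n in sequentially. (norm (P (P (x n)) - N\<^sup>2 *\<^sub>R x n))\<^sup>2
        \<le> 2 * N\<^sup>2 * (N\<^sup>2 - (norm (P (x n)))\<^sup>2)"
      by (intro always_eventually allI sq_le)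
  qed
  then have lim0: "(\<lambda>n. P (P (x n)) - N\<^sup>2 *\<^sub>R x n) \<longlonglongrightarrow> 0"
    by (simp add: tendsto_norm_zero_iff)
  obtain r :: "nat \<Rightarrow> nat" where r: "strict_mono r" "convergent (\<lambda>n. P (x (r n)))"
    using c[unfolded compact_map_def, rule_format, of x] nx by auto
  then obtain y where y: "(\<lambda>n. P (x (r n))) \<longlonglongrightarrow> y"
    by (auto simp: convergent_def)
  have "(\<lambda>n. P (P (x (r n))) - (P (P (x (r n))) - N\<^sup>2 *\<^sub>R x (r n))) \<longlonglongrightarrow> P y - 0"
    using LIMSEQ_subseq_LIMSEQ[OF lim0 r(1)]
    by (intro tendsto_diff blinfun.tendsto tendsto_const y) (simp add: o_def)
  then have "(\<lambda>n. (1 / N\<^sup>2) *\<^sub>R N\<^sup>2 *\<^sub>R x (r n)) \<longlonglongrightarrow> (1 / N\<^sup>2) *\<^sub>R P y"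
    by (intro tendsto_scaleR tendsto_const) simp
  then obtain e where e: "(\<lambda>n. x (r n)) \<longlonglongrightarrow> e"
    using N by auto
  have ne: "norm e = 1"
    using tendsto_norm[OF e] by (simp add: nx LIMSEQ_const_iff)
  have "(\<lambda>n. P (P (x (r n))) - N\<^sup>2 *\<^sub>R x (r n)) \<longlonglongrightarrow> P (P e) - N\<^sup>2 *\<^sub>R e"
    by (intro tendsto_intros blinfun.tendsto e)
  then have PPe: "P (P e) - N\<^sup>2 *\<^sub>R e = 0"
    by (rule LIMSEQ_unique) (use LIMSEQ_subseq_LIMSEQ[OF lim0 r(1)] in \<open>simp add: o_def\<close>)
  define u where "u = P e - N *\<^sub>R e"
  have "P u = - N *\<^sub>R u"
    using PPe by (simp add: u_def blinfun.bilinear_simps power2_eq_square algebra_simps)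
  moreover have "inner (P u) u \<ge> 0"
    using P positive_ops_iff by blast
  ultimately have "N * inner u u \<le> 0"
    by simp
  then have "inner u u = 0"
    using N inner_ge_zero[of u] by (simp add: mult_le_0_iff)
  then have "u = 0"
    by simp
  with ne show ?thesis
    by (auto simp: u_def N_def)
qed

text \<open>
  The zero operator gets the zero vector, so that repeated deflation never stops.
\<close>

definition top_eigenvector :: "('a::complex_hilbert_space \<Rightarrow>\<^sub>L 'a) \<Rightarrow> 'a" where
  "top_eigenvector P = (if P = 0 then 0 else SOME e. norm e = 1 \<and> P e = norm P *\<^sub>R e)"

primrec deflation :: "('a::complex_hilbert_space \<Rightarrow>\<^sub>L 'a) \<Rightarrow> nat \<Rightarrow> 'a \<Rightarrow>\<^sub>L 'a" where
  "deflation P 0 = P"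
| "deflation P (Suc n) = deflation P n -
     norm (deflation P n) *\<^sub>R rank_one_proj (top_eigenvector (deflation P n))"

definition eigenvector_seq :: "('a::complex_hilbert_space \<Rightarrow>\<^sub>L 'a) \<Rightarrow> nat \<Rightarrow> 'a" where
  "eigenvector_seq P n = top_eigenvector (deflation P n)"

definition eigenvalue_seq :: "('a::complex_hilbert_space \<Rightarrow>\<^sub>L 'a) \<Rightarrow> nat \<Rightarrow> real" where
  "eigenvalue_seq P n = norm (deflation P n)"

lemma top_eigenvector:
  fixes P :: "'a::complex_hilbert_space \<Rightarrow>\<^sub>L 'a"
  assumes P: "P \<in> positive_ops" and c: "compact_map P"
  shows "P (top_eigenvector P) = norm P *\<^sub>R top_eigenvector P"
    and "norm (top_eigenvector P) = (if P = 0 then 0 else 1)"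
proof -
  have "P \<noteq> 0 \<Longrightarrow> norm (top_eigenvector P) = 1 \<and> P (top_eigenvector P) = norm P *\<^sub>R top_eigenvector P"
    unfolding top_eigenvector_def
    using someI_ex[OF top_eigenvector_exists[OF P c]] by simp
  then show "P (top_eigenvector P) = norm P *\<^sub>R top_eigenvector P"
    and "norm (top_eigenvector P) = (if P = 0 then 0 else 1)"
    by (auto simp: top_eigenvector_def blinfun.zero_right)
qed

text \<open>
  Removing the top eigenvector \<open>e\<close> is the same as composing \<open>P\<close> with the projection onto the
  orthogonal complement of \<open>e\<close>.
\<close>

lemma deflation_step:
  fixes P :: "'a::complex_hilbert_space \<Rightarrow>\<^sub>L 'a"
  assumes P: "P \<in> positive_ops" and c: "compact_map P"
  defines "e \<equiv> top_eigenvector P"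
  defines "P' \<equiv> P - norm P *\<^sub>R rank_one_proj e"
  shows "P' \<in> positive_ops" and "compact_map P'" and "P' e = 0" and "norm P' \<le> norm P"
    and "P x = 0 \<Longrightarrow> P' x = 0"
proof -
  have bP: "P \<in> bounded_ops"
    using P by (simp add: positive_ops_def)
  have Pe: "P e = norm P *\<^sub>R e" and ne: "norm e = (if P = 0 then 0 else 1)"
    using top_eigenvector[OF P c] by (auto simp: e_def)
  define y where "y = (\<lambda>x. x - cinner x e *\<^sub>C e)"
  have P'_eq: "P' x = P (y x)" for x
    by (simp add: P'_def y_def blinfun.bilinear_simps rank_one_proj.rep_eq bounded_opsD[OF bP] Pe
        scaleC.scaleR_right)
  have "cinner e e = 1 \<or> e = 0"
    using ne by (auto simp: cinner_self split: if_splits)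
  then have ye: "cinner (y x) e = 0" for x
    by (auto simp: y_def cinner.diff_left cinner_scaleC_left cinner.zero_right)
  have x_eq: "x = y x + cinner x e *\<^sub>C e" for x
    by (simp add: y_def)
  have P'x: "inner (P' x) x = inner (P (y x)) (y x)" for x
  proof -
    have "cinner (P (y x)) e = 0"
      using self_adjointD[OF positive_ops_self_adjoint[OF P], of "y x" e]
      by (simp add: Pe cinner.scaleR_right ye)
    then have "cinner (P (y x)) x = cinner (P (y x)) (y x)"
      by (subst (2) x_eq) (simp add: cinner.add_right cinner_scaleC_right)
    then show ?thesis
      by (simp add: P'_eq inner_eq_Re_cinner)
  qed
  have sP': "self_adjoint P'"
    using positive_ops_self_adjoint[OF P] rank_one_proj_self_adjoint[of e]
    unfolding self_adjoint_def P'_def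
    by (auto intro!: bounded_ops_diff bounded_ops_scaleR
        simp: blinfun.bilinear_simps cinner.diff_left cinner.diff_right cinner.scaleR_left cinner.scaleR_right)
  then show "P' \<in> positive_ops"
    using P by (auto simp: positive_ops_iff P'x)
  have "P' = P o\<^sub>L (id_blinfun - rank_one_proj e)"
    by (rule blinfun_eqI) (simp add: P'_eq y_def blinfun.diff_left rank_one_proj.rep_eq)
  then show "compact_map P'"
    using compact_map_compose_right[OF c] by metis
  show "P' e = 0"
    using \<open>cinner e e = 1 \<or> e = 0\<close>
    by (auto simp: P'_eq y_def scaleC_one blinfun.zero_right)
  show "norm P' \<le> norm P"
  proof (rule norm_blinfun_bound)
    fix x
    have "(norm x)\<^sup>2 = (norm (y x))\<^sup>2 + (norm (cinner x e *\<^sub>C e))\<^sup>2"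
    proof -
      have "inner (y x) (cinner x e *\<^sub>C e) = 0"
        by (simp add: inner_eq_Re_cinner cinner_scaleC_right ye)
      then show ?thesis
        unfolding power2_norm_eq_inner
        by (subst (1 2) x_eq) (simp add: inner_add inner_commute del: add_diff_cancel)
    qed
    then have "norm (y x) \<le> norm x"
      by (simp add: power2_le_imp_le)
    have "norm (P' x) \<le> norm P * norm (y x)"
      unfolding P'_eq by (rule norm_blinfun)
    also have "\<dots> \<le> norm P * norm x"
      using \<open>norm (y x) \<le> norm x\<close> by (intro mult_left_mono) auto
    finally show "norm (P' x) \<le> norm P * norm x" .
  qed simp
  show "P' x = 0" if "P x = 0"
  proof -
    have "norm P * cinner x e = 0"
      using self_adjointD[OF positive_ops_self_adjoint[OF P], of x e] that
      by (simp add: Pe cinner.scaleR_right cinner.zero_left scaleR_conv_of_real)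
    then show ?thesis
      using that by (auto simp: P'_def blinfun.bilinear_simps rank_one_proj.rep_eq scaleC.zero_left)
  qed
qed

context
  fixes P :: "'a::complex_hilbert_space \<Rightarrow>\<^sub>L 'a"
  assumes P: "P \<in> positive_ops" and c: "compact_map P"
begin

lemma deflation_positive_compact: "deflation P n \<in> positive_ops \<and> compact_map (deflation P n)"
proof (induction n)
  case (Suc n)
  then show ?case
    using deflation_step(1,2)[of "deflation P n"] by simp
qed (use P c in simp)

lemmas deflation_positive = deflation_positive_compact[THEN conjunct1]
  and deflation_compact = deflation_positive_compact[THEN conjunct2]

lemma eigenvalue_seq_nonneg: "0 \<le> eigenvalue_seq P n"
  by (simp add: eigenvalue_seq_def)

lemma eigenvalue_seq_antimono: "antimono (eigenvalue_seq P)"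
  unfolding eigenvalue_seq_def
  using deflation_step(4)[OF deflation_positive deflation_compact]
  by (intro decseq_SucI) simp

lemma norm_eigenvector_seq:
  "norm (eigenvector_seq P n) = (if eigenvalue_seq P n = 0 then 0 else 1)"
  using top_eigenvector(2)[OF deflation_positive deflation_compact, of n]
  by (simp add: eigenvector_seq_def eigenvalue_seq_def)

lemma deflation_kills: "j < n \<Longrightarrow> deflation P n (eigenvector_seq P j) = 0"
proof (induction n)
  case (Suc n)
  then show ?case
    using deflation_step(3,5)[OF deflation_positive deflation_compact, of n]
    by (cases "j = n") (auto simp: eigenvector_seq_def)
qed simp

lemma deflation_eigenvector:
  "deflation P n (eigenvector_seq P n) = eigenvalue_seq P n *\<^sub>R eigenvector_seq P n"
  using top_eigenvector(1)[OF deflation_positive deflation_compact, of n]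
  by (simp add: eigenvector_seq_def eigenvalue_seq_def)

lemma eigenvector_seq_orthogonal:
  assumes "i \<noteq> j"
  shows "cinner (eigenvector_seq P i) (eigenvector_seq P j) = 0"
proof -
  have *: "cinner (eigenvector_seq P j) (eigenvector_seq P i) = 0" if "i < j" for i j
  proof (cases "eigenvalue_seq P j = 0")
    case True
    then have "eigenvector_seq P j = 0"
      using norm_eigenvector_seq[of j] by simp
    then show ?thesis by (simp add: cinner.zero_left)
  next
    case False
    have "eigenvalue_seq P j *\<^sub>R cinner (eigenvector_seq P j) (eigenvector_seq P i)
        = cinner (eigenvector_seq P j) (deflation P j (eigenvector_seq P i))"
      using self_adjointD[OF positive_ops_self_adjoint[OF deflation_positive]]
      by (metis cinner.scaleR_left deflation_eigenvector)
    also have "\<dots> = 0"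
      using that by (simp add: deflation_kills cinner.zero_right)
    finally show ?thesis
      using False by simp
  qed
  then show ?thesis
    using assms cinner_commute by (metis complex_cnj_zero linorder_neqE_nat)
qed

lemma deflation_expansion:
  "P x = deflation P n x +
     (\<Sum>j<n. eigenvalue_seq P j *\<^sub>R cinner x (eigenvector_seq P j) *\<^sub>C eigenvector_seq P j)"
  by (induction n) (simp_all add: blinfun.bilinear_simps rank_one_proj.rep_eq eigenvector_seq_def
      eigenvalue_seq_def)

lemma eigenvector_seq: "P (eigenvector_seq P n) = eigenvalue_seq P n *\<^sub>R eigenvector_seq P n"
  using deflation_expansion[of "eigenvector_seq P n" n]
  by (simp add: deflation_eigenvector eigenvector_seq_orthogonal scaleC.zero_left)

text \<open>
  If the eigenvalues stayed above \<open>L > 0\<close>, the images \<open>P e\<^sub>n\<close> of the orthonormal eigenvectors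
  would be pairwise at distance at least \<open>L\<close>.
\<close>

lemma eigenvalue_seq_tendsto_0: "eigenvalue_seq P \<longlonglongrightarrow> 0"
proof -
  obtain L where L: "eigenvalue_seq P \<longlonglongrightarrow> L" "\<And>n. L \<le> eigenvalue_seq P n"
    using decseq_convergent[OF eigenvalue_seq_antimono] eigenvalue_seq_nonneg by metis
  have "L \<ge> 0"
    using LIMSEQ_le_const[OF L(1)] eigenvalue_seq_nonneg by blast
  have "L = 0"
  proof (rule ccontr)
    assume "L \<noteq> 0"
    with \<open>L \<ge> 0\<close> have "L > 0" by simp
    have "norm (eigenvector_seq P n) \<le> 1" for n
      by (simp add: norm_eigenvector_seq)
    then obtain r :: "nat \<Rightarrow> nat" where r: "strict_mono r" "convergent (\<lambda>n. P (eigenvector_seq P (r n)))"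
      using c[unfolded compact_map_def, rule_format, of "eigenvector_seq P"] by auto
    obtain M where M: "\<And>m n. m \<ge> M \<Longrightarrow> n \<ge> M \<Longrightarrow>
        dist (P (eigenvector_seq P (r m))) (P (eigenvector_seq P (r n))) < L"
      using convergent_Cauchy[OF r(2)] \<open>L > 0\<close> unfolding Cauchy_def by meson
    define i j where "i = r M" and "j = r (Suc M)"
    have "i \<noteq> j"
      using r(1) by (simp add: i_def j_def strict_mono_eq)
    have pos: "eigenvalue_seq P i > 0" "eigenvalue_seq P j > 0"
      using L(2)[of i] L(2)[of j] \<open>L > 0\<close> by auto
    have "inner (eigenvector_seq P i) (eigenvector_seq P j) = 0"
      using eigenvector_seq_orthogonal[OF \<open>i \<noteq> j\<close>] by (simp add: inner_eq_Re_cinner)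
    then have "(norm (P (eigenvector_seq P i) - P (eigenvector_seq P j)))\<^sup>2
        = (eigenvalue_seq P i)\<^sup>2 * (norm (eigenvector_seq P i))\<^sup>2
          + (eigenvalue_seq P j)\<^sup>2 * (norm (eigenvector_seq P j))\<^sup>2"
      unfolding power2_norm_eq_inner eigenvector_seq
      by (simp add: inner_diff inner_commute power2_eq_square)
    also have "\<dots> = (eigenvalue_seq P i)\<^sup>2 + (eigenvalue_seq P j)\<^sup>2"
      using pos by (simp add: norm_eigenvector_seq)
    finally have eq: "(norm (P (eigenvector_seq P i) - P (eigenvector_seq P j)))\<^sup>2
        = (eigenvalue_seq P i)\<^sup>2 + (eigenvalue_seq P j)\<^sup>2" .
    have "L\<^sup>2 \<le> (eigenvalue_seq P i)\<^sup>2"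
      using power_mono[OF L(2)[of i] \<open>L \<ge> 0\<close>] .
    then have "L\<^sup>2 \<le> (norm (P (eigenvector_seq P i) - P (eigenvector_seq P j)))\<^sup>2"
      unfolding eq using zero_le_power2[of "eigenvalue_seq P j"] by linarith
    then have "L \<le> dist (P (eigenvector_seq P i)) (P (eigenvector_seq P j))"
      unfolding dist_norm by (rule power2_le_imp_le) simp
    with M[of M "Suc M"] show False
      by (simp add: i_def j_def)
  qed
  with L show ?thesis by simp
qed

lemma norm_deflation_le: "norm (deflation P n x) \<le> eigenvalue_seq P n * norm x"
  by (simp add: eigenvalue_seq_def norm_blinfun)

text \<open>
  The eigenvectors with eigenvalue \<open>\<mu>\<close> in the sequence form a basis of the eigenspace: a
  \<open>\<mu>\<close>-eigenvector \<open>y\<close> orthogonal to them is orthogonal to the whole sequence, so all deflations act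
  on it as \<open>\<mu>\<close>, while their norms tend to \<open>0\<close>.
\<close>

lemma dim_eigenspace:
  assumes "\<mu> > 0"
  shows "complex_vector.dim {x. P x = \<mu> *\<^sub>R x} = card {n. eigenvalue_seq P n = \<mu>}"
proof -
  define I where "I = {n. eigenvalue_seq P n = \<mu>}"
  have "\<forall>\<^sub>F n in sequentially. eigenvalue_seq P n < \<mu>"
    using order_tendstoD(2)[OF eigenvalue_seq_tendsto_0 assms] .
  then obtain M where M: "\<And>n. n \<ge> M \<Longrightarrow> eigenvalue_seq P n < \<mu>"
    by (auto simp: eventually_sequentially)
  have "I \<subseteq> {..<M}"
  proof
    fix i assume "i \<in> I"
    then show "i \<in> {..<M}"
      using M[of i] by (cases "M \<le> i") (auto simp: I_def)
  qed
  then have fin: "finite I"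
    using finite_subset by blast
  have self: "cinner (eigenvector_seq P i) (eigenvector_seq P i) = 1" if "i \<in> I" for i
    using that assms norm_eigenvector_seq[of i] by (simp add: I_def cinner_self)
  have inj: "inj_on (eigenvector_seq P) I"
    using self eigenvector_seq_orthogonal by (metis inj_onI zero_neq_one)
  define B where "B = eigenvector_seq P ` I"
  have coeff: "cinner (\<Sum>v\<in>B. u v *\<^sub>C v) w = u w" if "w \<in> B" for u w
  proof -
    have "cinner (\<Sum>v\<in>B. u v *\<^sub>C v) w = (\<Sum>v\<in>B. u v * cinner v w)"
      by (simp add: cinner.sum_left cinner_scaleC_left)
    also have "\<dots> = (\<Sum>v\<in>B. if v = w then u w else 0)"
    proof (rule sum.cong)
      fix v assume "v \<in> B"
      then obtain i where i: "i \<in> I" "v = eigenvector_seq P i" by (auto simp: B_def)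
      obtain k where k: "k \<in> I" "w = eigenvector_seq P k"
        using \<open>w \<in> B\<close> by (auto simp: B_def)
      show "u v * cinner v w = (if v = w then u w else 0)"
        using self[OF i(1)] eigenvector_seq_orthogonal[of i k] i k by (cases "i = k") auto
    qed simp
    also have "\<dots> = u w"
      using that fin by (simp add: B_def)
    finally show ?thesis .
  qed
  have "complex_vector.dim {x. P x = \<mu> *\<^sub>R x} = card I"
  proof (rule complex_vector.dim_unique)
    show "B \<subseteq> {x. P x = \<mu> *\<^sub>R x}"
      by (auto simp: B_def I_def eigenvector_seq)
    have "u v = 0" if "(\<Sum>w\<in>B. u w *\<^sub>C w) = 0" "v \<in> B" for u v
      using coeff[OF that(2), of u] that(1) by (simp add: cinner.zero_left)
    moreover have "finite B"
      using fin by (simp add: B_def)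
    ultimately show "complex_vector.independent B"
      using complex_vector.dependent_finite[of B] by blast
    show "card B = card I"
      unfolding B_def by (rule card_image[OF inj])
    show "{x. P x = \<mu> *\<^sub>R x} \<subseteq> complex_vector.span B"
    proof
      fix x assume "x \<in> {x. P x = \<mu> *\<^sub>R x}"
      then have x: "P x = \<mu> *\<^sub>R x" by simp
      define y where "y = x - (\<Sum>b\<in>B. cinner x b *\<^sub>C b)"
      have PB: "P b = \<mu> *\<^sub>R b" if "b \<in> B" for b
        using that by (auto simp: B_def I_def eigenvector_seq)
      have "P (\<Sum>b\<in>B. cinner x b *\<^sub>C b) = (\<Sum>b\<in>B. \<mu> *\<^sub>R cinner x b *\<^sub>C b)"
        using P unfolding blinfun.sum_right
        by (intro sum.cong) (auto simp: bounded_opsD positive_ops_def PB scaleC.scaleR_right)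
      then have Py: "P y = \<mu> *\<^sub>R y"
        by (simp add: y_def blinfun.diff_right x scaleR_diff_right scaleR_sum_right)
      have orth: "cinner y (eigenvector_seq P n) = 0" for n
      proof (cases "n \<in> I")
        case True
        then show ?thesis
          by (simp add: y_def cinner.diff_left coeff B_def[symmetric]) (simp add: B_def coeff[unfolded B_def])
      next
        case False
        have "\<mu> *\<^sub>R cinner y (eigenvector_seq P n) = eigenvalue_seq P n *\<^sub>R cinner y (eigenvector_seq P n)"
          using self_adjointD[OF positive_ops_self_adjoint[OF P], of y "eigenvector_seq P n"]
          by (simp add: Py eigenvector_seq cinner.scaleR_left cinner.scaleR_right)
        with False show ?thesis
          by (auto simp: I_def)
      qed
      have "\<mu> * norm y \<le> eigenvalue_seq P n * norm y" for n
      proof -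
        have "deflation P n y = \<mu> *\<^sub>R y"
          using deflation_expansion[of y n] by (simp add: orth scaleC.zero_left Py)
        with norm_deflation_le[of n y] assms show ?thesis
          by simp
      qed
      then have "\<mu> * norm y \<le> 0 * norm y"
        by (intro LIMSEQ_le_const[OF tendsto_mult[OF eigenvalue_seq_tendsto_0 tendsto_const]]) auto
      then have "y = 0"
        using assms by (simp add: mult_le_0_iff)
      then have "x = (\<Sum>b\<in>B. cinner x b *\<^sub>C b)"
        by (simp add: y_def)
      moreover have "(\<Sum>b\<in>B. cinner x b *\<^sub>C b) \<in> complex_vector.span B"
        by (intro complex_vector.span_sum complex_vector.span_scale complex_vector.span_base)
      ultimately show "x \<in> complex_vector.span B"
        by simp
    qed
  qed
  then show ?thesis
    by (simp add: I_def)
qed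

end

section \<open>Singular value decomposition\<close>

text \<open>
  At the first index \<open>n\<close> where two decreasing sequences differ, the larger one has the value \<open>s n\<close> at
  \<open>n\<close> itself, while the smaller one can only have it before \<open>n\<close>, where the sequences agree.
\<close>

lemma card_level_less:
  fixes s t :: "nat \<Rightarrow> real"
  assumes "antimono s" "antimono t" "s \<longlonglongrightarrow> 0" "\<And>n. 0 \<le> t n"
    and eq: "\<And>m. m < n \<Longrightarrow> s m = t m" and less: "t n < s n"
  shows "card {m. t m = s n} < card {m. s m = s n}"
proof (rule psubset_card_mono)
  have "\<forall>\<^sub>F m in sequentially. s m < s n"
    using order_tendstoD(2)[OF assms(3)] assms(4)[of n] less by simp
  then obtain M where M: "\<And>m. m \<ge> M \<Longrightarrow> s m < s n"
    by (auto simp: eventually_sequentially)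
  have "{m. s m = s n} \<subseteq> {..<M}"
  proof
    fix m assume "m \<in> {m. s m = s n}"
    then show "m \<in> {..<M}"
      using M[of m] by (cases "M \<le> m") auto
  qed
  then show "finite {m. s m = s n}"
    using finite_subset by blast
  have "m < n" if "t m = s n" for m
    using antimonoD[OF \<open>antimono t\<close>, of n m] that less by (cases "m < n") auto
  then have "{m. t m = s n} \<subseteq> {m. s m = s n}"
    using eq by auto
  moreover have "n \<notin> {m. t m = s n}" "n \<in> {m. s m = s n}"
    using less by auto
  ultimately show "{m. t m = s n} \<subset> {m. s m = s n}"
    by blast
qed

lemma decreasing_seq_determined_by_multiplicities:
  fixes s t :: "nat \<Rightarrow> real"
  assumes s: "antimono s" "\<And>n. 0 \<le> s n" "s \<longlonglongrightarrow> 0"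
    and t: "antimono t" "\<And>n. 0 \<le> t n" "t \<longlonglongrightarrow> 0"
    and card: "\<And>\<mu>. \<mu> > 0 \<Longrightarrow> card {n. s n = \<mu>} = card {n. t n = \<mu>}"
  shows "s = t"
proof (rule ccontr)
  assume "s \<noteq> t"
  then have ex: "\<exists>n. s n \<noteq> t n" by auto
  define n where "n = (LEAST n. s n \<noteq> t n)"
  have ne: "s n \<noteq> t n"
    using LeastI_ex[OF ex] by (simp add: n_def)
  have eq: "s m = t m" if "m < n" for m
    using not_less_Least[of m "\<lambda>n. s n \<noteq> t n"] that by (auto simp: n_def)
  show False
  proof (cases "t n < s n")
    case True
    with t(2)[of n] have "s n > 0" by linarith
    with card_level_less[OF s(1) t(1) s(3) t(2) eq True] card show False by simp
  next
    case False
    with ne have less: "s n < t n" by simp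
    with s(2)[of n] have "t n > 0" by linarith
    with card_level_less[OF t(1) s(1) t(3) s(2) eq[symmetric] less] card show False by simp
  qed
qed

lemma singular_values_eq_eigenvalue_seq:
  assumes T: "T \<in> bounded_ops" "compact_map T"
  shows "singular_values T = eigenvalue_seq (op_abs T)"
proof -
  note P = op_abs_positive[OF T(1)] compact_map_op_abs[OF T]
  note facts = eigenvalue_seq_antimono[OF P] eigenvalue_seq_nonneg[OF P]
    eigenvalue_seq_tendsto_0[OF P]
  show ?thesis
    unfolding singular_values_def
  proof (rule the_equality)
    fix s assume s: "antimono s \<and> (\<forall>n. 0 \<le> s n) \<and> s \<longlonglongrightarrow> 0 \<and>
     (\<forall>\<mu>>0. card {n. s n = \<mu>} = complex_vector.dim {x. op_abs T x = \<mu> *\<^sub>R x})"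
    show "s = eigenvalue_seq (op_abs T)"
      by (rule decreasing_seq_determined_by_multiplicities)
        (use s facts dim_eigenspace[OF P] in auto)
  qed (use facts dim_eigenspace[OF P] in auto)
qed

text \<open>
  Norms below \<open>1\<close> are allowed because null vectors stand in for the singular vectors that belong to
  the singular value \<open>0\<close>. Bessel's inequality still holds.
\<close>

definition suborthonormal :: "'i set \<Rightarrow> ('i \<Rightarrow> 'a::complex_hilbert_space) \<Rightarrow> bool" where
  "suborthonormal I e \<longleftrightarrow> (\<forall>i\<in>I. norm (e i) \<le> 1) \<and>
     (\<forall>i\<in>I. \<forall>j\<in>I. i \<noteq> j \<longrightarrow> cinner (e i) (e j) = 0)"

lemma Bessel_inequality:
  assumes e: "suborthonormal I e" and fin: "finite I"
  shows "(\<Sum>i\<in>I. (cmod (cinner x (e i)))\<^sup>2) \<le> (norm x)\<^sup>2"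
proof -
  define u where "u = (\<Sum>i\<in>I. cinner x (e i) *\<^sub>C e i)"
  define b where "b = (\<Sum>i\<in>I. (cmod (cinner x (e i)))\<^sup>2)"
  have "cinner x u = (\<Sum>i\<in>I. cnj (cinner x (e i)) * cinner x (e i))"
    by (simp add: u_def cinner.sum_right cinner_scaleC_right)
  also have "\<dots> = complex_of_real b"
    by (simp add: b_def complex_norm_square mult.commute del: of_real_power)
  finally have xu: "inner x u = b"
    by (simp add: inner_eq_Re_cinner)
  have ue: "cinner u (e j) = cinner x (e j) * complex_of_real ((norm (e j))\<^sup>2)" if "j \<in> I" for j
  proof -
    have "cinner u (e j) = (\<Sum>i\<in>I. cinner x (e i) * cinner (e i) (e j))"
      by (simp add: u_def cinner.sum_left cinner_scaleC_left)
    also have "\<dots> = (\<Sum>i\<in>I. if i = j then cinner x (e j) * cinner (e j) (e j) else 0)"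
      using e that unfolding suborthonormal_def by (intro sum.cong) auto
    also have "\<dots> = cinner x (e j) * cinner (e j) (e j)"
      using fin that by simp
    finally show ?thesis
      by (simp add: cinner_self)
  qed
  have "cinner u u = (\<Sum>j\<in>I. cnj (cinner x (e j)) * cinner u (e j))"
    by (subst (2) u_def) (simp add: cinner.sum_right cinner_scaleC_right)
  also have "\<dots> = (\<Sum>j\<in>I. complex_of_real ((cmod (cinner x (e j)))\<^sup>2 * (norm (e j))\<^sup>2))"
    by (intro sum.cong) (auto simp: ue complex_norm_square mult.commute mult.left_commute
        simp del: of_real_power)
  finally have "inner u u = (\<Sum>j\<in>I. (cmod (cinner x (e j)))\<^sup>2 * (norm (e j))\<^sup>2)"
    by (simp add: inner_eq_Re_cinner del: of_real_mult of_real_power)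
  also have "\<dots> \<le> (\<Sum>j\<in>I. (cmod (cinner x (e j)))\<^sup>2 * 1)"
    using e unfolding suborthonormal_def
    by (intro sum_mono mult_left_mono) (auto simp: power_le_one)
  finally have uu: "inner u u \<le> b"
    by (simp add: b_def)
  have "0 \<le> inner (x - u) (x - u)"
    by simp
  also have "\<dots> = inner x x - 2 * inner x u + inner u u"
    by (simp add: inner_diff inner_commute)
  finally have "b \<le> inner x x"
    using xu uu by linarith
  then show ?thesis
    by (simp add: b_def power2_norm_eq_inner)
qed

text \<open>
  The right singular vectors are the eigenvectors of \<open>\<bar>T\<bar>\<close>, the left ones their normalised images
  under \<open>T\<close>. Vectors belonging to the singular value \<open>0\<close> are set to \<open>0\<close>, which is why the
  families are only suborthonormal.
\<close>

lemma singular_value_decomposition: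
  fixes T :: "'a::complex_hilbert_space \<Rightarrow>\<^sub>L 'a"
  assumes T: "T \<in> bounded_ops" "compact_map T"
  obtains e f :: "nat \<Rightarrow> 'a" where
    "suborthonormal UNIV e" "suborthonormal UNIV f"
    "\<And>n. singular_values T n > 0 \<Longrightarrow> norm (e n) = 1"
    "\<And>n. singular_values T n > 0 \<Longrightarrow> norm (f n) = 1"
    "\<And>n. T (e n) = singular_values T n *\<^sub>R f n"
    "\<And>n. op_adjoint T (f n) = singular_values T n *\<^sub>R e n"
    "\<And>n x. norm (T x - (\<Sum>i<n. singular_values T i *\<^sub>R cinner x (e i) *\<^sub>C f i))
       \<le> singular_values T n * norm x"
proof -
  define P where "P = op_abs T"
  define s where "s = singular_values T"
  define e where "e = eigenvector_seq P"
  define f where "f = (\<lambda>n. (1 / s n) *\<^sub>R T (e n))"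
  have P: "P \<in> positive_ops" "compact_map P"
    using op_abs_positive[OF T(1)] compact_map_op_abs[OF T] by (auto simp: P_def)
  have s_eq: "s = eigenvalue_seq P"
    using singular_values_eq_eigenvalue_seq[OF T] by (simp add: s_def P_def)
  have ne: "norm (e n) = (if s n = 0 then 0 else 1)" for n
    using norm_eigenvector_seq[OF P, of n] by (simp add: e_def s_eq)
  have Pe: "P (e n) = s n *\<^sub>R e n" for n
    using eigenvector_seq[OF P, of n] by (simp add: e_def s_eq)
  have oe: "cinner (e i) (e j) = 0" if "i \<noteq> j" for i j
    using eigenvector_seq_orthogonal[OF P that] by (simp add: e_def)
  have Te: "T (e n) = s n *\<^sub>R f n" for n
    using ne[of n] by (auto simp: f_def blinfun.zero_right)
  have TTe: "op_adjoint T (T (e n)) = (s n)\<^sup>2 *\<^sub>R e n" for n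
    using op_abs_squared[OF T(1), of "e n"]
    by (simp add: Pe blinfun.scaleR_right power2_eq_square flip: P_def)
  have Tf: "op_adjoint T (f n) = s n *\<^sub>R e n" for n
    by (simp add: f_def blinfun.scaleR_right TTe power2_eq_square)
  have ff: "cinner (f i) (f j) = (s i / s j) *\<^sub>R cinner (e i) (e j)" for i j
  proof -
    have "cinner (f i) (f j) = (1 / s j) *\<^sub>R cinner (f i) (T (e j))"
      by (subst (2) f_def) (simp add: cinner.scaleR_right)
    also have "\<dots> = (1 / s j) *\<^sub>R cinner (op_adjoint T (f i)) (e j)"
      by (simp add: cinner_op_adjoint'[OF T(1)])
    finally show ?thesis
      by (simp add: Tf cinner.scaleR_left)
  qed
  have nf: "norm (f n) = (if s n = 0 then 0 else 1)" for n
  proof (cases "s n = 0")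
    case False
    then have "cinner (f n) (f n) = 1"
      unfolding ff using ne[of n] by (simp add: cinner_self)
    then have "complex_of_real ((norm (f n))\<^sup>2) = complex_of_real 1"
      by (simp only: cinner_self of_real_1)
    then have "(norm (f n))\<^sup>2 = 1"
      by (simp only: of_real_eq_iff)
    then show ?thesis
      using False norm_ge_zero[of "f n"] unfolding power2_eq_1_iff by auto
  qed (simp add: f_def)
  show thesis
  proof (rule that[of e f, folded s_def])
    show "suborthonormal UNIV e" "suborthonormal UNIV f"
      by (simp_all add: suborthonormal_def ne nf oe ff)
    show "op_adjoint T (f n) = s n *\<^sub>R e n" "T (e n) = s n *\<^sub>R f n" for n
      by (rule Tf Te)+
    fix n x
    define z where "z = x - (\<Sum>i<n. cinner x (e i) *\<^sub>C e i)"
    have "T z = T x - (\<Sum>i<n. s i *\<^sub>R cinner x (e i) *\<^sub>C f i)"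
      by (simp add: z_def blinfun.diff_right blinfun.sum_right bounded_opsD[OF T(1)] Te scaleC.scaleR_right)
    moreover have "P z = deflation P n x"
      using deflation_expansion[OF P, of x n] P(1)
      by (simp add: z_def blinfun.diff_right blinfun.sum_right bounded_opsD positive_ops_def Pe
          scaleC.scaleR_right flip: e_def s_eq)
    then have "norm (P z) \<le> s n * norm x"
      using norm_deflation_le[OF P] by (simp add: s_eq)
    ultimately show "norm (T x - (\<Sum>i<n. s i *\<^sub>R cinner x (e i) *\<^sub>C f i)) \<le> s n * norm x"
      using norm_op_abs[OF T(1), of z] by (simp add: P_def)
  qed (auto simp: ne nf)
qed

lemma
  assumes T: "T \<in> bounded_ops" "compact_map T"
  shows singular_values_antimono: "antimono (singular_values T)"
    and singular_values_nonneg: "0 \<le> singular_values T n"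
    and singular_values_tendsto_0: "singular_values T \<longlonglongrightarrow> 0"
proof -
  note P = op_abs_positive[OF T(1)] compact_map_op_abs[OF T]
  show "antimono (singular_values T)" "0 \<le> singular_values T n" "singular_values T \<longlonglongrightarrow> 0"
    unfolding singular_values_eq_eigenvalue_seq[OF T]
    by (fact eigenvalue_seq_antimono[OF P] eigenvalue_seq_nonneg[OF P] eigenvalue_seq_tendsto_0[OF P])+
qed

section \<open>Ky Fan sums\<close>

text \<open>
  Ky Fan sums are estimated through the block operator \<open>(p, q) \<mapsto> (T q, T\<^sup>* p)\<close>, which acts on the
  product of the space with itself.
\<close>

instantiation prod :: (complex_hilbert_space, complex_hilbert_space) complex_hilbert_space
begin

definition "scaleC_prod c (x :: 'a \<times> 'b) = (c *\<^sub>C fst x, c *\<^sub>C snd x)"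

definition "cinner_prod (x :: 'a \<times> 'b) y = cinner (fst x) (fst y) + cinner (snd x) (snd y)"

instance
proof
  fix c d :: complex and r :: real and x y z :: "'a \<times> 'b"
  show "c *\<^sub>C (x + y) = c *\<^sub>C x + c *\<^sub>C y" "(c + d) *\<^sub>C x = c *\<^sub>C x + d *\<^sub>C x"
    "c *\<^sub>C d *\<^sub>C x = (c * d) *\<^sub>C x" "1 *\<^sub>C x = x"
    by (simp_all add: scaleC_prod_def scaleC_add_left scaleC_add_right scaleC_scaleC scaleC_one)
  show "r *\<^sub>R x = complex_of_real r *\<^sub>C x"
    by (simp add: scaleC_prod_def prod_eq_iff flip: scaleR_scaleC)
  show "cinner x y = cnj (cinner y x)"
    by (simp add: cinner_prod_def flip: cinner_commute)
  show "cinner (x + y) z = cinner x z + cinner y z"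
    by (simp add: cinner_prod_def cinner_add_left)
  show "cinner (c *\<^sub>C x) y = c * cinner x y"
    by (simp add: cinner_prod_def scaleC_prod_def cinner_scaleC_left distrib_left)
  show "inner x y = Re (cinner x y)"
    by (simp add: cinner_prod_def inner_prod_def inner_eq_Re_cinner)
qed

end

lemma suborthonormal_pair:
  assumes e: "suborthonormal UNIV e" and f: "suborthonormal UNIV f"
  shows "suborthonormal I (\<lambda>i. ((1 / sqrt 2) *\<^sub>R f i, (1 / sqrt 2) *\<^sub>R e i))"
proof -
  define u where "u = (\<lambda>i. ((1 / sqrt 2) *\<^sub>R f i, (1 / sqrt 2) *\<^sub>R e i))"
  have "suborthonormal I u"
    unfolding suborthonormal_def
  proof (intro conjI ballI impI)
    fix i
    have "(norm (u i))\<^sup>2 = ((norm (f i))\<^sup>2 + (norm (e i))\<^sup>2) / 2"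
      by (simp add: u_def norm_prod_def power_divide add_divide_distrib)
    also have "\<dots> \<le> (1 + 1) / 2"
      using e f unfolding suborthonormal_def
      by (intro divide_right_mono add_mono) (auto simp: power_le_one)
    finally show "norm (u i) \<le> 1"
      by (simp add: power2_le_imp_le)
    fix j assume "i \<noteq> j"
    then show "cinner (u i) (u j) = 0"
      using e f unfolding suborthonormal_def
      by (simp add: u_def cinner_prod_def cinner.scaleR_left cinner.scaleR_right)
  qed
  then show ?thesis
    by (simp add: u_def)
qed

text \<open>
  Subtracting \<open>s k\<close> from all entries makes those before \<open>k\<close> nonnegative, where the weight \<open>1\<close> is best, and
  those after \<open>k\<close> nonpositive, where the weight \<open>0\<close> is best.
\<close>

lemma weighted_sum_le_initial_sum:
  fixes s c :: "nat \<Rightarrow> real"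
  assumes s: "antimono s" and c: "\<And>i. 0 \<le> c i" "\<And>i. c i \<le> 1"
    and "s k \<ge> 0" "k \<le> n" and sum: "(\<Sum>i<n. c i) \<le> real k"
  shows "(\<Sum>i<n. s i * c i) \<le> (\<Sum>i<k. s i)"
proof -
  have "(\<Sum>i<n. s i * c i) - s k * (\<Sum>i<n. c i) = (\<Sum>i<n. (s i - s k) * c i)"
    by (simp add: sum_subtractf sum_distrib_left algebra_simps)
  also have "\<dots> \<le> (\<Sum>i<n. if i < k then s i - s k else 0)"
  proof (rule sum_mono)
    fix i
    show "(s i - s k) * c i \<le> (if i < k then s i - s k else 0)"
      using antimonoD[OF s, of i k] antimonoD[OF s, of k i] c[of i]
      by (auto simp: mult_left_le mult_nonpos_nonneg)
  qed
  also have "\<dots> = (\<Sum>i<k. s i - s k)"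
    using \<open>k \<le> n\<close> by (intro sum.mono_neutral_cong_right) auto
  finally have "(\<Sum>i<n. s i * c i) \<le> (\<Sum>i<k. s i) + s k * ((\<Sum>i<n. c i) - real k)"
    by (simp add: sum_subtractf algebra_simps)
  also have "s k * ((\<Sum>i<n. c i) - real k) \<le> 0"
    using \<open>s k \<ge> 0\<close> sum by (intro mult_nonneg_nonpos) auto
  finally show ?thesis by simp
qed

text \<open>
  The block operator \<open>(p, q) \<mapsto> (T q, T\<^sup>* p)\<close> has the eigenvectors \<open>(f\<^sub>i, e\<^sub>i)/\<surd>2\<close> with eigenvalues
  \<open>s\<^sub>i\<close>, and \<open>2 Re \<langle>T q, p\<rangle>\<close> is its quadratic form. So this is Ky Fan's maximum principle for the
  block operator.
\<close>

lemma Ky_Fan_bound: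
  fixes T :: "'a::complex_hilbert_space \<Rightarrow>\<^sub>L 'a" and w :: "nat \<Rightarrow> 'a \<times> 'a"
  assumes T: "T \<in> bounded_ops" "compact_map T" and w: "suborthonormal {..<k} w"
  shows "(\<Sum>j<k. 2 * Re (cinner (T (snd (w j))) (fst (w j)))) \<le> (\<Sum>j<k. singular_values T j)"
proof -
  define s where "s = singular_values T"
  obtain e f where e: "suborthonormal UNIV e" and f: "suborthonormal UNIV f"
    and "\<And>n. s n > 0 \<Longrightarrow> norm (e n) = 1" and "\<And>n. s n > 0 \<Longrightarrow> norm (f n) = 1"
    and "\<And>n. T (e n) = s n *\<^sub>R f n" and "\<And>n. op_adjoint T (f n) = s n *\<^sub>R e n"
    and approx: "\<And>n x. norm (T x - (\<Sum>i<n. s i *\<^sub>R cinner x (e i) *\<^sub>C f i)) \<le> s n * norm x"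
    by (rule singular_value_decomposition[OF T, folded s_def]) (rule that)
  have s: "antimono s" "\<And>n. 0 \<le> s n" "s \<longlonglongrightarrow> 0"
    using singular_values_antimono[OF T] singular_values_nonneg[OF T] singular_values_tendsto_0[OF T]
    by (auto simp: s_def)
  define u where "u = (\<lambda>i. ((1 / sqrt 2) *\<^sub>R f i, (1 / sqrt 2) *\<^sub>R e i))"
  have cu: "cinner (p, q) (u i) = (1 / sqrt 2) *\<^sub>R (cinner p (f i) + cinner q (e i))" for p q i
    by (simp add: u_def cinner_prod_def cinner.scaleR_right scaleR_add_right)
  have ou: "suborthonormal I u" for I
    unfolding u_def by (rule suborthonormal_pair[OF e f])
  \<comment> \<open>by Bessel, in both directions, these weights lie in \<open>[0, 1]\<close> and sum up to at most \<open>k\<close>\<close>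
  define c where "c = (\<lambda>i. \<Sum>j<k. (cmod (cinner (w j) (u i)))\<^sup>2)"
  have c0: "0 \<le> c i" for i
    by (simp add: c_def sum_nonneg)
  have c1: "c i \<le> 1" for i
  proof -
    have "c i = (\<Sum>j<k. (cmod (cinner (u i) (w j)))\<^sup>2)"
      unfolding c_def by (metis cinner_commute complex_mod_cnj)
    also have "\<dots> \<le> (norm (u i))\<^sup>2"
      by (rule Bessel_inequality[OF w]) simp
    also have "\<dots> \<le> 1"
      using ou[of UNIV] by (simp add: suborthonormal_def power_le_one)
    finally show ?thesis .
  qed
  have csum: "(\<Sum>i<n. c i) \<le> real k" for n
  proof -
    have "(\<Sum>i<n. c i) = (\<Sum>j<k. \<Sum>i<n. (cmod (cinner (w j) (u i)))\<^sup>2)"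
      unfolding c_def by (rule sum.swap)
    also have "\<dots> \<le> (\<Sum>j<k. 1)"
    proof (rule sum_mono)
      fix j assume "j \<in> {..<k}"
      have "(\<Sum>i<n. (cmod (cinner (w j) (u i)))\<^sup>2) \<le> (norm (w j))\<^sup>2"
        by (rule Bessel_inequality[OF ou]) simp
      also have "\<dots> \<le> 1"
        using w \<open>j \<in> {..<k}\<close> by (simp add: suborthonormal_def power_le_one)
      finally show "(\<Sum>i<n. (cmod (cinner (w j) (u i)))\<^sup>2) \<le> 1" .
    qed
    finally show ?thesis by simp
  qed
  have step: "2 * Re (cinner (T (snd (w j))) (fst (w j)))
      \<le> (\<Sum>i<n. s i * (cmod (cinner (w j) (u i)))\<^sup>2) + 2 * s n" if "j < k" for j n
  proof -
    obtain p q where pq: "w j = (p, q)" by (cases "w j")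
    have "norm (w j) \<le> 1"
      using w that by (simp add: suborthonormal_def)
    then have np: "norm p \<le> 1" "norm q \<le> 1"
      using norm_fst_le[of p q] norm_snd_le[of q p] by (auto simp: pq)
    define r where "r = T q - (\<Sum>i<n. s i *\<^sub>R cinner q (e i) *\<^sub>C f i)"
    have "cmod (cinner r p) \<le> norm r * norm p"
      by (rule cinner_Cauchy_Schwarz)
    also have "\<dots> \<le> (s n * 1) * 1"
      using approx[where x = q and n = n] np s(2)[of n] unfolding r_def[symmetric]
      by (intro mult_mono) (auto intro: order_trans mult_left_le)
    finally have r: "Re (cinner r p) \<le> s n"
      using complex_Re_le_cmod[of "cinner r p"] by simp
    have "T q = (\<Sum>i<n. s i *\<^sub>R cinner q (e i) *\<^sub>C f i) + r"
      by (simp add: r_def)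
    then have "Re (cinner (T q) p) = (\<Sum>i<n. s i * Re (cinner q (e i) * cinner (f i) p)) + Re (cinner r p)"
      by (simp add: cinner.add_left cinner.sum_left cinner.scaleR_left cinner_scaleC_left)
    moreover have "2 * (\<Sum>i<n. s i * Re (cinner q (e i) * cinner (f i) p))
        \<le> (\<Sum>i<n. s i * (cmod (cinner (w j) (u i)))\<^sup>2)"
      unfolding sum_distrib_left
    proof (rule sum_mono)
      fix i
      define a b where "a = cinner q (e i)" and "b = cinner p (f i)"
      have "4 * Re (a * cnj b) \<le> (cmod (b + a))\<^sup>2"
      proof -
        have "(cmod (b + a))\<^sup>2 - 4 * Re (a * cnj b) = (cmod (a - b))\<^sup>2"
          unfolding cmod_power2 by (simp add: power2_eq_square algebra_simps)
        then show ?thesis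
          by (smt (verit) zero_le_power2)
      qed
      moreover have "(cmod (cinner (w j) (u i)))\<^sup>2 = (cmod (b + a))\<^sup>2 / 2"
        by (simp add: pq cu a_def b_def power_divide)
      moreover have "cinner (f i) p = cnj b"
        unfolding b_def by (rule cinner_commute)
      ultimately have "2 * Re (a * cinner (f i) p) \<le> (cmod (cinner (w j) (u i)))\<^sup>2"
        by simp
      then show "2 * (s i * Re (cinner q (e i) * cinner (f i) p)) \<le> s i * (cmod (cinner (w j) (u i)))\<^sup>2"
        using mult_left_mono[OF _ s(2)[of i]] unfolding a_def by (fastforce simp: algebra_simps)
    qed
    ultimately show ?thesis
      using r by (simp add: pq)
  qed
  \<comment> \<open>cutting the expansion of \<open>T\<close> off at \<open>n\<close> costs at most \<open>2 s\<^sub>n\<close> per vector, which tends to \<open>0\<close>\<close>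
  have bound: "(\<Sum>j<k. 2 * Re (cinner (T (snd (w j))) (fst (w j))))
      \<le> (\<Sum>j<k. s j) + real k * (2 * s n)" if "n \<ge> k" for n
  proof -
    have "(\<Sum>j<k. 2 * Re (cinner (T (snd (w j))) (fst (w j))))
        \<le> (\<Sum>j<k. (\<Sum>i<n. s i * (cmod (cinner (w j) (u i)))\<^sup>2) + 2 * s n)"
      using step by (intro sum_mono) auto
    also have "\<dots> = (\<Sum>i<n. s i * c i) + real k * (2 * s n)"
      by (subst sum.distrib, subst sum.swap) (simp add: c_def sum_distrib_left)
    also have "(\<Sum>i<n. s i * c i) \<le> (\<Sum>i<k. s i)"
      using that by (intro weighted_sum_le_initial_sum s c0 c1 csum)
    finally show ?thesis by simp
  qed
  have "(\<lambda>n. (\<Sum>j<k. s j) + real k * (2 * s n)) \<longlonglongrightarrow> (\<Sum>j<k. s j) + real k * (2 * 0)"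
    by (intro tendsto_intros s)
  then have "(\<Sum>j<k. 2 * Re (cinner (T (snd (w j))) (fst (w j)))) \<le> (\<Sum>j<k. s j) + real k * (2 * 0)"
    by (rule LIMSEQ_le_const) (use bound in blast)
  then show ?thesis
    by (simp add: s_def)
qed

text \<open>
  The sum for \<open>T\<close> is attained at the singular vectors of \<open>T\<close>, where it is compared with the bound for
  \<open>S\<close>. Exchanging the roles of \<open>S\<close> and \<open>T\<close> gives Lipschitz continuity in the operator norm.
\<close>

lemma Ky_Fan_sum_le_perturbed:
  fixes S T :: "'a::complex_hilbert_space \<Rightarrow>\<^sub>L 'a"
  assumes S: "S \<in> bounded_ops" "compact_map S" and T: "T \<in> bounded_ops" "compact_map T"
  shows "(\<Sum>j<k. singular_values T j) \<le> (\<Sum>j<k. singular_values S j) + real k * norm (T - S)"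
proof -
  define s where "s = singular_values T"
  obtain e f where e: "suborthonormal UNIV e" and f: "suborthonormal UNIV f"
    and "\<And>n. s n > 0 \<Longrightarrow> norm (e n) = 1" and nf: "\<And>n. s n > 0 \<Longrightarrow> norm (f n) = 1"
    and Te: "\<And>n. T (e n) = s n *\<^sub>R f n" and "\<And>n. op_adjoint T (f n) = s n *\<^sub>R e n"
    and "\<And>n x. norm (T x - (\<Sum>i<n. s i *\<^sub>R cinner x (e i) *\<^sub>C f i)) \<le> s n * norm x"
    by (rule singular_value_decomposition[OF T, folded s_def]) (rule that)
  define w where "w = (\<lambda>i. ((1 / sqrt 2) *\<^sub>R f i, (1 / sqrt 2) *\<^sub>R e i))"
  have w: "suborthonormal {..<k} w"
    unfolding w_def by (rule suborthonormal_pair[OF e f])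
  have s_le: "s j \<le> 2 * Re (cinner (S (snd (w j))) (fst (w j))) + norm (T - S)" for j
  proof -
    have "Re (cinner (T (e j)) (f j)) = s j"
      using nf[of j] singular_values_nonneg[OF T, of j]
      by (cases "s j = 0") (auto simp: Te s_def cinner.scaleR_left cinner.zero_left cinner_self)
    moreover have "2 * Re (cinner (S (snd (w j))) (fst (w j))) = Re (cinner (S (e j)) (f j))"
      by (simp add: w_def blinfun.scaleR_right cinner.scaleR_left cinner.scaleR_right)
    moreover have "Re (cinner (T (e j)) (f j)) - Re (cinner (S (e j)) (f j)) \<le> norm (T - S)"
    proof -
      have "Re (cinner (T (e j)) (f j)) - Re (cinner (S (e j)) (f j)) = inner ((T - S) (e j)) (f j)"
        by (simp add: blinfun.diff_left inner_eq_Re_cinner cinner.diff_left)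
      also have "\<dots> \<le> norm ((T - S) (e j)) * norm (f j)"
        by (rule norm_cauchy_schwarz)
      also have "\<dots> \<le> (norm (T - S) * 1) * 1"
      proof (intro mult_mono)
        have "norm ((T - S) (e j)) \<le> norm (T - S) * norm (e j)"
          by (rule norm_blinfun)
        also have "\<dots> \<le> norm (T - S) * 1"
          using e unfolding suborthonormal_def by (intro mult_left_mono) auto
        finally show "norm ((T - S) (e j)) \<le> norm (T - S) * 1" .
        show "norm (f j) \<le> 1"
          using f unfolding suborthonormal_def by simp
      qed auto
      finally show ?thesis by simp
    qed
    ultimately show ?thesis by linarith
  qed
  have "(\<Sum>j<k. s j) \<le> (\<Sum>j<k. 2 * Re (cinner (S (snd (w j))) (fst (w j))) + norm (T - S))"
    by (intro sum_mono s_le)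
  also have "\<dots> \<le> (\<Sum>j<k. singular_values S j) + real k * norm (T - S)"
    using Ky_Fan_bound[OF S w] by (simp add: sum.distrib)
  finally show ?thesis
    by (simp add: s_def)
qed

section \<open>The arithmetic-geometric mean inequality\<close>

text \<open>
  Gram-Schmidt applied to linearly independent eigenvectors makes the operator triangular, with the
  eigenvalues on the diagonal.
\<close>

lemma triangular_basis:
  fixes L :: "'b::complex_hilbert_space \<Rightarrow> 'b" and k :: nat
  assumes add: "\<And>x y. L (x + y) = L x + L y" and scale: "\<And>c x. L (c *\<^sub>C x) = c *\<^sub>C L x"
    and eig: "\<And>j. j < k \<Longrightarrow> L (v j) = \<mu> j *\<^sub>R v j"
    and indep: "\<And>j. j < k \<Longrightarrow> v j \<notin> complex_vector.span (v ` {..<j})"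
  shows "\<exists>w. (\<forall>i<k. norm (w i) = 1) \<and> (\<forall>i<k. \<forall>j<k. i \<noteq> j \<longrightarrow> cinner (w i) (w j) = 0) \<and>
    (\<forall>j<k. cinner (L (w j)) (w j) = complex_of_real (\<mu> j)) \<and>
    complex_vector.span (w ` {..<k}) = complex_vector.span (v ` {..<k})"
  using eig indep
proof (induction k)
  case 0
  then show ?case by simp
next
  case (Suc k)
  obtain w where norm: "\<And>i. i < k \<Longrightarrow> norm (w i) = 1"
      and orth: "\<And>i j. i < k \<Longrightarrow> j < k \<Longrightarrow> i \<noteq> j \<Longrightarrow> cinner (w i) (w j) = 0"
      and diag: "\<And>j. j < k \<Longrightarrow> cinner (L (w j)) (w j) = complex_of_real (\<mu> j)"
      and span: "complex_vector.span (w ` {..<k}) = complex_vector.span (v ` {..<k})"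
    using Suc.IH Suc.prems by (metis less_SucI)
  define V where "V = complex_vector.span (v ` {..<k})"
  have V: "complex_vector.subspace V"
    by (simp add: V_def)
  have LV: "L y \<in> V" if "y \<in> V" for y
    using that[unfolded V_def]
  proof (induction rule: complex_vector.span_induct)
    case base
    have "L 0 = 0" using scale[of 0 0] by (simp add: scaleC.zero_left)
    then show ?case
      using V by (simp add: complex_vector.subspace_def add scale)
  next
    case (step x)
    then obtain j where j: "j < k" "x = v j" by auto
    have "v j \<in> V"
      unfolding V_def using j by (intro complex_vector.span_base) auto
    then have "complex_of_real (\<mu> j) *\<^sub>C v j \<in> V"
      using complex_vector.subspace_scale[OF V] by blast
    then show ?case
      using Suc.prems(1)[of j] j by (simp add: scaleR_scaleC[of "\<mu> j" "v j"])
  qed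
  define u where "u = (\<Sum>i<k. cinner (v k) (w i) *\<^sub>C w i)"
  have wV: "w i \<in> V" if "i < k" for i
    unfolding V_def span[symmetric] using that by (intro complex_vector.span_base) auto
  have uV: "u \<in> V"
    unfolding u_def
    by (intro complex_vector.subspace_sum[OF V] complex_vector.subspace_scale[OF V] wV) simp
  define z where "z = v k - u"
  have "z \<noteq> 0"
    using Suc.prems(2)[of k] uV by (auto simp: z_def V_def)
  define c where "c = 1 / norm z"
  have "c > 0"
    using \<open>z \<noteq> 0\<close> by (simp add: c_def)
  define x where "x = c *\<^sub>R z"
  have nx: "norm x = 1"
    using \<open>z \<noteq> 0\<close> by (simp add: x_def c_def)
  have zw: "cinner z (w i) = 0" if "i < k" for i
  proof -
    have "cinner u (w i) = (\<Sum>j<k. cinner (v k) (w j) * cinner (w j) (w i))"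
      by (simp add: u_def cinner.sum_left cinner_scaleC_left)
    also have "\<dots> = (\<Sum>j<k. if j = i then cinner (v k) (w i) else 0)"
      using that orth by (intro sum.cong) (auto simp: cinner_self norm)
    finally show ?thesis
      using that by (simp add: z_def cinner.diff_left)
  qed
  have xV: "cinner y x = 0" if "y \<in> V" for y
    using that[unfolded V_def, folded span]
  proof (induction rule: complex_vector.span_induct)
    case base
    then show ?case
      by (simp add: complex_vector.subspace_def cinner.zero_left cinner.add_left cinner_scaleC_left)
  next
    case (step y)
    then obtain i where "i < k" "y = w i" by auto
    then have "cinner x y = 0"
      by (simp add: x_def cinner.scaleR_left zw)
    then show ?case
      by (subst cinner_commute) simp
  qed
  have vk: "v k = norm z *\<^sub>R x + u"
    using \<open>z \<noteq> 0\<close> by (simp add: x_def c_def z_def)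
  have scaleR: "L (r *\<^sub>R y) = r *\<^sub>R L y" for r y
    using scale[of "complex_of_real r" y] by (simp add: scaleR_scaleC[of r])
  have "L (v k) = \<mu> k *\<^sub>R v k"
    using Suc.prems(1) by simp
  then have "norm z *\<^sub>R L x + L u = \<mu> k *\<^sub>R norm z *\<^sub>R x + \<mu> k *\<^sub>R u"
    unfolding vk by (simp add: add scaleR scaleR_add_right)
  then have "cinner (norm z *\<^sub>R L x + L u) x = cinner (\<mu> k *\<^sub>R norm z *\<^sub>R x + \<mu> k *\<^sub>R u) x"
    by simp
  then have "norm z *\<^sub>R cinner (L x) x = norm z *\<^sub>R \<mu> k *\<^sub>R cinner x x"
    by (simp add: cinner.add_left cinner.scaleR_left xV[OF uV] xV[OF LV[OF uV]])
  then have diag_x: "cinner (L x) x = complex_of_real (\<mu> k)"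
    using \<open>z \<noteq> 0\<close> nx by (simp add: cinner_self scaleR_conv_of_real)
  define w' where "w' = w(k := x)"
  have img: "w' ` {..<Suc k} = insert x (w ` {..<k})" "v ` {..<Suc k} = insert (v k) (v ` {..<k})"
    by (auto simp: w'_def lessThan_Suc)
  have "complex_vector.span (w' ` {..<Suc k}) = complex_vector.span (v ` {..<Suc k})"
  proof (rule complex_vector.span_eq[THEN iffD2], intro conjI)
    have V1: "V \<subseteq> complex_vector.span (v ` {..<Suc k})"
      unfolding V_def by (intro complex_vector.span_mono) auto
    have V2: "V \<subseteq> complex_vector.span (w' ` {..<Suc k})"
      unfolding V_def span[symmetric] img by (intro complex_vector.span_mono) auto
    have "v k \<in> complex_vector.span (v ` {..<Suc k})"
      by (intro complex_vector.span_base) auto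
    then have "z \<in> complex_vector.span (v ` {..<Suc k})"
      unfolding z_def using uV V1 by (intro complex_vector.span_diff) auto
    then have "x \<in> complex_vector.span (v ` {..<Suc k})"
      unfolding x_def scaleR_scaleC[of c z] by (rule complex_vector.span_scale)
    with V1 wV show "w' ` {..<Suc k} \<subseteq> complex_vector.span (v ` {..<Suc k})"
      unfolding img(1) by auto
    have "x \<in> complex_vector.span (w' ` {..<Suc k})"
      unfolding img by (intro complex_vector.span_base) auto
    then have "complex_of_real (norm z) *\<^sub>C x + u \<in> complex_vector.span (w' ` {..<Suc k})"
      using uV V2 by (intro complex_vector.span_add complex_vector.span_scale) auto
    then have "v k \<in> complex_vector.span (w' ` {..<Suc k})"
      unfolding vk scaleR_scaleC[of "norm z" x] .
    moreover have "v ` {..<k} \<subseteq> V"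
      unfolding V_def by (rule complex_vector.span_superset)
    ultimately show "v ` {..<Suc k} \<subseteq> complex_vector.span (w' ` {..<Suc k})"
      using V2 unfolding img(2) by auto
  qed
  moreover have "cinner x (w i) = 0" "cinner (w i) x = 0" if "i < k" for i
    using zw[OF that] xV[OF wV[OF that]] by (simp_all add: x_def cinner.scaleR_left)
  ultimately show ?case
    using norm orth diag diag_x nx
    by (intro exI[of _ w']) (auto simp: w'_def less_Suc_eq)
qed

text \<open>
  Let \<open>e\<^sub>j, f\<^sub>j\<close> be the singular vectors of \<open>M = C Y D\<close>. The block operator
  \<open>(u, v) \<mapsto> (C\<^sup>2 Y v, D\<^sup>2 Y\<^sup>* u)\<close> has the eigenvectors \<open>(C f\<^sub>j, D e\<^sub>j)\<close> with eigenvalues \<open>s\<^sub>j\<close>.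
  Triangularising it produces an orthonormal family \<open>(p\<^sub>j, q\<^sub>j)\<close>, and the real parts of its diagonal
  entries only see the self-adjoint part, which is given by \<open>C\<^sup>2 Y + Y D\<^sup>2\<close>.
\<close>

lemma Ky_Fan_sum_compose:
  fixes C D Y :: "'a::complex_hilbert_space \<Rightarrow>\<^sub>L 'a"
  assumes C: "self_adjoint C" and D: "self_adjoint D" and Y: "Y \<in> bounded_ops" "compact_map Y"
  shows "\<exists>k\<le>n. \<exists>w :: nat \<Rightarrow> 'a \<times> 'a. suborthonormal {..<k} w \<and>
    (\<Sum>j<n. singular_values (C o\<^sub>L Y o\<^sub>L D) j)
      = (\<Sum>j<k. Re (cinner (C (C (Y (snd (w j)))) + Y (D (D (snd (w j))))) (fst (w j))))"
proof -
  define M where "M = C o\<^sub>L Y o\<^sub>L D"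
  define s where "s = singular_values M"
  note bC = self_adjoint_bounded_ops[OF C] and bD = self_adjoint_bounded_ops[OF D]
  have M: "M \<in> bounded_ops" "compact_map M"
    unfolding M_def
    by (intro bounded_ops_compose bC bD Y compact_map_compose_left compact_map_compose_right)+
  define Y' where "Y' = op_adjoint Y"
  have bY': "Y' \<in> bounded_ops" and Y': "\<And>x y. cinner (Y x) y = cinner x (Y' y)"
    using op_adjoint_bounded_ops[OF Y(1)] cinner_op_adjoint[OF Y(1)] by (auto simp: Y'_def)
  have M': "op_adjoint M x = D (Y' (C x))" for x
  proof (rule cinner_eqI_right)
    fix y
    show "cinner y (op_adjoint M x) = cinner y (D (Y' (C x)))"
      unfolding cinner_op_adjoint[OF M(1), symmetric]
      by (simp add: M_def self_adjointD[OF C] self_adjointD[OF D] Y')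
  qed
  obtain e f where e: "suborthonormal UNIV e" and f: "suborthonormal UNIV f"
    and ne: "\<And>n. s n > 0 \<Longrightarrow> norm (e n) = 1" and nf: "\<And>n. s n > 0 \<Longrightarrow> norm (f n) = 1"
    and Me: "\<And>n. M (e n) = s n *\<^sub>R f n" and Mf: "\<And>n. op_adjoint M (f n) = s n *\<^sub>R e n"
    and "\<And>n x. norm (M x - (\<Sum>i<n. s i *\<^sub>R cinner x (e i) *\<^sub>C f i)) \<le> s n * norm x"
    by (rule singular_value_decomposition[OF M, folded s_def]) (rule that)
  have s: "antimono s" "\<And>n. 0 \<le> s n"
    using singular_values_antimono[OF M] singular_values_nonneg[OF M] by (auto simp: s_def)
  \<comment> \<open>only the positive singular values give linearly independent eigenvectors\<close>
  have "\<exists>k\<le>n. (\<forall>j<k. s j > 0) \<and> (\<forall>j\<ge>k. j < n \<longrightarrow> s j = 0)"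
  proof (induction n)
    case (Suc n)
    then obtain k where k: "k \<le> n" "\<forall>j<k. s j > 0" "\<forall>j\<ge>k. j < n \<longrightarrow> s j = 0" by blast
    show ?case
    proof (cases "s n = 0")
      case True
      then show ?thesis
        using k by (intro exI[of _ k]) (auto simp: less_Suc_eq)
    next
      case False
      have "s j > 0" if "j \<le> n" for j
        using antimonoD[OF s(1) that] s(2)[of n] False by linarith
      then show ?thesis
        by (intro exI[of _ "Suc n"]) (auto simp: less_Suc_eq_le)
    qed
  qed simp
  then obtain k where "k \<le> n" and pos: "\<And>j. j < k \<Longrightarrow> s j > 0"
      and zero: "\<And>j. k \<le> j \<Longrightarrow> j < n \<Longrightarrow> s j = 0" by blast
  \<comment> \<open>\<open>G\<close> is the second component of \<open>L\<close> without the outer \<open>D\<close>; it sends \<open>v j\<close> to a multiple of \<open>e j\<close>, and the \<open>e j\<close> are orthogonal\<close>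
  define L :: "'a \<times> 'a \<Rightarrow> 'a \<times> 'a" where "L = (\<lambda>x. (C (C (Y (snd x))), D (D (Y' (fst x)))))"
  define v where "v = (\<lambda>j. (C (f j), D (e j)))"
  define G :: "'a \<times> 'a \<Rightarrow> 'a" where "G = (\<lambda>x. D (Y' (fst x)))"
  have eig: "L (v j) = s j *\<^sub>R v j" for j
    using Me[of j] Mf[of j] unfolding M' by (simp add: L_def v_def M_def blinfun.scaleR_right)
  have Gv: "G (v j) = s j *\<^sub>R e j" for j
    using Mf[of j] unfolding M' by (simp add: G_def v_def)
  have indep: "v j \<notin> complex_vector.span (v ` {..<j})" if "j < k" for j
  proof
    assume "v j \<in> complex_vector.span (v ` {..<j})"
    then have "cinner (G (v j)) (e j) = 0"
    proof (induction rule: complex_vector.span_induct)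
      case base
      then show ?case
        by (simp add: complex_vector.subspace_def G_def blinfun.bilinear_simps cinner.zero_left
            cinner.add_left scaleC_prod_def bounded_opsD[OF bY'] bounded_opsD[OF bD] cinner_scaleC_left)
    next
      case (step x)
      then obtain i where "i < j" "x = v i" by auto
      then show ?case
        using e by (simp add: Gv cinner.scaleR_left suborthonormal_def)
    qed
    then show False
      using pos[OF that] ne[of j] by (simp add: Gv cinner.scaleR_left cinner_self)
  qed
  have "L (x + y) = L x + L y" "L (c *\<^sub>C x) = c *\<^sub>C L x" for c x y
    by (simp_all add: L_def blinfun.bilinear_simps scaleC_prod_def bounded_opsD[OF bY']
        bounded_opsD[OF bD] bounded_opsD[OF bC] bounded_opsD[OF Y(1)])
  from triangular_basis[of L k v s, OF this eig indep]
  obtain w where nw: "\<And>i. i < k \<Longrightarrow> norm (w i) = 1"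
    and ow: "\<And>i j. i < k \<Longrightarrow> j < k \<Longrightarrow> i \<noteq> j \<Longrightarrow> cinner (w i) (w j) = 0"
    and diag: "\<And>j. j < k \<Longrightarrow> cinner (L (w j)) (w j) = complex_of_real (s j)"
    by blast
  have "s j = Re (cinner (C (C (Y (snd (w j)))) + Y (D (D (snd (w j))))) (fst (w j)))" if "j < k" for j
  proof -
    obtain p q where pq: "w j = (p, q)" by (cases "w j")
    have "cinner (D (D (Y' p))) q = cinner (Y' p) (D (D q))"
      by (simp add: self_adjointD[OF D])
    also have "\<dots> = cnj (cinner (Y (D (D q))) p)"
      unfolding Y' by (rule cinner_commute)
    finally have "Re (cinner (D (D (Y' p))) q) = Re (cinner (Y (D (D q))) p)"
      by simp
    moreover have "Re (cinner (L (w j)) (w j)) = s j"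
      by (simp add: diag[OF that])
    ultimately show ?thesis
      by (simp add: pq L_def cinner_prod_def cinner.add_left)
  qed
  moreover have "(\<Sum>j<n. s j) = (\<Sum>j<k. s j)"
    using \<open>k \<le> n\<close> zero by (intro sum.mono_neutral_right) auto
  moreover have "suborthonormal {..<k} w"
    using nw ow by (simp add: suborthonormal_def)
  ultimately show ?thesis
    using \<open>k \<le> n\<close> unfolding M_def[symmetric] s_def[symmetric]
    by (intro exI[of _ k] conjI exI[of _ w]) auto
qed

text \<open>
  The arithmetic-geometric mean inequality for Ky Fan sums. The right-hand operator is split into two
  summands because it is used with the triangle inequality.
\<close>

lemma Ky_Fan_arithmetic_geometric_mean:
  fixes C D Y :: "'a::complex_hilbert_space \<Rightarrow>\<^sub>L 'a"
  assumes C: "self_adjoint C" and D: "self_adjoint D" and Y: "Y \<in> bounded_ops" "compact_map Y"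
    and Z1: "Z1 \<in> bounded_ops" "compact_map Z1" and Z2: "Z2 \<in> bounded_ops" "compact_map Z2"
    and Z: "(C o\<^sub>L C o\<^sub>L Y) + (Y o\<^sub>L D o\<^sub>L D) = Z1 + Z2"
  shows "2 * (\<Sum>j<n. singular_values (C o\<^sub>L Y o\<^sub>L D) j)
    \<le> (\<Sum>j<n. singular_values Z1 j) + (\<Sum>j<n. singular_values Z2 j)"
proof -
  obtain k w where "k \<le> n" and w: "suborthonormal {..<k} w"
    and eq: "(\<Sum>j<n. singular_values (C o\<^sub>L Y o\<^sub>L D) j)
      = (\<Sum>j<k. Re (cinner (C (C (Y (snd (w j)))) + Y (D (D (snd (w j))))) (fst (w j))))"
    using Ky_Fan_sum_compose[OF C D Y] by blast
  have "C (C (Y q)) + Y (D (D q)) = Z1 q + Z2 q" for q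
    using arg_cong[OF Z, of "\<lambda>T. blinfun_apply T q"] by (simp add: blinfun.add_left)
  then have "2 * (\<Sum>j<n. singular_values (C o\<^sub>L Y o\<^sub>L D) j)
      = (\<Sum>j<k. 2 * Re (cinner (Z1 (snd (w j))) (fst (w j))))
        + (\<Sum>j<k. 2 * Re (cinner (Z2 (snd (w j))) (fst (w j))))"
    unfolding eq by (simp add: cinner.add_left sum.distrib sum_distrib_left)
  also have "\<dots> \<le> (\<Sum>j<k. singular_values Z1 j) + (\<Sum>j<k. singular_values Z2 j)"
    by (intro add_mono Ky_Fan_bound w Z1 Z2)
  also have "\<dots> \<le> (\<Sum>j<n. singular_values Z1 j) + (\<Sum>j<n. singular_values Z2 j)"
    using \<open>k \<le> n\<close> singular_values_nonneg[OF Z1] singular_values_nonneg[OF Z2]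
    by (intro add_mono sum_mono2) auto
  finally show ?thesis .
qed

section \<open>Symmetric gauge functions and weak majorisation\<close>

lemma fin_seqs_combination:
  "x \<in> fin_seqs \<Longrightarrow> y \<in> fin_seqs \<Longrightarrow> (\<lambda>n. a * x n + b * y n) \<in> fin_seqs"
  unfolding fin_seqs_def mem_Collect_eq
  by (rule finite_subset[of _ "{n. x n \<noteq> 0} \<union> {n. y n \<noteq> 0}"]) auto

lemma fin_seqs_bij:
  assumes "x \<in> fin_seqs" "bij \<pi>"
  shows "(\<lambda>n. x (\<pi> n)) \<in> fin_seqs"
  using finite_vimageI[OF _ bij_is_inj[OF assms(2)], of "{n. x n \<noteq> 0}"] assms(1)
  by (simp add: fin_seqs_def vimage_def)

lemma fin_seqs_finite_support: "finite S \<Longrightarrow> (\<And>n. n \<notin> S \<Longrightarrow> x n = 0) \<Longrightarrow> x \<in> fin_seqs"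
  unfolding fin_seqs_def mem_Collect_eq by (rule finite_subset[of _ S]) auto

context
  fixes g :: "(nat \<Rightarrow> real) \<Rightarrow> real"
  assumes g: "symmetric_gauge g"
begin

lemma gauge_nonneg: "x \<in> fin_seqs \<Longrightarrow> 0 \<le> g x"
  using g by (simp add: symmetric_gauge_def)

lemma gauge_zero: "g (\<lambda>n. 0) = 0"
proof -
  have "(\<lambda>n. 0) \<in> fin_seqs"
    by (simp add: fin_seqs_def)
  then show ?thesis
    using g unfolding symmetric_gauge_def by blast
qed

lemma gauge_scale: "x \<in> fin_seqs \<Longrightarrow> g (\<lambda>n. a * x n) = \<bar>a\<bar> * g x"
  using g by (simp add: symmetric_gauge_def)

lemma gauge_triangle: "x \<in> fin_seqs \<Longrightarrow> y \<in> fin_seqs \<Longrightarrow> g (\<lambda>n. x n + y n) \<le> g x + g y"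
  using g by (simp add: symmetric_gauge_def)

lemma gauge_permute: "x \<in> fin_seqs \<Longrightarrow> bij \<pi> \<Longrightarrow> g (\<lambda>n. x (\<pi> n)) = g x"
  using g by (simp add: symmetric_gauge_def)

lemma gauge_sign: "x \<in> fin_seqs \<Longrightarrow> (\<And>n. \<epsilon> n \<in> {-1, 1}) \<Longrightarrow> g (\<lambda>n. \<epsilon> n * x n) = g x"
  using g unfolding symmetric_gauge_def by blast

lemma gauge_combination_le:
  assumes x: "x \<in> fin_seqs" and y: "y \<in> fin_seqs" and "a \<ge> 0" "b \<ge> 0"
  shows "g (\<lambda>n. a * x n + b * y n) \<le> a * g x + b * g y"
proof -
  have "(\<lambda>n. a * x n) \<in> fin_seqs" "(\<lambda>n. b * y n) \<in> fin_seqs"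
    using fin_seqs_combination[OF x x, of a 0] fin_seqs_combination[OF y y, of b 0] by simp_all
  from gauge_triangle[OF this] show ?thesis
    using assms by (simp add: gauge_scale)
qed

text \<open>
  Lowering one entry towards \<open>0\<close> is a convex combination of the sequence with its reflection in that
  coordinate.
\<close>

lemma gauge_mono:
  assumes "x \<in> fin_seqs" and "y \<in> fin_seqs" and "\<And>n. 0 \<le> x n" and "\<And>n. x n \<le> y n"
  shows "g x \<le> g y"
  using assms
proof (induction "card {n. x n \<noteq> y n}" arbitrary: y rule: less_induct)
  case less
  have fin: "finite {n. x n \<noteq> y n}"
    by (rule finite_subset[of _ "{n. x n \<noteq> 0} \<union> {n. y n \<noteq> 0}"])
      (use less.prems in \<open>auto simp: fin_seqs_def\<close>)
  show ?case
  proof (cases "x = y")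
    case False
    then obtain i where i: "x i \<noteq> y i" by auto
    define y' where "y' = y(i := x i)"
    \<comment> \<open>\<open>x i = c y i\<close> lies between \<open>y i\<close> and \<open>- y i\<close>\<close>
    define c where "c = x i / y i"
    have yi: "0 \<le> x i" "x i < y i"
      using less.prems(3)[of i] less.prems(4)[of i] i by auto
    then have c: "0 \<le> c" "c \<le> 1"
      by (auto simp: c_def)
    define z where "z = (\<lambda>n. (if n = i then -1 else 1) * y n)"
    have z: "z \<in> fin_seqs"
      using less.prems(2) unfolding fin_seqs_def mem_Collect_eq
      by (rule finite_subset[rotated]) (auto simp: z_def)
    have "g z = g y"
      unfolding z_def by (rule gauge_sign[OF less.prems(2)]) auto
    have y'_eq: "y' = (\<lambda>n. (1 + c) / 2 * y n + (1 - c) / 2 * z n)"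
    proof
      fix n
      show "y' n = (1 + c) / 2 * y n + (1 - c) / 2 * z n"
        using yi by (cases "n = i") (auto simp: y'_def z_def c_def field_simps)
    qed
    have y': "y' \<in> fin_seqs"
      unfolding y'_eq by (intro fin_seqs_combination less.prems z)
    have "g y' \<le> (1 + c) / 2 * g y + (1 - c) / 2 * g z"
      unfolding y'_eq using c by (intro gauge_combination_le less.prems z) auto
    also have "\<dots> = g y"
      unfolding \<open>g z = g y\<close> by (simp add: field_simps)
    finally have le: "g y' \<le> g y" .
    have "{n. x n \<noteq> y' n} \<subset> {n. x n \<noteq> y n}"
      using i by (auto simp: y'_def)
    then have "card {n. x n \<noteq> y' n} < card {n. x n \<noteq> y n}"
      by (rule psubset_card_mono[OF fin])
    then have "g x \<le> g y'"
      using less.prems by (intro less.hyps y') (auto simp: y'_def)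
    with le show ?thesis by simp
  qed simp
qed

text \<open>
  Weak majorisation. If some entry \<open>x j\<close> exceeds \<open>y j\<close>, the first such entry is preceded by some
  \<open>i\<close> with \<open>x i < y i\<close>. Moving the right amount of mass from \<open>y i\<close> to \<open>y j\<close> is a convex
  combination of \<open>y\<close> with the transposed sequence, keeps the partial sums large enough, and makes
  \<open>y\<close> agree with \<open>x\<close> in one more place. Otherwise monotonicity applies.
\<close>

lemma gauge_weak_majorization:
  assumes "x \<in> fin_seqs" "y \<in> fin_seqs" "antimono x" "\<And>n. 0 \<le> x n" "\<And>n. 0 \<le> y n"
    and "\<And>k. (\<Sum>i<k. x i) \<le> (\<Sum>i<k. y i)"
  shows "g x \<le> g y"
  using assms
proof (induction "card {n. x n \<noteq> y n}" arbitrary: y rule: less_induct)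
  case less
  note y = less.prems(2)
  have fin: "finite {n. x n \<noteq> y n}"
    by (rule finite_subset[of _ "{n. x n \<noteq> 0} \<union> {n. y n \<noteq> 0}"])
      (use less.prems in \<open>auto simp: fin_seqs_def\<close>)
  show ?case
  proof (cases "\<forall>n. x n \<le> y n")
    case True
    then show ?thesis
      using less.prems by (intro gauge_mono) auto
  next
    case False
    then have ex: "\<exists>j. y j < x j"
      by (auto simp: not_le)
    define j where "j = (LEAST j. y j < x j)"
    have j: "y j < x j"
      using LeastI_ex[OF ex] by (simp add: j_def)
    have before: "x l \<le> y l" if "l < j" for l
      using not_less_Least[of l "\<lambda>j. y j < x j"] that by (auto simp: j_def)
    have "\<exists>i<j. x i < y i"
    proof (rule ccontr)
      assume "\<not> (\<exists>i<j. x i < y i)"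
      then have "(\<Sum>l<j. y l) \<le> (\<Sum>l<j. x l)"
        by (intro sum_mono) (meson lessThan_iff not_less)
      with j have "(\<Sum>l<Suc j. y l) < (\<Sum>l<Suc j. x l)" by simp
      with less.prems(6)[of "Suc j"] show False by simp
    qed
    then obtain i where i: "i < j" "x i < y i" by blast
    have "x j \<le> x i"
      using antimonoD[OF less.prems(3)] i by simp
    define \<delta> where "\<delta> = min (y i - x i) (x j - y j)"
    have \<delta>: "\<delta> > 0" "\<delta> \<le> y i - x i" "\<delta> \<le> x j - y j"
      using i j by (auto simp: \<delta>_def)
    define y' where "y' = (\<lambda>l. y l + (if l = i then - \<delta> else 0) + (if l = j then \<delta> else 0))"
    define \<pi> where "\<pi> = (\<lambda>n. if n = i then j else if n = j then i else n)"
    have \<pi>: "bij \<pi>"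
      by (rule involuntory_imp_bij) (auto simp: \<pi>_def)
    \<comment> \<open>the share of the transposed sequence that moves exactly \<open>\<delta>\<close>\<close>
    define t where "t = \<delta> / (y i - y j)"
    have gap: "\<delta> \<le> y i - y j" "y i - y j > 0"
      using \<delta> \<open>x j \<le> x i\<close> by auto
    then have t: "0 \<le> t" "t \<le> 1"
      using \<delta> by (auto simp: t_def)
    have ty: "t * (y i - y j) = \<delta>"
      using gap by (simp add: t_def)
    have y'_eq: "y' = (\<lambda>l. (1 - t) * y l + t * y (\<pi> l))"
    proof
      fix l
      consider "l = i" | "l = j" | "l \<noteq> i" "l \<noteq> j" by blast
      then show "y' l = (1 - t) * y l + t * y (\<pi> l)"
        unfolding y'_def \<pi>_def using i(1) by cases (simp_all add: algebra_simps flip: ty)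
    qed
    have y': "y' \<in> fin_seqs"
      unfolding y'_eq by (intro fin_seqs_combination y fin_seqs_bij[OF y \<pi>])
    have "g y' \<le> (1 - t) * g y + t * g (\<lambda>l. y (\<pi> l))"
      unfolding y'_eq using t by (intro gauge_combination_le y fin_seqs_bij[OF y \<pi>]) auto
    also have "\<dots> = g y"
      by (simp add: gauge_permute[OF y \<pi>] algebra_simps)
    finally have le: "g y' \<le> g y" .
    have "{n. x n \<noteq> y' n} \<subseteq> {n. x n \<noteq> y n}"
      using i j by (auto simp: y'_def split: if_splits)
    moreover have "x i = y' i \<or> x j = y' j"
      using i by (auto simp: y'_def \<delta>_def min_def)
    ultimately have "{n. x n \<noteq> y' n} \<subset> {n. x n \<noteq> y n}"
      using i j by auto
    then have card: "card {n. x n \<noteq> y' n} < card {n. x n \<noteq> y n}"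
      by (rule psubset_card_mono[OF fin])
    have "0 \<le> y' n" for n
      using less.prems(4)[of i] less.prems(5)[of n] \<delta> i by (auto simp: y'_def)
    moreover have "(\<Sum>l<k. x l) \<le> (\<Sum>l<k. y' l)" for k
    proof -
      have sum_y': "(\<Sum>l<k. y' l) = (\<Sum>l<k. y l) + (if i < k then - \<delta> else 0) + (if j < k then \<delta> else 0)"
        unfolding y'_def by (simp add: sum.distrib)
      show ?thesis
      proof (cases "i < k \<and> k \<le> j")
        case True
        have "y i - x i \<le> (\<Sum>l<k. y l - x l)"
          using True before by (intro member_le_sum) auto
        then show ?thesis
          using True \<delta> by (simp add: sum_y' sum_subtractf)
      next
        case False
        then show ?thesis
          using less.prems(6)[of k] i by (auto simp: sum_y')
      qed
    qed
    ultimately have "g x \<le> g y'"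
      using less.prems by (intro less.hyps[OF card] y') auto
    with le show ?thesis by simp
  qed
qed

text \<open>
  The triangle inequality over the coordinates: a gauge function is Lipschitz on sequences supported
  in a fixed finite set.
\<close>

lemma gauge_le_sum:
  assumes "\<And>k. k \<ge> n \<Longrightarrow> x k = 0"
  shows "g x \<le> (\<Sum>k<n. \<bar>x k\<bar> * g (\<lambda>l. if l = k then 1 else 0))"
  using assms
proof (induction n arbitrary: x)
  case 0
  then have "x = (\<lambda>n. 0)" by auto
  then show ?case by (simp add: gauge_zero)
next
  case (Suc n)
  define u :: "nat \<Rightarrow> real" where "u = (\<lambda>l. if l = n then 1 else 0)"
  define z where "z = x(n := 0)"
  have u: "u \<in> fin_seqs"
    by (rule fin_seqs_finite_support[of "{n}"]) (auto simp: u_def)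
  have z0: "z k = 0" if "k \<ge> n" for k
    using Suc.prems[of k] that by (cases "k = n") (auto simp: z_def)
  then have z: "z \<in> fin_seqs"
    by (intro fin_seqs_finite_support[of "{..<n}"]) auto
  have xu: "(\<lambda>l. x n * u l) \<in> fin_seqs"
    using fin_seqs_combination[OF u u, of "x n" 0] by simp
  have "x = (\<lambda>l. z l + x n * u l)"
    by (auto simp: z_def u_def)
  then have "g x \<le> g z + \<bar>x n\<bar> * g u"
    using gauge_triangle[OF z xu] by (simp add: gauge_scale[OF u])
  moreover have "g z \<le> (\<Sum>k<n. \<bar>z k\<bar> * g (\<lambda>l. if l = k then 1 else 0))"
    by (rule Suc.IH[OF z0])
  moreover have "\<dots> = (\<Sum>k<n. \<bar>x k\<bar> * g (\<lambda>l. if l = k then 1 else 0))"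
    by (intro sum.cong) (auto simp: z_def)
  ultimately show ?case
    by (simp add: u_def)
qed

end

definition truncate_seq :: "nat \<Rightarrow> (nat \<Rightarrow> real) \<Rightarrow> nat \<Rightarrow> real" where
  "truncate_seq n s = (\<lambda>k. if k < n then s k else 0)"

lemma truncate_seq_fin_seqs: "truncate_seq n s \<in> fin_seqs"
  by (rule fin_seqs_finite_support[of "{..<n}"]) (auto simp: truncate_seq_def)

lemma gauge_truncate_abs_diff_le:
  assumes g: "symmetric_gauge g"
  shows "\<bar>g (truncate_seq n s) - g (truncate_seq n t)\<bar>
    \<le> (\<Sum>k<n. \<bar>s k - t k\<bar> * g (\<lambda>l. if l = k then 1 else 0))"
proof -
  have *: "g (truncate_seq n s) - g (truncate_seq n t)
      \<le> (\<Sum>k<n. \<bar>s k - t k\<bar> * g (\<lambda>l. if l = k then 1 else 0))" for s t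
  proof -
    define d where "d = truncate_seq n (\<lambda>k. s k - t k)"
    have "truncate_seq n s = (\<lambda>k. truncate_seq n t k + d k)"
      by (auto simp: truncate_seq_def d_def)
    then have "g (truncate_seq n s) \<le> g (truncate_seq n t) + g d"
      using gauge_triangle[OF g truncate_seq_fin_seqs truncate_seq_fin_seqs] by (metis d_def)
    moreover have "g d \<le> (\<Sum>k<n. \<bar>d k\<bar> * g (\<lambda>l. if l = k then 1 else 0))"
      by (rule gauge_le_sum[OF g]) (simp add: d_def truncate_seq_def)
    moreover have "\<dots> = (\<Sum>k<n. \<bar>s k - t k\<bar> * g (\<lambda>l. if l = k then 1 else 0))"
      by (intro sum.cong) (auto simp: d_def truncate_seq_def)
    ultimately show ?thesis by simp
  qed
  show ?thesis
    using *[of s t] *[of t s] by (simp add: abs_minus_commute abs_le_iff)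
qed

lemma antimono_truncate_seq:
  assumes "antimono s" "\<And>n. 0 \<le> s n"
  shows "antimono (truncate_seq n s)"
  using assms by (auto intro!: antimonoI simp: truncate_seq_def dest: antimonoD)

lemma sum_truncate_seq: "(\<Sum>i<k. truncate_seq n s i) = (\<Sum>i<min k n. s i)"
  unfolding truncate_seq_def by (intro sum.mono_neutral_cong_right) auto

section \<open>Midpoint convex functions\<close>

text \<open>
  At an interior maximum of \<open>f\<close> minus the chord, the symmetric interval reaching to the nearer end
  point bounds the maximum by half of itself.
\<close>

lemma midpoint_convex_le_chord:
  fixes f :: "real \<Rightarrow> real"
  assumes "a < b" and cont: "continuous_on {a..b} f"
    and mid: "\<And>m d. d \<ge> 0 \<Longrightarrow> a \<le> m - d \<Longrightarrow> m + d \<le> b \<Longrightarrow> 2 * f m \<le> f (m - d) + f (m + d)"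
    and x: "x \<in> {a..b}"
  shows "f x \<le> f a + (f b - f a) / (b - a) * (x - a)"
proof -
  define k where "k = (f b - f a) / (b - a)"
  define h where "h = (\<lambda>x. f x - (f a + k * (x - a)))"
  have "continuous_on {a..b} h"
    unfolding h_def by (intro continuous_intros cont)
  then obtain c where c: "c \<in> {a..b}" and max: "\<And>y. y \<in> {a..b} \<Longrightarrow> h y \<le> h c"
    using continuous_attains_sup[OF compact_Icc _ \<open>continuous_on {a..b} h\<close>] \<open>a < b\<close> by auto
  have ends: "h a = 0" "h b = 0"
    using \<open>a < b\<close> by (auto simp: h_def k_def)
  have hmid: "2 * h m \<le> h (m - d) + h (m + d)" if "d \<ge> 0" "a \<le> m - d" "m + d \<le> b" for m d
    using mid[OF that] by (simp add: h_def algebra_simps)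
  have "h c \<le> 0"
  proof (cases "c - a \<le> b - c")
    case True
    then show ?thesis
      using hmid[of "c - a" c] c max[of "c + (c - a)"] ends by simp
  next
    case False
    then show ?thesis
      using hmid[of "b - c" c] c max[of "c - (b - c)"] ends by simp
  qed
  with max[OF x] show ?thesis
    by (simp add: h_def k_def)
qed

text \<open>
  Integrating the chord gives the trapezoidal rule.
\<close>

lemma midpoint_convex_nn_integral_le:
  fixes f :: "real \<Rightarrow> real"
  assumes "a < b" and cont: "continuous_on {a..b} f"
    and mid: "\<And>m d. d \<ge> 0 \<Longrightarrow> a \<le> m - d \<Longrightarrow> m + d \<le> b \<Longrightarrow> 2 * f m \<le> f (m - d) + f (m + d)"
    and nonneg: "\<And>x. x \<in> {a..b} \<Longrightarrow> 0 \<le> f x"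
  shows "(\<integral>\<^sup>+x\<in>{a..b}. ennreal (f x) \<partial>lborel) \<le> ennreal ((b - a) / 2 * (f a + f b))"
proof -
  define k where "k = (f b - f a) / (b - a)"
  define F where "F = (\<lambda>x. f a * x + k * (x - a)\<^sup>2 / 2)"
  have chord: "f x \<le> f a + k * (x - a)" if "x \<in> {a..b}" for x
    using midpoint_convex_le_chord[OF assms(1) cont mid that] by (simp add: k_def)
  have "(\<integral>\<^sup>+x\<in>{a..b}. ennreal (f x) \<partial>lborel)
      \<le> (\<integral>\<^sup>+x. ennreal (f a + k * (x - a)) * indicator {a..b} x \<partial>lborel)"
    using chord by (intro nn_integral_mono) (auto split: split_indicator intro: ennreal_leI)
  also have "\<dots> = ennreal (F b - F a)"
  proof (rule nn_integral_FTC_Icc)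
    show "(\<lambda>x. f a + k * (x - a)) \<in> borel_measurable borel"
      by measurable
    show "(F has_real_derivative f a + k * (x - a)) (at x)" if "x \<in> {a..b}" for x
      unfolding F_def by (auto intro!: derivative_eq_intros)
    show "0 \<le> f a + k * (x - a)" if "x \<in> {a..b}" for x
      using chord[OF that] nonneg[OF that] by linarith
  qed (use \<open>a < b\<close> in auto)
  also have "F b - F a = (b - a) / 2 * (f a + f b)"
  proof -
    have "k * (b - a)\<^sup>2 = (f b - f a) * (b - a)"
      using \<open>a < b\<close> by (simp add: k_def power2_eq_square)
    then show ?thesis
      by (simp add: F_def algebra_simps add_divide_distrib diff_divide_distrib)
  qed
  finally show ?thesis .
qed

section \<open>Norms of differences of Heinz type\<close>

lemma op_powr_op_powr:
  "T \<in> positive_ops \<Longrightarrow> a > 0 \<Longrightarrow> b > 0 \<Longrightarrow> c = a + b \<Longrightarrow> op_powr T a (op_powr T b x) = op_powr T c x"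
  by (simp add: op_powr_add)

lemma singular_values_uminus:
  assumes T: "T \<in> bounded_ops"
  shows "singular_values (- T) = singular_values T"
proof -
  have mT: "- T \<in> bounded_ops"
    using bounded_ops_scaleR[OF T, of "-1"] by simp
  have "op_adjoint (- T) x = - op_adjoint T x" for x
  proof (rule cinner_eqI_right)
    fix y
    show "cinner y (op_adjoint (- T) x) = cinner y (- op_adjoint T x)"
      by (simp add: blinfun.minus_left cinner.minus_left cinner.minus_right
          flip: cinner_op_adjoint[OF mT] cinner_op_adjoint[OF T])
  qed
  then have "op_adjoint (- T) o\<^sub>L (- T) = op_adjoint T o\<^sub>L T"
    by (intro blinfun_eqI) (simp add: blinfun.minus_left blinfun.minus_right)
  then show ?thesis
    by (simp add: singular_values_def op_abs_def)
qed

lemma singular_values_0: "singular_values 0 n = 0"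
proof -
  have 0: "0 \<in> bounded_ops" "compact_map (0 :: 'a \<Rightarrow>\<^sub>L 'a)"
    by (auto simp: bounded_ops_def blinfun.zero_left scaleC.zero_right compact_map_def
        convergent_const intro: exI[of _ id] strict_mono_id)
  obtain e f :: "nat \<Rightarrow> 'a" where "suborthonormal UNIV e" "suborthonormal UNIV f"
    and "\<And>n. singular_values (0 :: 'a \<Rightarrow>\<^sub>L 'a) n > 0 \<Longrightarrow> norm (e n) = 1"
    and nf: "\<And>n. singular_values (0 :: 'a \<Rightarrow>\<^sub>L 'a) n > 0 \<Longrightarrow> norm (f n) = 1"
    and ef: "\<And>n. (0 :: 'a \<Rightarrow>\<^sub>L 'a) (e n) = singular_values (0 :: 'a \<Rightarrow>\<^sub>L 'a) n *\<^sub>R f n"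
    and "\<And>n. op_adjoint 0 (f n) = singular_values (0 :: 'a \<Rightarrow>\<^sub>L 'a) n *\<^sub>R e n"
    and "\<And>n x. norm ((0 :: 'a \<Rightarrow>\<^sub>L 'a) x -
        (\<Sum>i<n. singular_values (0 :: 'a \<Rightarrow>\<^sub>L 'a) i *\<^sub>R cinner x (e i) *\<^sub>C f i))
      \<le> singular_values (0 :: 'a \<Rightarrow>\<^sub>L 'a) n * norm x"
    by (rule singular_value_decomposition[OF 0]) (rule that)
  have "singular_values (0 :: 'a \<Rightarrow>\<^sub>L 'a) n = 0 \<or> f n = 0"
    using ef[of n] by (simp add: blinfun.zero_left)
  then show ?thesis
    using nf[of n] singular_values_nonneg[OF 0, of n] by fastforce
qed

definition heinz_diff ::
    "('a::complex_hilbert_space \<Rightarrow>\<^sub>L 'a) \<Rightarrow> ('a \<Rightarrow>\<^sub>L 'a) \<Rightarrow> ('a \<Rightarrow>\<^sub>L 'a) \<Rightarrow> real \<Rightarrow> 'a \<Rightarrow>\<^sub>L 'a" where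
  "heinz_diff A B X \<nu> = (op_powr A \<nu> o\<^sub>L X o\<^sub>L op_powr B (1 - \<nu>)) -
    (op_powr A (1 - \<nu>) o\<^sub>L X o\<^sub>L op_powr B \<nu>)"

lemma heinz_diff_flip: "heinz_diff A B X (1 - \<nu>) = - heinz_diff A B X \<nu>"
  by (simp add: heinz_diff_def)

context
  fixes A B X :: "'a::complex_hilbert_space \<Rightarrow>\<^sub>L 'a"
  assumes A: "A \<in> positive_ops" and B: "B \<in> positive_ops"
    and X: "X \<in> bounded_ops" "compact_map X"
begin

lemma sandwich_bounded_compact:
  assumes "a > 0" "b > 0"
  shows "op_powr A a o\<^sub>L X o\<^sub>L op_powr B b \<in> bounded_ops"
    and "compact_map (op_powr A a o\<^sub>L X o\<^sub>L op_powr B b)"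
proof -
  have "op_powr A a \<in> bounded_ops" "op_powr B b \<in> bounded_ops"
    using op_powr_self_adjoint[OF A assms(1)] op_powr_self_adjoint[OF B assms(2)]
    by (auto intro: self_adjoint_bounded_ops)
  then show "op_powr A a o\<^sub>L X o\<^sub>L op_powr B b \<in> bounded_ops"
    by (intro bounded_ops_compose X)
  show "compact_map (op_powr A a o\<^sub>L X o\<^sub>L op_powr B b)"
    by (intro compact_map_compose_right compact_map_compose_left X)
qed

lemma heinz_diff_bounded_compact:
  assumes "0 < \<nu>" "\<nu> < 1"
  shows "heinz_diff A B X \<nu> \<in> bounded_ops" and "compact_map (heinz_diff A B X \<nu>)"
  unfolding heinz_diff_def using assms
  by (auto intro!: bounded_ops_diff compact_map_diff sandwich_bounded_compact)

text \<open>
  With \<open>C = A\<^sup>d\<close>, \<open>D = B\<^sup>d\<close> and \<open>Y = A\<^bsup>m - d\<^esup> X B\<^bsup>1 - m - d\<^esup> - A\<^bsup>1 - m - d\<^esup> X B\<^bsup>m - d\<^esup>\<close>, the difference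
  at \<open>m\<close> is \<open>C Y D\<close>, and \<open>C\<^sup>2 Y + Y D\<^sup>2\<close> is the sum of the differences at \<open>m - d\<close> and \<open>m + d\<close>. The
  restriction to \<open>0 < m - d\<close> and \<open>m + d < 1\<close> keeps all exponents positive.
\<close>

lemma heinz_diff_midpoint:
  assumes "d \<ge> 0" "0 < m - d" "m + d < 1"
  shows "2 * (\<Sum>j<n. singular_values (heinz_diff A B X m) j)
    \<le> (\<Sum>j<n. singular_values (heinz_diff A B X (m - d)) j)
      + (\<Sum>j<n. singular_values (heinz_diff A B X (m + d)) j)"
proof (cases "d = 0")
  case False
  with assms have d: "d > 0" by simp
  define Y where "Y = (op_powr A (m - d) o\<^sub>L X o\<^sub>L op_powr B (1 - m - d)) -
    (op_powr A (1 - m - d) o\<^sub>L X o\<^sub>L op_powr B (m - d))"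
  have Y: "Y \<in> bounded_ops" "compact_map Y"
    unfolding Y_def using assms
    by (auto intro!: bounded_ops_diff compact_map_diff sandwich_bounded_compact)
  have pow: "op_powr P d (op_powr P (m - d) x) = op_powr P m x"
      "op_powr P d (op_powr P (1 - m - d) x) = op_powr P (1 - m) x"
      "op_powr P d (op_powr P m x) = op_powr P (m + d) x"
      "op_powr P d (op_powr P (1 - m) x) = op_powr P (1 - (m - d)) x"
      "op_powr P (1 - m - d) (op_powr P d x) = op_powr P (1 - m) x"
      "op_powr P (m - d) (op_powr P d x) = op_powr P m x"
      "op_powr P (1 - m) (op_powr P d x) = op_powr P (1 - (m - d)) x"
      "op_powr P m (op_powr P d x) = op_powr P (m + d) x"
    if "P \<in> positive_ops" for P :: "'a \<Rightarrow>\<^sub>L 'a" and x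
    using that assms d by (intro op_powr_op_powr; simp)+
  have exps: "1 - (m + d) = 1 - m - d"
    by simp
  have CYD: "op_powr A d o\<^sub>L Y o\<^sub>L op_powr B d = heinz_diff A B X m"
    by (rule blinfun_eqI)
      (simp add: Y_def heinz_diff_def blinfun.diff_left blinfun.diff_right pow[OF A] pow[OF B])
  have "(op_powr A d o\<^sub>L op_powr A d o\<^sub>L Y) + (Y o\<^sub>L op_powr B d o\<^sub>L op_powr B d)
      = heinz_diff A B X (m - d) + heinz_diff A B X (m + d)"
  proof (rule blinfun_eqI)
    fix x
    show "((op_powr A d o\<^sub>L op_powr A d o\<^sub>L Y) + (Y o\<^sub>L op_powr B d o\<^sub>L op_powr B d)) x
      = (heinz_diff A B X (m - d) + heinz_diff A B X (m + d)) x"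
      unfolding heinz_diff_def exps Y_def blinfun.add_left blinfun.diff_left
        blinfun_apply_blinfun_compose blinfun.diff_right pow[OF A] pow[OF B]
      by (simp only: algebra_simps)
  qed
  then have "2 * (\<Sum>j<n. singular_values (op_powr A d o\<^sub>L Y o\<^sub>L op_powr B d) j)
    \<le> (\<Sum>j<n. singular_values (heinz_diff A B X (m - d)) j)
      + (\<Sum>j<n. singular_values (heinz_diff A B X (m + d)) j)"
    using assms d
    by (intro Ky_Fan_arithmetic_geometric_mean op_powr_self_adjoint A B Y heinz_diff_bounded_compact) auto
  then show ?thesis
    by (simp add: CYD)
qed simp

lemma continuous_on_heinz_diff: "continuous_on {1/4..3/4} (heinz_diff A B X)"
proof -
  have pow: "continuous_on {1/4..3/4} (op_powr P)"
    "continuous_on {1/4..3/4} (\<lambda>\<nu>. op_powr P (1 - \<nu>))" if "P \<in> positive_ops" for P :: "'a \<Rightarrow>\<^sub>L 'a"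
  proof -
    show c: "continuous_on {1/4..3/4} (op_powr P)"
      using continuous_on_op_powr[OF that, of "1/4" "3/4"] by simp
    show "continuous_on {1/4..3/4} (\<lambda>\<nu>. op_powr P (1 - \<nu>))"
      by (rule continuous_on_compose2[OF c]) (auto intro!: continuous_intros)
  qed
  show ?thesis
    unfolding heinz_diff_def[abs_def]
    by (intro continuous_on_diff bounded_bilinear.continuous_on[OF bounded_bilinear_blinfun_compose]
        continuous_on_const pow A B)
qed

lemma continuous_on_Ky_Fan_sum:
  "continuous_on {1/4..3/4} (\<lambda>\<nu>. \<Sum>j<k. singular_values (heinz_diff A B X \<nu>) j)"
  unfolding continuous_on_def
proof (intro ballI)
  fix \<mu> :: real assume \<mu>: "\<mu> \<in> {1/4..3/4}"
  define F where "F = (\<lambda>\<nu>. \<Sum>j<k. singular_values (heinz_diff A B X \<nu>) j)"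
  have bound: "norm (F \<nu> - F \<mu>) \<le> real k * norm (heinz_diff A B X \<nu> - heinz_diff A B X \<mu>)"
    if "\<nu> \<in> {1/4..3/4}" for \<nu>
  proof -
    have "0 < \<nu>" "\<nu> < 1" "0 < \<mu>" "\<mu> < 1"
      using that \<mu> by auto
    note T = heinz_diff_bounded_compact[OF this(1,2)] heinz_diff_bounded_compact[OF this(3,4)]
    show ?thesis
      using Ky_Fan_sum_le_perturbed[OF T(3,4,1,2), of k] Ky_Fan_sum_le_perturbed[OF T, of k]
      by (simp add: F_def norm_minus_commute abs_le_iff)
  qed
  have "((\<lambda>\<nu>. real k * norm (heinz_diff A B X \<nu> - heinz_diff A B X \<mu>)) \<longlongrightarrow>
      real k * norm (heinz_diff A B X \<mu> - heinz_diff A B X \<mu>)) (at \<mu> within {1/4..3/4})"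
    using continuous_on_heinz_diff \<mu> unfolding continuous_on_def
    by (intro tendsto_intros) auto
  then have "((\<lambda>\<nu>. real k * norm (heinz_diff A B X \<nu> - heinz_diff A B X \<mu>)) \<longlongrightarrow> 0) (at \<mu> within {1/4..3/4})"
    by simp
  moreover have "\<forall>\<^sub>F \<nu> in at \<mu> within {1/4..3/4}.
      norm (F \<nu> - F \<mu>) \<le> real k * norm (heinz_diff A B X \<nu> - heinz_diff A B X \<mu>)"
    using bound by (auto simp: eventually_at_filter)
  ultimately have "((\<lambda>\<nu>. F \<nu> - F \<mu>) \<longlongrightarrow> 0) (at \<mu> within {1/4..3/4})"
    by (rule Lim_null_comparison[rotated])
  then have "(F \<longlongrightarrow> F \<mu>) (at \<mu> within {1/4..3/4})"
    by (simp only: LIM_zero_iff)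
  then show "((\<lambda>\<nu>. \<Sum>j<k. singular_values (heinz_diff A B X \<nu>) j) \<longlongrightarrow>
      (\<Sum>j<k. singular_values (heinz_diff A B X \<mu>) j)) (at \<mu> within {1/4..3/4})"
    unfolding F_def .
qed

text \<open>
  A singular value is the difference of two consecutive Ky Fan sums.
\<close>

lemma continuous_on_singular_value:
  "continuous_on {1/4..3/4} (\<lambda>\<nu>. singular_values (heinz_diff A B X \<nu>) k)"
proof -
  have "continuous_on {1/4..3/4} (\<lambda>\<nu>. (\<Sum>j<Suc k. singular_values (heinz_diff A B X \<nu>) j) -
      (\<Sum>j<k. singular_values (heinz_diff A B X \<nu>) j))"
    by (intro continuous_on_diff continuous_on_Ky_Fan_sum)
  then show ?thesis by simp
qed

context
  fixes g :: "(nat \<Rightarrow> real) \<Rightarrow> real"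
  assumes g: "symmetric_gauge g"
begin

text \<open>
  The norm of the difference may be infinite a priori. Its truncations are real, and they inherit
  midpoint convexity, as weak majorisation only involves partial sums, and continuity in the exponent.
  The norm is their supremum.
\<close>

definition truncated_norm :: "nat \<Rightarrow> real \<Rightarrow> real" where
  "truncated_norm n \<nu> = g (truncate_seq n (singular_values (heinz_diff A B X \<nu>)))"

lemma truncated_norm_nonneg: "0 \<le> truncated_norm n \<nu>"
  unfolding truncated_norm_def by (intro gauge_nonneg[OF g] truncate_seq_fin_seqs)

lemma truncated_norm_flip: "\<nu> \<in> {1/4..3/4} \<Longrightarrow> truncated_norm n (1 - \<nu>) = truncated_norm n \<nu>"
  unfolding truncated_norm_def heinz_diff_flip
  by (simp add: singular_values_uminus heinz_diff_bounded_compact)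

lemma truncated_norm_half: "truncated_norm n (1/2) = 0"
proof -
  have "heinz_diff A B X (1/2) = 0"
    by (simp add: heinz_diff_def)
  then show ?thesis
    by (simp add: truncated_norm_def truncate_seq_def singular_values_0[abs_def] gauge_zero[OF g])
qed

lemma incseq_truncated_norm:
  assumes "\<nu> \<in> {1/4..3/4}"
  shows "incseq (\<lambda>n. truncated_norm n \<nu>)"
proof (rule incseq_SucI)
  fix n
  show "truncated_norm n \<nu> \<le> truncated_norm (Suc n) \<nu>"
    unfolding truncated_norm_def
    using assms singular_values_nonneg[OF heinz_diff_bounded_compact]
    by (intro gauge_mono[OF g] truncate_seq_fin_seqs) (auto simp: truncate_seq_def)
qed

lemma truncated_norm_midpoint:
  assumes "d \<ge> 0" "0 < m - d" "m + d < 1"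
  shows "2 * truncated_norm n m \<le> truncated_norm n (m - d) + truncated_norm n (m + d)"
proof -
  define s where "s = (\<lambda>\<nu>. singular_values (heinz_diff A B X \<nu>))"
  have s: "antimono (s \<nu>)" "\<And>k. 0 \<le> s \<nu> k" if "0 < \<nu>" "\<nu> < 1" for \<nu>
    unfolding s_def
    using singular_values_antimono[OF heinz_diff_bounded_compact[OF that]]
      singular_values_nonneg[OF heinz_diff_bounded_compact[OF that]] by auto
  note sm = s[of m] s[of "m - d"] s[of "m + d"]
  define y where "y = (\<lambda>k. 1/2 * truncate_seq n (s (m - d)) k + 1/2 * truncate_seq n (s (m + d)) k)"
  have "g (truncate_seq n (s m)) \<le> g y"
  proof (rule gauge_weak_majorization[OF g])
    show "y \<in> fin_seqs"
      unfolding y_def by (intro fin_seqs_combination truncate_seq_fin_seqs)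
    show "antimono (truncate_seq n (s m))"
      using sm assms by (intro antimono_truncate_seq) auto
    show "0 \<le> truncate_seq n (s m) k" "0 \<le> y k" for k
      using sm assms by (auto simp: y_def truncate_seq_def)
    show "(\<Sum>i<k. truncate_seq n (s m) i) \<le> (\<Sum>i<k. y i)" for k
      using heinz_diff_midpoint[OF assms, of "min k n"]
      by (simp add: y_def sum.distrib sum_truncate_seq s_def flip: sum_divide_distrib)
  qed (rule truncate_seq_fin_seqs)
  also have "g y \<le> 1/2 * g (truncate_seq n (s (m - d))) + 1/2 * g (truncate_seq n (s (m + d)))"
    unfolding y_def by (intro gauge_combination_le[OF g] truncate_seq_fin_seqs) auto
  finally show ?thesis
    by (simp add: truncated_norm_def s_def)
qed

lemma continuous_on_truncated_norm: "continuous_on {1/4..3/4} (truncated_norm n)"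
  unfolding continuous_on_def
proof (intro ballI)
  fix \<mu> :: real assume \<mu>: "\<mu> \<in> {1/4..3/4}"
  define s where "s = (\<lambda>\<nu>. singular_values (heinz_diff A B X \<nu>))"
  define c where "c = (\<lambda>k. g (\<lambda>l. if l = k then 1 else 0))"
  have bound: "norm (truncated_norm n \<nu> - truncated_norm n \<mu>) \<le> (\<Sum>k<n. \<bar>s \<nu> k - s \<mu> k\<bar> * c k)" for \<nu>
    using gauge_truncate_abs_diff_le[OF g, of n "s \<nu>" "s \<mu>"]
    by (simp add: truncated_norm_def s_def c_def)
  have "((\<lambda>\<nu>. s \<nu> k) \<longlongrightarrow> s \<mu> k) (at \<mu> within {1/4..3/4})" for k
    using continuous_on_singular_value[of k] \<mu> by (auto simp: continuous_on_def s_def)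
  then have "((\<lambda>\<nu>. \<Sum>k<n. \<bar>s \<nu> k - s \<mu> k\<bar> * c k) \<longlongrightarrow> (\<Sum>k<n. \<bar>s \<mu> k - s \<mu> k\<bar> * c k))
      (at \<mu> within {1/4..3/4})"
    by (intro tendsto_intros)
  then have "((\<lambda>\<nu>. \<Sum>k<n. \<bar>s \<nu> k - s \<mu> k\<bar> * c k) \<longlongrightarrow> 0) (at \<mu> within {1/4..3/4})"
    by simp
  then have "((\<lambda>\<nu>. truncated_norm n \<nu> - truncated_norm n \<mu>) \<longlongrightarrow> 0) (at \<mu> within {1/4..3/4})"
    by (rule Lim_null_comparison[rotated]) (intro always_eventually allI bound)
  then show "(truncated_norm n \<longlongrightarrow> truncated_norm n \<mu>) (at \<mu> within {1/4..3/4})"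
    by (simp add: LIM_zero_iff)
qed

lemma truncated_norm_indicator_measurable:
  assumes "1/4 \<le> a" "b \<le> 3/4"
  shows "(\<lambda>\<nu>. ennreal (truncated_norm n \<nu>) * indicator {a..b} \<nu>) \<in> borel_measurable lborel"
proof -
  have "(\<lambda>\<nu>. indicator {a..b} \<nu> *\<^sub>R truncated_norm n \<nu>) \<in> borel_measurable borel"
    using assms
    by (intro borel_measurable_continuous_on_indicator
        continuous_on_subset[OF continuous_on_truncated_norm]) auto
  then have "(\<lambda>\<nu>. ennreal (indicator {a..b} \<nu> *\<^sub>R truncated_norm n \<nu>)) \<in> borel_measurable lborel"
    by simp
  moreover have "(\<lambda>\<nu>. ennreal (indicator {a..b} \<nu> *\<^sub>R truncated_norm n \<nu>))
      = (\<lambda>\<nu>. ennreal (truncated_norm n \<nu>) * indicator {a..b} \<nu>)"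
    by (auto split: split_indicator)
  ultimately show ?thesis by simp
qed

lemma truncated_norm_integral_le:
  assumes "1/4 \<le> a" "a < b" "b \<le> 3/4"
  shows "(\<integral>\<^sup>+\<nu>\<in>{a..b}. ennreal (truncated_norm n \<nu>) \<partial>lborel)
    \<le> ennreal ((b - a) / 2 * (truncated_norm n a + truncated_norm n b))"
  using assms
  by (intro midpoint_convex_nn_integral_le truncated_norm_midpoint truncated_norm_nonneg
      continuous_on_subset[OF continuous_on_truncated_norm]) auto

text \<open>
  The trapezoidal rule on the four intervals cut out by \<open>3/8\<close>, \<open>1/2\<close> and \<open>5/8\<close>. The value at \<open>1/2\<close>
  vanishes and the values at \<open>5/8\<close> and \<open>3/4\<close> equal those at \<open>3/8\<close> and \<open>1/4\<close>.
\<close>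

lemma truncated_norm_integral:
  "(\<integral>\<^sup>+\<nu>\<in>{1/4..3/4}. ennreal (truncated_norm n \<nu>) \<partial>lborel)
    \<le> ennreal (1/8 * truncated_norm n (1/4) + 1/4 * truncated_norm n (3/8))"
proof -
  define K where "K = truncated_norm n"
  define I where "I = (\<lambda>a b. \<integral>\<^sup>+\<nu>\<in>{a..b}. ennreal (K \<nu>) \<partial>lborel)"
  have split: "I a c \<le> I a b + I b c" if "1/4 \<le> a" "a \<le> b" "b \<le> c" "c \<le> 3/4" for a b c
  proof -
    have "I a c \<le> (\<integral>\<^sup>+\<nu>. ennreal (K \<nu>) * indicator {a..b} \<nu> + ennreal (K \<nu>) * indicator {b..c} \<nu> \<partial>lborel)"
      unfolding I_def by (intro nn_integral_mono) (auto split: split_indicator)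
    also have "\<dots> = I a b + I b c"
      unfolding I_def K_def using that by (intro nn_integral_add truncated_norm_indicator_measurable) auto
    finally show ?thesis .
  qed
  have nonneg: "0 \<le> K \<nu>" for \<nu>
    by (simp add: K_def truncated_norm_nonneg)
  have flip: "K (3/4) = K (1/4)" "K (5/8) = K (3/8)" and half: "K (1/2) = 0"
    using truncated_norm_flip[of "1/4" n] truncated_norm_flip[of "3/8" n] truncated_norm_half[of n]
    by (simp_all add: K_def)
  have "I (1/4) (3/4) \<le> I (1/4) (3/8) + (I (3/8) (1/2) + (I (1/2) (5/8) + I (5/8) (3/4)))"
    by (intro order_trans[OF split[of "1/4" "3/8" "3/4"]] add_left_mono
        order_trans[OF split[of "3/8" "1/2" "3/4"]] split) auto
  also have "\<dots> \<le> ennreal ((3/8 - 1/4) / 2 * (K (1/4) + K (3/8)))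
      + (ennreal ((1/2 - 3/8) / 2 * (K (3/8) + K (1/2)))
      + (ennreal ((5/8 - 1/2) / 2 * (K (1/2) + K (5/8)))
      + ennreal ((3/4 - 5/8) / 2 * (K (5/8) + K (3/4)))))"
    unfolding I_def K_def by (intro add_mono truncated_norm_integral_le) auto
  also have "\<dots> = ennreal (1/8 * K (1/4) + 1/4 * K (3/8))"
    using nonneg[of "1/4"] nonneg[of "3/8"]
    by (simp add: flip half field_simps flip: ennreal_plus)
  finally show ?thesis
    by (simp add: I_def K_def)
qed

lemma heinz_diff_norm_eq_SUP: "heinz_diff_norm g A B X \<nu> = (SUP n. ennreal (truncated_norm n \<nu>))"
  by (simp add: heinz_diff_norm_def ui_norm_def gauge_ext_def truncated_norm_def truncate_seq_def
      heinz_diff_def)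

lemma heinz_diff_norm_measurable:
  "heinz_diff_norm g A B X \<in> borel_measurable (restrict_space lborel {1/4..3/4})"
proof -
  have "truncated_norm n \<in> borel_measurable (restrict_space borel {1/4..3/4})" for n
    by (rule borel_measurable_continuous_on_restrict[OF continuous_on_truncated_norm])
  then have "truncated_norm n \<in> borel_measurable (restrict_space lborel {1/4..3/4})" for n
    by (simp cong: measurable_cong_sets add: sets_restrict_space)
  then have "(\<lambda>\<nu>. SUP n. ennreal (truncated_norm n \<nu>)) \<in> borel_measurable (restrict_space lborel {1/4..3/4})"
    by (intro borel_measurable_SUP) auto
  then show ?thesis
    by (simp add: heinz_diff_norm_eq_SUP[abs_def])
qed

lemma heinz_diff_norm_integral:
  "(\<integral>\<^sup>+\<nu>\<in>{1/4..3/4}. heinz_diff_norm g A B X \<nu> \<partial>lborel)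
    \<le> ennreal (1/8) * heinz_diff_norm g A B X (1/4) + ennreal (1/4) * heinz_diff_norm g A B X (3/8)"
proof -
  have "(\<integral>\<^sup>+\<nu>\<in>{1/4..3/4}. heinz_diff_norm g A B X \<nu> \<partial>lborel)
      = (\<integral>\<^sup>+\<nu>. (SUP n. ennreal (truncated_norm n \<nu>) * indicator {1/4..3/4} \<nu>) \<partial>lborel)"
    by (simp add: heinz_diff_norm_eq_SUP SUP_mult_right_ennreal)
  also have "\<dots> = (SUP n. \<integral>\<^sup>+\<nu>\<in>{1/4..3/4}. ennreal (truncated_norm n \<nu>) \<partial>lborel)"
  proof (rule nn_integral_monotone_convergence_SUP)
    show "incseq (\<lambda>n \<nu>. ennreal (truncated_norm n \<nu>) * indicator {1/4..3/4} \<nu>)"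
      using incseqD[OF incseq_truncated_norm]
      by (auto simp: incseq_def le_fun_def ennreal_leI split: split_indicator)
    fix n
    show "(\<lambda>\<nu>. ennreal (truncated_norm n \<nu>) * indicator {1/4..3/4} \<nu>) \<in> borel_measurable lborel"
      by (rule truncated_norm_indicator_measurable) auto
  qed
  also have "\<dots> \<le> ennreal (1/8) * heinz_diff_norm g A B X (1/4) + ennreal (1/4) * heinz_diff_norm g A B X (3/8)"
  proof (rule SUP_least)
    fix n
    have le: "ennreal (truncated_norm n \<nu>) \<le> heinz_diff_norm g A B X \<nu>" for \<nu>
      unfolding heinz_diff_norm_eq_SUP by (rule SUP_upper) simp
    have "(\<integral>\<^sup>+\<nu>\<in>{1/4..3/4}. ennreal (truncated_norm n \<nu>) \<partial>lborel)
        \<le> ennreal (1/8 * truncated_norm n (1/4) + 1/4 * truncated_norm n (3/8))"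
      by (rule truncated_norm_integral)
    also have "\<dots> = ennreal (1/8) * ennreal (truncated_norm n (1/4))
        + ennreal (1/4) * ennreal (truncated_norm n (3/8))"
      using truncated_norm_nonneg[of n "1/4"] truncated_norm_nonneg[of n "3/8"]
      by (subst ennreal_plus) (auto simp flip: ennreal_mult)
    also have "\<dots> \<le> ennreal (1/8) * heinz_diff_norm g A B X (1/4)
        + ennreal (1/4) * heinz_diff_norm g A B X (3/8)"
      by (intro add_mono mult_left_mono le) auto
    finally show "(\<integral>\<^sup>+\<nu>\<in>{1/4..3/4}. ennreal (truncated_norm n \<nu>) \<partial>lborel)
        \<le> ennreal (1/8) * heinz_diff_norm g A B X (1/4) + ennreal (1/4) * heinz_diff_norm g A B X (3/8)" .
  qed
  finally show ?thesis .
qed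

end

end

theorem theorem5p4:
  fixes A B X :: "'a::complex_hilbert_space \<Rightarrow>\<^sub>L 'a"
    and g :: "(nat \<Rightarrow> real) \<Rightarrow> real"
  assumes "separable_space (euclidean :: 'a topology)"
    and "symmetric_gauge g"
    and "A \<in> positive_ops" and "B \<in> positive_ops"
    and "X \<in> norm_ideal g"
  shows "heinz_diff_norm g A B X \<in> borel_measurable (restrict_space lborel {1/4..3/4}) \<and>
    (\<integral>\<^sup>+\<nu>\<in>{1/4..3/4}. heinz_diff_norm g A B X \<nu> \<partial>lborel)
      \<le> ennreal (1/8) * heinz_diff_norm g A B X (1/4) + ennreal (1/4) * heinz_diff_norm g A B X (3/8)"
proof -
  have "X \<in> compact_ops"
    using assms(5) by (simp add: norm_ideal_def)
  then have X: "X \<in> bounded_ops" "compact_map X"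
    using compact_ops_compact_map by (auto simp: compact_ops_def)
  show ?thesis
    using heinz_diff_norm_measurable[OF assms(3,4) X assms(2)]
      heinz_diff_norm_integral[OF assms(3,4) X assms(2)] by blast
qed

end
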